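(* Let $\{W(t),t\in\mathbb{R}^d\}$ be a sample-continuous zero-mean Gaussian process with stationary increments and variance $\sigma^2(t)=\operatorname{Var}W(t)$. Suppose that $$\lim_{\|t\|\to\infty}\bigl(W(t)-\sigma^2(t)/2\bigr)=-\infty\quad\text{a.s.}$$ Let $W_i$, $i\in\mathbb{N}$, be independent copies of $W$ and, independently of the $W_i$, let $\sum_{i=1}^\infty\delta_{U_i}$ be a Poisson point process on $\mathbb{R}$ with intensity $e^{-y}\,dy$. Then the process $$\eta(t)=\bigvee_{i=1}^\infty\bigl(U_i+W_i(t)-\sigma^2(t)/2\bigr),\qquad t\in\mathbb{R}^d,$$ has a representation as a mixed moving maxima process.
   Context: A process $\{W(t),t\in\mathbb{R}^d\}$ has stationary increments if the law of $\{W(t+t_0)-W(t_0),t\in\mathbb{R}^d\}$ does not depend on $t_0\in\mathbb{R}^d$. Gaussian processes with stationary increments are assumed to have zero mean. $\|\cdot\|$ is the Euclidean norm; $\bigvee$ denotes the supremum. Mixed moving maxima process: let $\{F(t),t\in\mathbb{R}^d\}$ be a measurable process with $\mathbb{E}\int_{\mathbb{R}^d}e^{F(t)}\,dt<\infty$. Let $\sum_{i=1}^\infty\delta_{(t_i,y_i)}$ be a Poisson point process on $\mathbb{R}^d\times\mathbb{R}$ with intensity $e^{-y}\,dt\,dy$ ($dt$ being Lebesgue measure on $\mathbb{R}^d$), and let $F_i$, $i\in\mathbb{N}$, be independent copies of $F$, independent of this point process. Then a process of the form $\bigvee_{i=1}^\infty(F_i(t-t_i)+y_i)$, $t\in\mathbb{R}^d$,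 is called a mixed moving maxima process. Saying that $\eta$ has a representation as a mixed moving maxima process means that there is such an $F$ for which $\eta$ has the same law as the resulting process. *)

theory Defs
  imports "HOL-Probability.Probability"
begin

text \<open>
  A process indexed by \<open>'t\<close> on a probability space \<open>M\<close> is a function \<open>X :: 't \<Rightarrow> 'w \<Rightarrow> 'b\<close>.
  Its law is a measure on the product \<open>\<sigma>\<close>-algebra, so two processes have the same law iff
  their finite-dimensional distributions agree.
\<close>

abbreviation path_space :: "('t \<Rightarrow> 'b::topological_space) measure" where
  "path_space \<equiv> Pi\<^sub>M UNIV (\<lambda>_. borel)"

definition process_law :: "'w measure \<Rightarrow> ('t \<Rightarrow> 'w \<Rightarrow> 'b::topological_space) \<Rightarrow> ('t \<Rightarrow> 'b) measure" where
  "process_law M X = distr M path_space (\<lambda>\<omega> t. X t \<omega>)"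

definition measurable_process ::
    "'w measure \<Rightarrow> ('t::topological_space \<Rightarrow> 'w \<Rightarrow> 'b::topological_space) \<Rightarrow> bool" where
  "measurable_process M X \<longleftrightarrow> (\<lambda>(t, \<omega>). X t \<omega>) \<in> borel \<Otimes>\<^sub>M M \<rightarrow>\<^sub>M borel"

definition sample_continuous ::
    "'w measure \<Rightarrow> ('t::topological_space \<Rightarrow> 'w \<Rightarrow> 'b::topological_space) \<Rightarrow> bool" where
  "sample_continuous M X \<longleftrightarrow> (AE \<omega> in M. continuous_on UNIV (\<lambda>t. X t \<omega>))"

definition stationary_increments ::
    "'w measure \<Rightarrow> ('t::ab_group_add \<Rightarrow> 'w \<Rightarrow> real) \<Rightarrow> bool" where
  "stationary_increments M X \<longleftrightarrow>
     (\<forall>s s'. process_law M (\<lambda>t \<omega>. X (t + s) \<omega> - X s \<omega>)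
           = process_law M (\<lambda>t \<omega>. X (t + s') \<omega> - X s' \<omega>))"

text \<open>Point masses count as (degenerate) normal distributions.\<close>

definition gaussian_variable :: "'w measure \<Rightarrow> ('w \<Rightarrow> real) \<Rightarrow> bool" where
  "gaussian_variable M X \<longleftrightarrow>
     X \<in> borel_measurable M \<and>
     (\<exists>m. distr M borel X = return borel m \<or>
          (\<exists>s>0. distributed M lborel X (\<lambda>x. ennreal (normal_density m s x))))"

definition gaussian_process :: "'w measure \<Rightarrow> ('t \<Rightarrow> 'w \<Rightarrow> real) \<Rightarrow> bool" where
  "gaussian_process M X \<longleftrightarrow>
     (\<forall>T (a :: 't \<Rightarrow> real). finite T \<longrightarrow> gaussian_variable M (\<lambda>\<omega>. \<Sum>t\<in>T. a t * X t \<omega>))"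

definition zero_mean :: "'w measure \<Rightarrow> ('t \<Rightarrow> 'w \<Rightarrow> real) \<Rightarrow> bool" where
  "zero_mean M X \<longleftrightarrow> (\<forall>t. prob_space.expectation M (X t) = 0)"

text \<open>
  The library's \<open>indep_var\<close> requires both random variables to take values in the same type;
  this is the heterogeneous version.
\<close>

definition independent_rvs ::
    "'w measure \<Rightarrow> 'a measure \<Rightarrow> ('w \<Rightarrow> 'a) \<Rightarrow> 'b measure \<Rightarrow> ('w \<Rightarrow> 'b) \<Rightarrow> bool" where
  "independent_rvs M A X B Y \<longleftrightarrow>
     X \<in> M \<rightarrow>\<^sub>M A \<and> Y \<in> M \<rightarrow>\<^sub>M B \<and>
     prob_space.indep_set M {X -` S \<inter> space M | S. S \<in> sets A}
                            {Y -` S \<inter> space M | S. S \<in> sets B}"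

definition independent_copies ::
    "'v measure \<Rightarrow> (nat \<Rightarrow> 't \<Rightarrow> 'v \<Rightarrow> real) \<Rightarrow> 'w measure \<Rightarrow> ('t \<Rightarrow> 'w \<Rightarrow> real) \<Rightarrow> bool" where
  "independent_copies N Xs M X \<longleftrightarrow>
     prob_space.indep_vars N (\<lambda>_. path_space) (\<lambda>i \<omega> t. Xs i t \<omega>) UNIV \<and>
     (\<forall>i. process_law N (Xs i) = process_law M X)"

text \<open>
  The whole sequence of points, and not only the point set it enumerates, is required to be
  independent of the processes: otherwise the enumeration could depend on the processes.
\<close>

definition points_independent_of ::
    "'w measure \<Rightarrow> 'p measure \<Rightarrow> (nat \<Rightarrow> 'w \<Rightarrow> 'p) \<Rightarrow> (nat \<Rightarrow> 't \<Rightarrow> 'w \<Rightarrow> real) \<Rightarrow> bool" where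
  "points_independent_of M S P Xs \<longleftrightarrow>
     independent_rvs M (Pi\<^sub>M UNIV (\<lambda>_. S)) (\<lambda>\<omega> i. P i \<omega>)
                       (Pi\<^sub>M UNIV (\<lambda>_. path_space)) (\<lambda>\<omega> i t. Xs i t \<omega>)"

definition point_count :: "(nat \<Rightarrow> 'w \<Rightarrow> 'p) \<Rightarrow> 'p set \<Rightarrow> 'w \<Rightarrow> ennreal" where
  "point_count P A \<omega> = emeasure (count_space UNIV) {i. P i \<omega> \<in> A}"

text \<open>\<open>\<Sum>i. \<delta>(P i)\<close> is a Poisson point process with intensity measure \<open>\<mu>\<close>.\<close>

definition poisson_point_process ::
    "'w measure \<Rightarrow> 'p measure \<Rightarrow> (nat \<Rightarrow> 'w \<Rightarrow> 'p) \<Rightarrow> bool" where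
  "poisson_point_process M \<mu> P \<longleftrightarrow>
     (\<forall>i. P i \<in> M \<rightarrow>\<^sub>M \<mu>) \<and>
     (\<forall>A\<in>sets \<mu>. emeasure \<mu> A < \<infinity> \<longrightarrow>
        (\<forall>k. measure M {\<omega> \<in> space M. point_count P A \<omega> = of_nat k}
             = measure \<mu> A ^ k / fact k * exp (- measure \<mu> A))) \<and>
     (\<forall>A\<in>sets \<mu>. emeasure \<mu> A = \<infinity> \<longrightarrow> (AE \<omega> in M. point_count P A \<omega> = \<infinity>)) \<and>
     (\<forall>(n::nat) A. (\<forall>j<n. A j \<in> sets \<mu>) \<and> disjoint_family_on A {..<n} \<longrightarrow>
        prob_space.indep_vars M (\<lambda>_. borel) (\<lambda>j. point_count P (A j)) {..<n})"

text \<open>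
  Suprema are taken in the extended reals, where they always exist.
  The process \<open>Z\<close> on \<open>N\<close> is the mixed moving maxima process generated by the process \<open>F\<close> on \<open>M\<close>.
\<close>

definition mixed_moving_maxima ::
    "'w measure \<Rightarrow> (real^'d \<Rightarrow> 'w \<Rightarrow> real) \<Rightarrow> 'v measure \<Rightarrow> (real^'d \<Rightarrow> 'v \<Rightarrow> ereal) \<Rightarrow> bool" where
  "mixed_moving_maxima M F N Z \<longleftrightarrow>
     prob_space M \<and> measurable_process M F \<and>
     (\<integral>\<^sup>+\<omega>. (\<integral>\<^sup>+t. ennreal (exp (F t \<omega>)) \<partial>lborel) \<partial>M) < \<infinity> \<and>
     prob_space N \<and>
     (\<exists>(T :: nat \<Rightarrow> 'v \<Rightarrow> real^'d) (Y :: nat \<Rightarrow> 'v \<Rightarrow> real) Fs.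
        poisson_point_process N
          (density (lborel \<Otimes>\<^sub>M lborel) (\<lambda>(t, y). ennreal (exp (- y)))) (\<lambda>i \<omega>. (T i \<omega>, Y i \<omega>)) \<and>
        (\<forall>i. measurable_process N (Fs i)) \<and>
        independent_copies N Fs M F \<and>
        points_independent_of N (borel \<Otimes>\<^sub>M borel) (\<lambda>i \<omega>. (T i \<omega>, Y i \<omega>)) Fs \<and>
        (\<forall>t. \<forall>\<omega>\<in>space N. Z t \<omega> = (SUP i. ereal (Fs i (t - T i \<omega>) \<omega> + Y i \<omega>))))"

text \<open>
  The sample spaces have to be drawn from fixed types. This loses no generality: the
  \<open>\<sigma>\<close>-algebras on them are arbitrary, the types have at least the cardinality of the continuum,
  and a jointly measurable real process depends on the sample point only through countably many
  events, so countably many such processes and random points can always be realised on a Cantor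
  space. The law of \<open>Z\<close> is determined by that of \<open>F\<close>, so asking for one realisation \<open>Z\<close> suffices.
\<close>

definition has_mixed_moving_maxima_representation ::
    "'w measure \<Rightarrow> (real^'d \<Rightarrow> 'w \<Rightarrow> ereal) \<Rightarrow> bool" where
  "has_mixed_moving_maxima_representation M \<eta> \<longleftrightarrow>
     (\<exists>(P :: (real^'d \<Rightarrow> real) measure) F
       (Q :: (nat \<Rightarrow> (real^'d \<times> real) \<times> (real^'d \<Rightarrow> real)) measure) Z.
        mixed_moving_maxima P F Q Z \<and> process_law M \<eta> = process_law Q Z)"

end

theory Submission
  imports Defs
begin

text \<open>
  Let \<open>v t = W t - \<sigma>\<^sup>2 t / 2\<close>. By a Gaussian change of measure, the path of \<open>v\<close> seen from \<open>s\<close>, that is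
  \<open>t \<mapsto> v (t + s) - v s\<close>, has under the probability with density \<open>exp (v s)\<close> a law which does not depend on
  \<open>s\<close>. As the paths are continuous and tend to \<open>-\<infinity>\<close>, the set \<open>A\<close> of all \<open>s\<close> where \<open>v s\<close> is within \<open>1\<close> of
  the maximum has finite positive Lebesgue measure. Choosing \<open>s\<close> uniformly in \<open>A\<close> and changing the measure gives,
  for every functional \<open>G\<close> with \<open>G (f + c) = exp c * G f\<close>, the identity
  \<open>E (G v) = \<integral> E (G (F (\<cdot> - s))) ds\<close>, where \<open>F\<close> is the path seen from \<open>0\<close> under the density \<open>exp (v 0)\<close>,
  conditioned on \<open>0 \<in> A\<close> and shifted by a suitable function of the path. The finite-dimensional distribution
  functions of both maxima processes are exponentials of such expressions, by the Laplace functional of a marked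
  Poisson process.
\<close>

section \<open>Uniqueness of laws with finite exponential moments\<close>

text \<open>The plateau replaces the argmax. An argmax would need a measurable choice among ties,
  and it may be a Lebesgue null set; the plateau is a neighbourhood of every maximiser, so a uniform
  choice from it makes sense. In return the chosen origin is only a near-maximiser, and the shift of
  the path corrects for the size of the plateau.

  \<open>W 0\<close> is not assumed to vanish, so even the origin is reached only under the density
  \<open>exp (v 0)\<close>, on the same footing as every other \<open>s\<close>.

  Laws of processes are compared through scalar quantities: tilted laws through exponential moments
  of linear combinations, which is what \<open>gaussian_process\<close> controls, and maxima through
  the probability that finitely many coordinates stay below thresholds, which is a void probability
  of a Poisson process. Homogeneity under \<open>f + c\<close> reflects the intensity
  \<open>exp (- u)\<close>: shifting the points by \<open>c\<close> multiplies it by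
  \<open>exp c\<close>.

  The path hypotheses hold almost surely only, hence a modification. A Poisson process on the
  product space is not given and has to be built from \<open>U\<close>.\<close>

lemma powser_eq_0_imp_coeffs_0:
  fixes a :: "nat \<Rightarrow> real"
  assumes sums: "\<And>x. 0 < x \<Longrightarrow> x < 1 \<Longrightarrow> (\<lambda>n. a n * x ^ n) sums 0"
  shows "a n = 0"
proof (induction n rule: less_induct)
  case (less n)
  \<comment> \<open>Dividing by the power \<open>x ^ n\<close> makes the first coefficient not yet
    known to vanish the constant term \<open>b 0\<close>.\<close>
  define b where "b = (\<lambda>k. a (k + n))"
  have sums_b: "(\<lambda>k. b k * x ^ k) sums 0" if x: "0 < x" "x < 1" for x
  proof -
    have "(\<lambda>k. a (k + n) * x ^ (k + n)) sums (0 - (\<Sum>k<n. a k * x ^ k))"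
      using sums[OF x] by (subst sums_iff_shift) simp
    moreover have "(\<Sum>k<n. a k * x ^ k) = 0" using less by simp
    ultimately have "(\<lambda>k. x ^ n * (b k * x ^ k)) sums (x ^ n * 0)"
      by (simp add: b_def power_add ac_simps)
    then show ?thesis using x by (subst (asm) sums_mult_iff) auto
  qed
  define f where "f x = (\<Sum>k. b k * x ^ k)" for x
  have su: "summable (\<lambda>k. b k * (1/2) ^ k)" using sums_b[of "1/2"] by (simp add: sums_iff)
  have "(\<lambda>k. b k * x ^ k) sums f x" if "norm x < 1/2" for x
    unfolding f_def using that by (intro summable_sums powser_inside[OF su]) simp
  then have "(f \<longlongrightarrow> b 0) (at 0)"
    by (intro powser_limit_0[where s="1/2"]) auto
  \<comment> \<open>The values are known for positive \<open>x\<close> only, so the constant term is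
    read off as a right-hand limit.\<close>
  then have "(f \<longlongrightarrow> b 0) (at_right 0)" by (rule filterlim_mono) (auto simp: at_within_le_at)
  moreover have "eventually (\<lambda>x. f x = 0) (at_right (0::real))"
    unfolding eventually_at_right_field f_def using sums_b by (intro exI[of _ 1]) (auto simp: sums_iff)
  ultimately have "((\<lambda>_. 0) \<longlongrightarrow> b 0) (at_right (0::real))"
    by (subst (asm) tendsto_cong) auto
  then have "b 0 = 0" by (simp add: tendsto_const_iff)
  then show ?case by (simp add: b_def)
qed

text \<open>The partial sums of the exponential series are dominated by
  \<open>exp (norm z * \<bar>x\<bar>)\<close>, which is integrable because exponential moments of
  both signs are finite. A complex \<open>z\<close> is allowed because real arguments serve to
  identify the moments, and imaginary ones then give the characteristic function.\<close>

lemma exp_series_integral: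
  fixes M :: "real measure" and z :: complex
  assumes "finite_measure M" and sets[measurable_cong]: "sets M = sets borel"
    and int: "\<And>a. integrable M (\<lambda>x. exp (a * x))"
  shows "(\<lambda>n. z ^ n / fact n * of_real (\<integral>x. x ^ n \<partial>M)) sums (\<integral>x. exp (z * of_real x) \<partial>M)"
proof -
  interpret finite_measure M by fact
  have dom: "integrable M (\<lambda>x. exp (c * \<bar>x\<bar>))" for c :: real
    by (rule Bochner_Integration.integrable_bound[OF Bochner_Integration.integrable_add[OF int[of c] int[of "-c"]]])
       (simp_all add: abs_of_pos add_pos_pos, auto simp: abs_real_def)
  have pow: "integrable M (\<lambda>x. x ^ n)" for n
  proof (rule Bochner_Integration.integrable_bound[OF integrable_mult_right[OF dom[of 1], of "fact n"]])
    show "AE x in M. norm (x ^ n) \<le> norm (fact n * exp (1 * \<bar>x\<bar>))"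
    proof (rule AE_I2)
      fix x :: real
      have "\<bar>x\<bar> ^ n /\<^sub>R fact n \<le> exp \<bar>x\<bar>"
        using sum_le_suminf[OF summable_exp_generic[of "\<bar>x\<bar>"], of "{n}"] by (simp add: exp_def)
      then show "norm (x ^ n) \<le> norm (fact n * exp (1 * \<bar>x\<bar>))"
        by (simp add: power_abs field_simps)
    qed
  qed simp
  have "(\<lambda>N. \<integral>x. (\<Sum>n<N. (z * of_real x) ^ n /\<^sub>R fact n) \<partial>M) \<longlonglongrightarrow> (\<integral>x. exp (z * of_real x) \<partial>M)"
  proof (rule integral_dominated_convergence[where w="\<lambda>x. exp (norm z * \<bar>x\<bar>)"])
    show "AE x in M. (\<lambda>N. \<Sum>n<N. (z * of_real x) ^ n /\<^sub>R fact n) \<longlonglongrightarrow> exp (z * of_real x)"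
      using exp_converges by (auto simp: sums_def)
    show "AE x in M. norm (\<Sum>n<N. (z * of_real x) ^ n /\<^sub>R fact n) \<le> exp (norm z * \<bar>x\<bar>)" for N
    proof (rule AE_I2)
      fix x :: real
      have "norm (\<Sum>n<N. (z * of_real x) ^ n /\<^sub>R fact n) \<le> (\<Sum>n<N. (norm z * \<bar>x\<bar>) ^ n /\<^sub>R fact n)"
        by (rule sum_norm_le) (simp add: norm_power norm_mult)
      also have "\<dots> \<le> exp (norm z * \<bar>x\<bar>)"
        unfolding exp_def by (intro sum_le_suminf summable_exp_generic) auto
      finally show "norm (\<Sum>n<N. (z * of_real x) ^ n /\<^sub>R fact n) \<le> exp (norm z * \<bar>x\<bar>)" .
    qed
  qed (use dom in auto)
  moreover have "(\<integral>x. (\<Sum>n<N. (z * of_real x) ^ n /\<^sub>R fact n) \<partial>M)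
      = (\<Sum>n<N. z ^ n / fact n * of_real (\<integral>x. x ^ n \<partial>M))" for N
  proof -
    have *: "(z * of_real x) ^ n /\<^sub>R fact n = z ^ n / fact n * of_real (x ^ n)" for x n
      by (simp add: power_mult_distrib scaleR_conv_of_real divide_simps)
    have i: "integrable M (\<lambda>x. z ^ n / fact n * complex_of_real (x ^ n))" for n
      by (intro integrable_mult_right integrable_of_real pow)
    show ?thesis unfolding *
      by (subst Bochner_Integration.integral_sum[OF i])
        (simp only: integral_mult_right_zero integral_complex_of_real)
  qed
  ultimately show ?thesis by (simp add: sums_def)
qed

text \<open>The exponential integrals are power series in the moments. Agreement at real arguments
  forces equal moments, equal moments give equal characteristic functions, and Levy uniqueness
  applies after scaling to mass one. General finite measures are treated because the lemma is
  applied to measures weighted by a density.\<close>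

lemma measure_eqI_exp_integrals:
  fixes M N :: "real measure"
  assumes sM[measurable_cong]: "sets M = sets borel" and sN[measurable_cong]: "sets N = sets borel"
    and eq: "\<And>a. (\<integral>\<^sup>+x. ennreal (exp (a * x)) \<partial>M) = (\<integral>\<^sup>+x. ennreal (exp (a * x)) \<partial>N)"
    and fin: "\<And>a. (\<integral>\<^sup>+x. ennreal (exp (a * x)) \<partial>M) < \<infinity>"
  shows "M = N"
proof -
  have tot: "emeasure M UNIV = emeasure N UNIV" "emeasure M UNIV < \<infinity>"
    using eq[of 0] fin[of 0] sM sN by (auto simp: sets_eq_imp_space_eq)
  have spM: "space M = UNIV" and spN: "space N = UNIV" using sM sN by (auto dest: sets_eq_imp_space_eq)
  interpret M: finite_measure M using tot by (intro finite_measureI) (simp add: spM)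
  interpret N: finite_measure N using tot by (intro finite_measureI) (simp add: spN)
  have iM: "integrable M (\<lambda>x. exp (a * x))" and iN: "integrable N (\<lambda>x. exp (a * x))" for a
    using eq[of a] fin[of a] by (auto simp: integrable_iff_bounded)
  have ieq: "(\<integral>x. exp (a * x) \<partial>M) = (\<integral>x. exp (a * x) \<partial>N)" for a
    by (simp add: integral_eq_nn_integral eq)
  define d where "d n = ((\<integral>x. x ^ n \<partial>M) - (\<integral>x. x ^ n \<partial>N)) / fact n" for n
  have "d n = 0" for n
  proof (rule powser_eq_0_imp_coeffs_0)
    fix x :: real
    have "(\<lambda>n. of_real (x) ^ n / fact n * of_real (\<integral>x. x ^ n \<partial>M) -
           of_real x ^ n / fact n * of_real (\<integral>x. x ^ n \<partial>N)) sums
        ((\<integral>y. exp (of_real x * complex_of_real y) \<partial>M) - (\<integral>y. exp (of_real x * complex_of_real y) \<partial>N))"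
      by (intro sums_diff exp_series_integral iM iN sM sN M.finite_measure_axioms N.finite_measure_axioms)
    also have "(\<integral>y. exp (of_real x * complex_of_real y) \<partial>M) = of_real (\<integral>y. exp (x * y) \<partial>M)"
      unfolding integral_complex_of_real[symmetric] by (simp only: exp_of_real[symmetric] of_real_mult)
    also have "(\<integral>y. exp (of_real x * complex_of_real y) \<partial>N) = of_real (\<integral>y. exp (x * y) \<partial>M)"
      unfolding ieq integral_complex_of_real[symmetric] by (simp only: exp_of_real[symmetric] of_real_mult)
    also have "(\<lambda>n. of_real (x) ^ n / fact n * of_real (\<integral>x. x ^ n \<partial>M) -
           of_real x ^ n / fact n * of_real (\<integral>x. x ^ n \<partial>N)) = (\<lambda>n. complex_of_real (d n * x ^ n))"
      by (auto simp: d_def field_simps)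
    finally have "(\<lambda>n. complex_of_real (d n * x ^ n)) sums complex_of_real 0" by (simp only: diff_self of_real_0)
    then show "(\<lambda>n. d n * x ^ n) sums 0" by (simp only: sums_of_real_iff)
  qed
  then have mom: "(\<integral>x. x ^ n \<partial>M) = (\<integral>x. x ^ n \<partial>N)" for n by (simp add: d_def)
  have ch: "char M t = char N t" for t
    using exp_series_integral[OF M.finite_measure_axioms sM iM, of "\<i> * of_real t"]
      exp_series_integral[OF N.finite_measure_axioms sN iN, of "\<i> * of_real t"]
    by (simp add: mom char_def sums_iff mult.assoc)
  define c where "c = measure M UNIV"
  have c: "measure N UNIV = c" using tot by (simp add: c_def measure_def)
  show ?thesis
  \<comment> \<open>The null measure cannot be scaled to a probability measure.\<close>
  proof (cases "c = 0")
    case True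
    then have "emeasure M A = 0" "emeasure N A = 0" for A
      using c M.emeasure_eq_measure[of A] N.emeasure_eq_measure[of A] M.bounded_measure[of A] N.bounded_measure[of A]
      by (auto simp: c_def spM spN intro!: antisym)
    then show ?thesis by (intro measure_eqI) (auto simp: sM sN)
  next
    case False
    then have cp: "c > 0" by (simp add: c_def zero_less_measure_iff)
    define S :: "real measure \<Rightarrow> real measure" where "S K = scale_measure (ennreal (1 / c)) K" for K
    have rd: "real_distribution (S K)" if "sets K = sets borel" "finite_measure K" "measure K UNIV = c" for K
    proof -
      interpret K: finite_measure K by fact
      have "emeasure K UNIV = ennreal c" using that(3) K.emeasure_eq_measure by simp
      then have "emeasure (S K) (space (S K)) = 1"
        using cp sets_eq_imp_space_eq[OF that(1)] by (simp add: S_def space_scale_measure flip: ennreal_mult)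
      then show ?thesis using that(1)
        by (intro real_distribution.intro prob_spaceI real_distribution_axioms.intro)
          (auto simp: S_def dest: sets_eq_imp_space_eq)
    qed
    have chS: "char (S K) t = char K t /\<^sub>R c" if "sets K = sets borel" for K t
    proof -
      have [measurable_cong]: "sets K = sets borel" by fact
      have "S K = density K (\<lambda>_. ennreal (1/c))"
        unfolding S_def by (intro measure_eqI) (auto simp: emeasure_density nn_integral_cmult)
      then show ?thesis using cp unfolding char_def by (simp add: integral_density divide_inverse)
    qed
    have "S M = S N"
      by (intro Levy_uniqueness rd sM sN ext) 
        (auto simp: M.finite_measure_axioms N.finite_measure_axioms c_def[symmetric] c chS sM sN ch)
    then have "emeasure (S M) A = emeasure (S N) A" for A by simp
    then have "ennreal c * (ennreal (1/c) * emeasure M A) = ennreal c * (ennreal (1/c) * emeasure N A)" for A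
      by (simp add: S_def)
    then have "emeasure M A = emeasure N A" for A
      using cp by (simp flip: mult.assoc ennreal_mult)
    then show ?thesis by (intro measure_eqI) (auto simp: sM sN)
  qed
qed

lemma nn_integral_distr_density:
  assumes [measurable]: "X \<in> M \<rightarrow>\<^sub>M S" "f \<in> borel_measurable M" "g \<in> borel_measurable S"
  shows "(\<integral>\<^sup>+x. g x \<partial>distr (density M f) S X) = (\<integral>\<^sup>+\<omega>. f \<omega> * g (X \<omega>) \<partial>M)"
  by (subst nn_integral_distr) (auto simp: nn_integral_density)

lemma distr_path_space_eqI_exp:
  fixes X :: "'t \<Rightarrow> 'a \<Rightarrow> real" and Y :: "'t \<Rightarrow> 'b \<Rightarrow> real"
  assumes X[measurable]: "\<And>t. X t \<in> borel_measurable M" and Y[measurable]: "\<And>t. Y t \<in> borel_measurable N"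
    and eq: "\<And>T a. finite T \<Longrightarrow> (\<integral>\<^sup>+\<omega>. ennreal (exp (\<Sum>t\<in>T. a t * X t \<omega>)) \<partial>M)
               = (\<integral>\<^sup>+\<omega>. ennreal (exp (\<Sum>t\<in>T. a t * Y t \<omega>)) \<partial>N)"
    and fin: "\<And>T a. finite T \<Longrightarrow> (\<integral>\<^sup>+\<omega>. ennreal (exp (\<Sum>t\<in>T. a t * X t \<omega>)) \<partial>M) < \<infinity>"
  shows "distr M path_space (\<lambda>\<omega> t. X t \<omega>) = distr N path_space (\<lambda>\<omega> t. Y t \<omega>)"
proof -
  \<comment> \<open>The exponential weights are replaced by indicators one coordinate at a time, so that the
    one-dimensional uniqueness theorem suffices.\<close>
  have *: "(\<integral>\<^sup>+\<omega>. (\<Prod>k\<in>K. indicator (B k) (X k \<omega>)) * ennreal (exp (\<Sum>t\<in>T. a t * X t \<omega>)) \<partial>M)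
      = (\<integral>\<^sup>+\<omega>. (\<Prod>k\<in>K. indicator (B k) (Y k \<omega>)) * ennreal (exp (\<Sum>t\<in>T. a t * Y t \<omega>)) \<partial>N)"
    if "finite K" "finite T" "\<And>k. k \<in> K \<Longrightarrow> B k \<in> sets borel" for K B T and a :: "'t \<Rightarrow> real"
    using that
  proof (induction K arbitrary: T a rule: finite_induct)
    case empty
    then show ?case using eq by simp
  next
    case (insert k K)
    have B[measurable]: "B k \<in> sets borel" and BK: "\<And>j. j \<in> K \<Longrightarrow> B j \<in> sets borel"
      using insert.prems by auto
    define f where "f \<omega> = (\<Prod>k\<in>K. indicator (B k) (X k \<omega>)) * ennreal (exp (\<Sum>t\<in>T. a t * X t \<omega>))" for \<omega>
    define g where "g \<omega> = (\<Prod>k\<in>K. indicator (B k) (Y k \<omega>)) * ennreal (exp (\<Sum>t\<in>T. a t * Y t \<omega>))" for \<omega>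
    have ind: "(\<lambda>\<omega>. indicator (B k) (Z k \<omega>) :: ennreal) \<in> borel_measurable L"
      if "\<And>t. Z t \<in> borel_measurable L" "k \<in> K" for k L and Z :: "'t \<Rightarrow> 'c \<Rightarrow> real"
      using that BK[OF that(2)] by measurable
    have f[measurable]: "f \<in> borel_measurable M"
      unfolding f_def by (intro borel_measurable_times_ennreal borel_measurable_prod_ennreal ind X) measurable
    have g[measurable]: "g \<in> borel_measurable N"
      unfolding g_def by (intro borel_measurable_times_ennreal borel_measurable_prod_ennreal ind Y) measurable
    \<comment> \<open>\<open>k\<close> may already belong to \<open>T\<close>, so \<open>c\<close>
      is added to its coefficient instead of replacing it.\<close>
    define a' where "a' c t = (if t \<in> T then a t else 0) + (if t = k then c else 0)" for c t
    have a'_sum: "(\<Sum>t\<in>insert k T. a' c t * z t) = c * z k + (\<Sum>t\<in>T. a t * z t)" for c and z :: "'t \<Rightarrow> real"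
    proof -
      have "(\<Sum>t\<in>insert k T. a' c t * z t)
          = (\<Sum>t\<in>insert k T. (if t \<in> T then a t * z t else 0)) + (\<Sum>t\<in>insert k T. if t = k then c * z t else 0)"
        by (subst sum.distrib[symmetric]) (auto simp: a'_def algebra_simps intro!: sum.cong)
      also have "(\<Sum>t\<in>insert k T. if t \<in> T then a t * z t else 0) = (\<Sum>t\<in>T. a t * z t)"
        using insert.prems by (intro sum.mono_neutral_cong_right) auto
      also have "(\<Sum>t\<in>insert k T. if t = k then c * z t else 0) = c * z k"
        using insert.prems sum.delta[of "insert k T" k "\<lambda>t. c * z t"] by simp
      finally show ?thesis by simp
    qed
    have tilt: "(\<Prod>k\<in>K. indicator (B k) (z k)) * ennreal (exp (\<Sum>t\<in>insert k T. a' c t * z t))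
        = (\<Prod>k\<in>K. indicator (B k) (z k)) * ennreal (exp (\<Sum>t\<in>T. a t * z t)) * ennreal (exp (c * z k))"
      for c and z :: "'t \<Rightarrow> real"
      by (simp add: a'_sum exp_add ennreal_mult' mult.assoc) (simp add: mult.commute)
    \<comment> \<open>Everything already fixed is put into a density. A further factor
      \<open>exp (c * X k \<omega>)\<close> is then an exponential moment of a measure on the real
      line, and the induction hypothesis, being general in \<open>T\<close> and \<open>a\<close>,
      compares all of these.\<close>
    have "distr (density M f) borel (X k) = distr (density N g) borel (Y k)"
    proof (rule measure_eqI_exp_integrals)
      fix c
      have "(\<integral>\<^sup>+x. ennreal (exp (c * x)) \<partial>distr (density M f) borel (X k))
         = (\<integral>\<^sup>+\<omega>. f \<omega> * ennreal (exp (c * X k \<omega>)) \<partial>M)"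
        by (subst nn_integral_distr_density) auto
      also have eqM: "\<dots> = (\<integral>\<^sup>+\<omega>. (\<Prod>k\<in>K. indicator (B k) (X k \<omega>))
          * ennreal (exp (\<Sum>t\<in>insert k T. a' c t * X t \<omega>)) \<partial>M)"
        unfolding tilt f_def by simp
      also have "\<dots> = (\<integral>\<^sup>+\<omega>. (\<Prod>k\<in>K. indicator (B k) (Y k \<omega>))
          * ennreal (exp (\<Sum>t\<in>insert k T. a' c t * Y t \<omega>)) \<partial>N)"
        using insert.prems BK by (intro insert.IH) auto
      also have "\<dots> = (\<integral>\<^sup>+\<omega>. g \<omega> * ennreal (exp (c * Y k \<omega>)) \<partial>N)"
        unfolding tilt g_def by simp
      also have "\<dots> = (\<integral>\<^sup>+x. ennreal (exp (c * x)) \<partial>distr (density N g) borel (Y k))"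
        by (subst nn_integral_distr_density) auto
      finally show "(\<integral>\<^sup>+x. ennreal (exp (c * x)) \<partial>distr (density M f) borel (X k))
         = (\<integral>\<^sup>+x. ennreal (exp (c * x)) \<partial>distr (density N g) borel (Y k))" .
      have "(\<integral>\<^sup>+x. ennreal (exp (c * x)) \<partial>distr (density M f) borel (X k))
         = (\<integral>\<^sup>+\<omega>. f \<omega> * ennreal (exp (c * X k \<omega>)) \<partial>M)"
        by (subst nn_integral_distr_density) auto
      also note eqM
      also have "(\<integral>\<^sup>+\<omega>. (\<Prod>k\<in>K. indicator (B k) (X k \<omega>))
          * ennreal (exp (\<Sum>t\<in>insert k T. a' c t * X t \<omega>)) \<partial>M)
          \<le> (\<integral>\<^sup>+\<omega>. ennreal (exp (\<Sum>t\<in>insert k T. a' c t * X t \<omega>)) \<partial>M)"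
      proof (intro nn_integral_mono)
        fix \<omega>
        have "(\<Prod>k\<in>K. indicator (B k) (X k \<omega>)) \<le> (1::ennreal)"
          by (intro prod_le_1) (auto split: split_indicator)
        from mult_right_mono[OF this zero_le]
        show "(\<Prod>k\<in>K. indicator (B k) (X k \<omega>)) * ennreal (exp (\<Sum>t\<in>insert k T. a' c t * X t \<omega>))
           \<le> ennreal (exp (\<Sum>t\<in>insert k T. a' c t * X t \<omega>))"
          by (simp only: mult_1_left)
      qed
      also have "\<dots> < \<infinity>" using insert.prems by (intro fin) auto
      finally show "(\<integral>\<^sup>+x. ennreal (exp (c * x)) \<partial>distr (density M f) borel (X k)) < \<infinity>" .
    qed auto
    then have "(\<integral>\<^sup>+x. indicator (B k) x \<partial>distr (density M f) borel (X k))
      = (\<integral>\<^sup>+x. indicator (B k) x \<partial>distr (density N g) borel (Y k))"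
      by simp
    then have "(\<integral>\<^sup>+\<omega>. f \<omega> * indicator (B k) (X k \<omega>) \<partial>M) = (\<integral>\<^sup>+\<omega>. g \<omega> * indicator (B k) (Y k \<omega>) \<partial>N)"
      by (subst (asm) (1 2) nn_integral_distr_density) auto
    then show ?case using insert.hyps unfolding f_def g_def by (simp add: ac_simps)
  qed
  show ?thesis
  proof (rule measure_eqI_PiM_infinite)
    have "emeasure M (space M) < \<infinity>" using fin[of "{}"] by simp
    then show "finite_measure (distr M path_space (\<lambda>\<omega> t. X t \<omega>))"
      by (intro finite_measure.finite_measure_distr finite_measureI measurable_PiM_single') (auto simp: space_PiM)
    fix A :: "'t \<Rightarrow> real set" and J assume J: "finite J" "\<And>i. i \<in> J \<Longrightarrow> A i \<in> sets borel"
    have box: "emeasure (distr L path_space (\<lambda>\<omega> t. Z t \<omega>)) (prod_emb UNIV (\<lambda>_. borel) J (Pi\<^sub>E J A))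
       = (\<integral>\<^sup>+\<omega>. (\<Prod>k\<in>J. indicator (A k) (Z k \<omega>)) * ennreal (exp (\<Sum>t\<in>{}. (\<lambda>_. 0) t * Z t \<omega>)) \<partial>L)"
      if Z[measurable]: "\<And>t. Z t \<in> borel_measurable L" for L and Z :: "'t \<Rightarrow> 'c \<Rightarrow> real"
    proof -
      have "emeasure (distr L path_space (\<lambda>\<omega> t. Z t \<omega>)) (prod_emb UNIV (\<lambda>_. borel) J (Pi\<^sub>E J A))
        = (\<integral>\<^sup>+x. indicator (prod_emb UNIV (\<lambda>_. borel) J (Pi\<^sub>E J A)) x \<partial>distr L path_space (\<lambda>\<omega> t. Z t \<omega>))"
        using J by (subst nn_integral_indicator) (auto intro!: sets_PiM_I)
      also have "\<dots> = (\<integral>\<^sup>+\<omega>. indicator (prod_emb UNIV (\<lambda>_. borel) J (Pi\<^sub>E J A)) (\<lambda>t. Z t \<omega>) \<partial>L)"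
        using J by (intro nn_integral_distr measurable_PiM_single' borel_measurable_indicator sets_PiM_I) auto
      also have "\<dots> = (\<integral>\<^sup>+\<omega>. (\<Prod>k\<in>J. indicator (A k) (Z k \<omega>)) \<partial>L)"
        using J(1) by (intro nn_integral_cong)
          (auto simp: prod_emb_def PiE_iff indicator_def prod_zero_iff intro!: prod.neutral[symmetric])
      finally show ?thesis by simp
    qed
    show "emeasure (distr M path_space (\<lambda>\<omega> t. X t \<omega>)) (prod_emb UNIV (\<lambda>_. borel) J (Pi\<^sub>E J A))
      = emeasure (distr N path_space (\<lambda>\<omega> t. Y t \<omega>)) (prod_emb UNIV (\<lambda>_. borel) J (Pi\<^sub>E J A))"
      unfolding box[of X M, OF X] box[of Y N, OF Y] using J by (intro *) auto
  qed auto
qed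

section \<open>Poisson processes and their Laplace functionals\<close>

text \<open>The function \<open>exp (- x)\<close> on \<open>[0, \<infinity>]\<close>, with value
  \<open>0\<close> at \<open>\<infinity>\<close>. Infinite test functions are wanted because the
  Laplace functional of \<open>\<infinity>\<close> times an indicator is a void probability.
  \<open>neg_ln\<close> is its inverse on \<open>[0, 1]\<close>.\<close>

definition exp_neg :: "ennreal \<Rightarrow> ennreal" where
  "exp_neg x = (if x = \<top> then 0 else ennreal (exp (- enn2real x)))"

definition neg_ln :: "ennreal \<Rightarrow> ennreal" where
  "neg_ln y = (if y = 0 then \<top> else ennreal (- ln (enn2real y)))"

lemma exp_neg_0 [simp]: "exp_neg 0 = 1"
  and exp_neg_top [simp]: "exp_neg \<top> = 0"
  by (simp_all add: exp_neg_def)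

lemma exp_neg_ennreal: "0 \<le> r \<Longrightarrow> exp_neg (ennreal r) = ennreal (exp (- r))"
  by (simp add: exp_neg_def)

lemma exp_neg_le_1: "exp_neg x \<le> 1"
  by (cases x) (auto simp: exp_neg_def)

lemma exp_neg_finite [simp]: "exp_neg x < \<top>" "exp_neg x \<noteq> \<top>"
  using order.strict_trans1[OF exp_neg_le_1[of x] ennreal_one_less_top] by simp_all

lemma exp_neg_antimono: "x \<le> y \<Longrightarrow> exp_neg y \<le> exp_neg x"
  by (cases x; cases y) (auto simp: exp_neg_def top_unique)

lemma exp_neg_add: "exp_neg (x + y) = exp_neg x * exp_neg y"
  by (cases x; cases y) (auto simp: exp_neg_ennreal exp_diff exp_minus divide_inverse simp flip: ennreal_plus ennreal_mult)

lemma exp_neg_sum: "exp_neg (\<Sum>i\<in>I. f i) = (\<Prod>i\<in>I. exp_neg (f i))"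
  by (induction I rule: infinite_finite_induct) (auto simp: exp_neg_add)

lemma exp_neg_eq_0_iff [simp]: "exp_neg x = 0 \<longleftrightarrow> x = \<top>"
  by (auto simp: exp_neg_def)

lemma exp_neg_eq_1_iff [simp]: "exp_neg x = 1 \<longleftrightarrow> x = 0"
  by (cases x) (auto simp: exp_neg_ennreal ennreal_eq_1)

lemma neg_ln_exp_neg: "neg_ln (exp_neg x) = x"
  by (cases x) (auto simp: exp_neg_def neg_ln_def)

lemma exp_neg_neg_ln: assumes "y \<le> 1" shows "exp_neg (neg_ln y) = y"
proof (cases "y = 0")
  case False
  with assms obtain r where "y = ennreal r" "0 < r" "r \<le> 1"
    by (cases y) (auto simp: top_unique)
  then show ?thesis by (simp add: neg_ln_def exp_neg_ennreal)
qed (simp add: neg_ln_def)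

lemma neg_ln_antimono: assumes "x \<le> y" "y \<le> 1" shows "neg_ln y \<le> neg_ln x"
proof -
  obtain r s where "x = ennreal r" "y = ennreal s" "0 \<le> r" "r \<le> s" "s \<le> 1"
    using assms by (cases x; cases y) (auto simp: top_unique)
  then show ?thesis by (auto simp: neg_ln_def intro!: ennreal_leI)
qed

text \<open>An order-reversing bijection from \<open>[0, \<infinity>]\<close> onto
  \<open>[0, 1]\<close> exchanges suprema and infima. For an empty index set the infimum would be
  \<open>\<top>\<close> instead of \<open>1\<close>.\<close>

lemma exp_neg_SUP:
  assumes "I \<noteq> {}"
  shows "exp_neg (SUP i\<in>I. f i) = (INF i\<in>I. exp_neg (f i))"
proof (rule antisym)
  show "exp_neg (SUP i\<in>I. f i) \<le> (INF i\<in>I. exp_neg (f i))"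
    by (intro INF_greatest exp_neg_antimono SUP_upper)
  define m where "m = (INF i\<in>I. exp_neg (f i))"
  have m1: "m \<le> 1" using assms unfolding m_def by (meson INF_lower2 exp_neg_le_1 ex_in_conv)
  have "f i \<le> neg_ln m" if "i \<in> I" for i
  proof -
    have "m \<le> exp_neg (f i)" unfolding m_def using that by (rule INF_lower)
    from neg_ln_antimono[OF this exp_neg_le_1] show ?thesis by (simp add: neg_ln_exp_neg)
  qed
  then have "(SUP i\<in>I. f i) \<le> neg_ln m" by (intro SUP_least)
  then have "exp_neg (neg_ln m) \<le> exp_neg (SUP i\<in>I. f i)" by (rule exp_neg_antimono)
  then show "(INF i\<in>I. exp_neg (f i)) \<le> exp_neg (SUP i\<in>I. f i)"
    using exp_neg_neg_ln[OF m1] by (simp add: m_def)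
qed

text \<open>Turns a sum over all points into a decreasing limit of finite products, to which
  independence and monotone convergence apply.\<close>

lemma exp_neg_suminf: "exp_neg (\<Sum>i. f i) = (INF n. \<Prod>i<n. exp_neg (f i))"
  by (simp add: suminf_eq_SUP exp_neg_SUP exp_neg_sum)

lemma borel_measurable_exp_neg [measurable]: "exp_neg \<in> borel_measurable borel"
  unfolding exp_neg_def[abs_def] by measurable

lemma borel_measurable_neg_ln [measurable]: "neg_ln \<in> borel_measurable borel"
  unfolding neg_ln_def[abs_def] by measurable

lemma point_count_eq_suminf: "point_count P A \<omega> = (\<Sum>i. indicator A (P i \<omega>))"
proof -
  have "(\<Sum>i. indicator A (P i \<omega>)) = (\<integral>\<^sup>+i. indicator {i. P i \<omega> \<in> A} i \<partial>count_space UNIV)"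
    by (subst nn_integral_count_space_nat) (intro arg_cong[of _ _ suminf] ext, simp add: indicator_def)
  then show ?thesis by (simp add: point_count_def)
qed

text \<open>Since a count has countably many values, its Borel events are generated by events of the
  form "exactly \<open>k\<close> points".\<close>

lemma point_count_range: "point_count P A \<omega> \<in> insert \<infinity> (range of_nat)"
proof (cases "finite {i. P i \<omega> \<in> A}")
  case True
  then show ?thesis by (simp add: point_count_def)
qed (simp add: point_count_def)

lemma borel_measurable_point_count [measurable]:
  assumes P: "\<And>i. P i \<in> N \<rightarrow>\<^sub>M \<mu>" and A[measurable]: "A \<in> sets \<mu>"
  shows "point_count P A \<in> borel_measurable N"
proof -
  note P[measurable]
  show ?thesis unfolding point_count_eq_suminf[abs_def] by measurable
qed

lemma suminf_step_function:
  assumes "finite K"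
  shows "(\<Sum>i. \<Sum>k\<in>K. c k * indicator (A k) (P i \<omega>)) = (\<Sum>k\<in>K. c k * point_count P (A k) \<omega>)"
  unfolding point_count_eq_suminf by (subst suminf_sum) (auto simp: summableI)

lemma step_function_disjoint_eq:
  fixes c :: "'k \<Rightarrow> ennreal"
  assumes "finite K" "disjoint_family_on A K" "k \<in> K" "x \<in> A k"
  shows "(\<Sum>j\<in>K. c j * indicator (A j) x) = c k"
proof -
  have "(\<Sum>j\<in>K. c j * indicator (A j) x) = (\<Sum>j\<in>K. if j = k then c k else 0)"
    using assms by (intro sum.cong) (auto simp: disjoint_family_on_def indicator_def)
  then show ?thesis using assms by simp
qed

lemma nn_integral_exp_neg_step:
  assumes K: "finite K" "disjoint_family_on A K" and A[measurable]: "\<And>k. k \<in> K \<Longrightarrow> A k \<in> sets \<mu>"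
  shows "(\<integral>\<^sup>+x. 1 - exp_neg (\<Sum>k\<in>K. c k * indicator (A k) x) \<partial>\<mu>)
    = (\<Sum>k\<in>K. (1 - exp_neg (c k)) * emeasure \<mu> (A k))"
proof -
  have "1 - exp_neg (\<Sum>k\<in>K. c k * indicator (A k) x) = (\<Sum>k\<in>K. (1 - exp_neg (c k)) * indicator (A k) x)" for x
  proof (cases "\<exists>k\<in>K. x \<in> A k")
    case True
    then obtain k where "k \<in> K" "x \<in> A k" by auto
    then show ?thesis by (simp add: step_function_disjoint_eq[OF K])
  next
    case False
    then show ?thesis by (simp add: indicator_def)
  qed
  then show ?thesis by (simp add: nn_integral_sum nn_integral_cmult)
qed

lemma exp_neg_mult_of_nat: "exp_neg (c * of_nat k) = exp_neg c ^ k"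
  by (induction k) (auto simp: distrib_left exp_neg_add)

text \<open>For infinite mean the whole mass sits at \<open>\<infinity>\<close>, so all weights vanish.\<close>

definition poisson_weight :: "ennreal \<Rightarrow> nat \<Rightarrow> ennreal" where
  "poisson_weight m k = (if m = \<top> then 0 else ennreal (enn2real m ^ k / fact k * exp (- enn2real m)))"

text \<open>The generating function of a Poisson variable at \<open>exp_neg c\<close>. For infinite
  \<open>m\<close> and \<open>c \<noteq> 0\<close> both sides are \<open>0\<close>; for infinite
  \<open>m\<close> and \<open>c = 0\<close> the left side is \<open>0\<close>, but the right side is
  \<open>1\<close> by the convention \<open>0 * \<top> = 0\<close>.\<close>

lemma poisson_weight_pgf:
  "(\<Sum>k. poisson_weight m k * exp_neg c ^ k) = exp_neg ((1 - exp_neg c) * m)"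
  if "m < \<top> \<or> c \<noteq> 0"
proof (cases "m = \<top>")
  case True
  with that have "exp_neg c \<noteq> 1" by auto
  with exp_neg_le_1[of c] have "1 - exp_neg c \<noteq> 0"
    by (metis antisym diff_eq_0_iff_ennreal exp_neg_finite(1) ennreal_one_less_top)
  with True show ?thesis by (simp add: poisson_weight_def ennreal_mult_top)
next
  case False
  then obtain r where r: "m = ennreal r" "0 \<le> r" by (cases m) auto
  obtain q where q: "exp_neg c = ennreal q" "0 \<le> q" "q \<le> 1"
    using exp_neg_le_1[of c] by (cases "exp_neg c") (auto simp: top_unique)
  have "(\<lambda>k. (r * q) ^ k /\<^sub>R fact k * exp (- r)) sums (exp (r * q) * exp (- r))"
    by (intro sums_mult2 exp_converges)
  then have "(\<lambda>k. ennreal ((r * q) ^ k /\<^sub>R fact k * exp (- r))) sums ennreal (exp (r * q) * exp (- r))"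
    using r q by (subst sums_ennreal) auto
  moreover have "ennreal ((r * q) ^ k /\<^sub>R fact k * exp (- r)) = poisson_weight m k * exp_neg c ^ k" for k
    using r q by (simp add: poisson_weight_def ennreal_power ennreal_mult'[symmetric] power_mult_distrib field_simps)
  moreover have "ennreal (exp (r * q) * exp (- r)) = exp_neg ((1 - exp_neg c) * m)"
  proof -
    have "(1 - exp_neg c) * m = ennreal ((1 - q) * r)"
      using r q by (simp add: ennreal_mult' ennreal_minus flip: ennreal_1)
    then have "exp_neg ((1 - exp_neg c) * m) = ennreal (exp (- ((1 - q) * r)))"
      using r q by (simp only:) (simp add: exp_neg_ennreal)
    then show ?thesis by (simp add: algebra_simps flip: exp_add)
  qed
  ultimately show ?thesis by (simp add: sums_iff)
qed

text \<open>Splits the integral over the values of the count. An infinite count contributes nothing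
  if \<open>c \<noteq> 0\<close>, since the exponential vanishes there. The weight \<open>Z\<close>
  leaves room for factors that depend on other counts.\<close>

lemma nn_integral_exp_neg_count:
  assumes Z[measurable]: "Z \<in> borel_measurable N" and C[measurable]: "C \<in> borel_measurable N"
    and range: "\<And>\<omega>. C \<omega> \<in> insert \<infinity> (range of_nat)"
    and c: "c \<noteq> 0 \<or> (AE \<omega> in N. C \<omega> < \<infinity>)"
  shows "(\<integral>\<^sup>+\<omega>. Z \<omega> * exp_neg (c * C \<omega>) \<partial>N)
    = (\<Sum>k. (\<integral>\<^sup>+\<omega>. Z \<omega> * indicator {of_nat k} (C \<omega>) \<partial>N) * exp_neg c ^ k)"
proof -
  have AEeq: "AE \<omega> in N. Z \<omega> * exp_neg (c * C \<omega>) = (\<Sum>k. Z \<omega> * indicator {of_nat k} (C \<omega>) * exp_neg c ^ k)"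
  proof -
    have "Z \<omega> * exp_neg (c * C \<omega>) = (\<Sum>k. Z \<omega> * indicator {of_nat k} (C \<omega>) * exp_neg c ^ k)"
      if "c \<noteq> 0 \<or> C \<omega> < \<infinity>" for \<omega>
    proof (cases "C \<omega> = \<infinity>")
      case True
      then have "(\<lambda>k. Z \<omega> * indicator {of_nat k} (C \<omega>) * exp_neg c ^ k) = (\<lambda>_. 0)"
        by (auto simp: indicator_def)
      with that True show ?thesis by (simp add: ennreal_mult_top)
    next
      case False
      then obtain n where n: "C \<omega> = of_nat n" using range[of \<omega>] by auto
      have "(\<Sum>k. Z \<omega> * indicator {of_nat k} (C \<omega>) * exp_neg c ^ k)
         = (\<Sum>k\<in>{n}. Z \<omega> * indicator {of_nat k} (C \<omega>) * exp_neg c ^ k)"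
        by (rule suminf_finite) (auto simp: n indicator_def)
      then show ?thesis by (simp add: n exp_neg_mult_of_nat)
    qed
    then show ?thesis using c by (auto elim: eventually_mono)
  qed
  have "(\<integral>\<^sup>+\<omega>. Z \<omega> * exp_neg (c * C \<omega>) \<partial>N)
     = (\<integral>\<^sup>+\<omega>. (\<Sum>k. Z \<omega> * indicator {of_nat k} (C \<omega>) * exp_neg c ^ k) \<partial>N)"
    by (rule nn_integral_cong_AE[OF AEeq])
  also have "\<dots> = (\<Sum>k. \<integral>\<^sup>+\<omega>. Z \<omega> * indicator {of_nat k} (C \<omega>) * exp_neg c ^ k \<partial>N)"
    by (rule nn_integral_suminf) measurable
  finally show ?thesis by (simp add: nn_integral_multc)
qed

section \<open>The Laplace functional of a Poisson process\<close>

locale ppp = prob_space N for N :: "'w measure" +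
  fixes \<mu> :: "'p measure" and P :: "nat \<Rightarrow> 'w \<Rightarrow> 'p"
  assumes ppp: "poisson_point_process N \<mu> P"
begin

lemma P_measurable [measurable]: "P i \<in> N \<rightarrow>\<^sub>M \<mu>"
  using ppp by (auto simp: poisson_point_process_def)

lemma indep_counts:
  fixes n :: nat
  assumes "\<And>j. j < n \<Longrightarrow> A j \<in> sets \<mu>" "disjoint_family_on A {..<n}"
  shows "indep_vars (\<lambda>_. borel) (\<lambda>j. point_count P (A j)) {..<n}"
proof -
  have "\<forall>(n::nat) A. (\<forall>j<n. A j \<in> sets \<mu>) \<and> disjoint_family_on A {..<n} \<longrightarrow>
        indep_vars (\<lambda>_. borel) (\<lambda>j. point_count P (A j)) {..<n}"
    using ppp unfolding poisson_point_process_def by (elim conjE)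
  from this[rule_format, of n A] assms show ?thesis by simp
qed

lemma prob_count:
  assumes A[measurable]: "A \<in> sets \<mu>"
  shows "emeasure N {\<omega> \<in> space N. point_count P A \<omega> = of_nat k} = poisson_weight (emeasure \<mu> A) k"
proof (cases "emeasure \<mu> A = \<infinity>")
  case True
  then have "AE \<omega> in N. point_count P A \<omega> = \<infinity>"
    using ppp A by (auto simp: poisson_point_process_def)
  then have "emeasure N {\<omega> \<in> space N. point_count P A \<omega> = of_nat k} = 0"
    by (intro emeasure_eq_0_AE) (auto elim!: eventually_mono)
  then show ?thesis using True by (simp add: poisson_weight_def)
next
  case False
  then have "measure N {\<omega> \<in> space N. point_count P A \<omega> = of_nat k}
      = measure \<mu> A ^ k / fact k * exp (- measure \<mu> A)"
    using ppp A by (auto simp: poisson_point_process_def less_top)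
  then show ?thesis unfolding poisson_weight_def using False by (simp add: emeasure_eq_measure flip: measure_def)
qed

lemma laplace_count:
  assumes A[measurable]: "A \<in> sets \<mu>"
  shows "(\<integral>\<^sup>+\<omega>. exp_neg (c * point_count P A \<omega>) \<partial>N) = exp_neg ((1 - exp_neg c) * emeasure \<mu> A)"
\<comment> \<open>With \<open>c = 0\<close> and infinite mean the expansion over finite counts would
  lose all the mass, so this case is separate.\<close>
proof (cases "c = 0")
  case True
  then show ?thesis by (simp add: emeasure_space_1)
next
  case False
  have C[measurable]: "point_count P A \<in> borel_measurable N" by measurable
  have cnt: "(\<integral>\<^sup>+\<omega>. 1 * indicator {of_nat k} (point_count P A \<omega>) \<partial>N) = poisson_weight (emeasure \<mu> A) k" for k
  proof -
    have "(\<integral>\<^sup>+\<omega>. 1 * indicator {of_nat k} (point_count P A \<omega>) \<partial>N)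
      = (\<integral>\<^sup>+\<omega>. indicator {\<omega> \<in> space N. point_count P A \<omega> = of_nat k} \<omega> \<partial>N)"
      by (intro nn_integral_cong) (auto simp: indicator_def)
    also have "\<dots> = emeasure N {\<omega> \<in> space N. point_count P A \<omega> = of_nat k}"
      by (rule nn_integral_indicator) measurable
    finally show ?thesis by (simp add: prob_count)
  qed
  have "(\<integral>\<^sup>+\<omega>. exp_neg (c * point_count P A \<omega>) \<partial>N)
     = (\<Sum>k. (\<integral>\<^sup>+\<omega>. 1 * indicator {of_nat k} (point_count P A \<omega>) \<partial>N) * exp_neg c ^ k)"
    using nn_integral_exp_neg_count[OF borel_measurable_const C point_count_range, of c 1] False by simp
  then show ?thesis unfolding cnt using False by (simp add: poisson_weight_pgf)
qed

lemma laplace_step: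
  assumes K: "finite K" "disjoint_family_on A K" and A: "\<And>k. k \<in> K \<Longrightarrow> A k \<in> sets \<mu>"
  shows "(\<integral>\<^sup>+\<omega>. exp_neg (\<Sum>i. \<Sum>k\<in>K. c k * indicator (A k) (P i \<omega>)) \<partial>N)
    = exp_neg (\<integral>\<^sup>+x. 1 - exp_neg (\<Sum>k\<in>K. c k * indicator (A k) x) \<partial>\<mu>)"
proof -
  \<comment> \<open>Independence of the counts is available for families indexed by
    \<open>{..<n}\<close>, so the disjoint sets are enumerated.\<close>
  obtain h where h: "bij_betw h {..<card K} K"
    using ex_bij_betw_nat_finite[OF K(1)] by (auto simp: lessThan_atLeast0)
  have disj: "disjoint_family_on (\<lambda>j. A (h j)) {..<card K}"
    using K(2) h unfolding disjoint_family_on_def bij_betw_def inj_on_def by (metis image_eqI)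
  have Ah: "A (h j) \<in> sets \<mu>" if "j < card K" for j
    using that h A by (auto simp: bij_betw_def)
  then have "indep_vars (\<lambda>_. borel) (\<lambda>j. point_count P (A (h j))) {..<card K}"
    using disj by (intro indep_counts) auto
  then have ind: "indep_vars (\<lambda>_. borel) (\<lambda>j \<omega>. exp_neg (c (h j) * point_count P (A (h j)) \<omega>)) {..<card K}"
    by (rule indep_vars_compose2) measurable
  have "(\<integral>\<^sup>+\<omega>. exp_neg (\<Sum>i. \<Sum>k\<in>K. c k * indicator (A k) (P i \<omega>)) \<partial>N)
     = (\<integral>\<^sup>+\<omega>. (\<Prod>k\<in>K. exp_neg (c k * point_count P (A k) \<omega>)) \<partial>N)"
    unfolding suminf_step_function[OF K(1)] exp_neg_sum ..
  also have "\<dots> = (\<integral>\<^sup>+\<omega>. (\<Prod>j<card K. exp_neg (c (h j) * point_count P (A (h j)) \<omega>)) \<partial>N)"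
    by (intro nn_integral_cong prod.reindex_bij_betw[OF h, symmetric])
  also have "\<dots> = (\<Prod>j<card K. \<integral>\<^sup>+\<omega>. exp_neg (c (h j) * point_count P (A (h j)) \<omega>) \<partial>N)"
    by (intro indep_vars_nn_integral ind) auto
  also have "\<dots> = (\<Prod>j<card K. exp_neg ((1 - exp_neg (c (h j))) * emeasure \<mu> (A (h j))))"
    by (intro prod.cong laplace_count Ah) auto
  also have "\<dots> = (\<Prod>k\<in>K. exp_neg ((1 - exp_neg (c k)) * emeasure \<mu> (A k)))"
    by (rule prod.reindex_bij_betw[OF h])
  also have "\<dots> = exp_neg (\<Sum>k\<in>K. (1 - exp_neg (c k)) * emeasure \<mu> (A k))"
    by (rule exp_neg_sum[symmetric])
  also have "(\<Sum>k\<in>K. (1 - exp_neg (c k)) * emeasure \<mu> (A k))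
      = (\<integral>\<^sup>+x. 1 - exp_neg (\<Sum>k\<in>K. c k * indicator (A k) x) \<partial>\<mu>)"
    by (rule nn_integral_exp_neg_step[OF K A, symmetric])
  finally show ?thesis .
qed

lemma laplace_simple:
  assumes \<phi>: "simple_function \<mu> \<phi>"
  shows "(\<integral>\<^sup>+\<omega>. exp_neg (\<Sum>i. \<phi> (P i \<omega>)) \<partial>N) = exp_neg (\<integral>\<^sup>+x. 1 - exp_neg (\<phi> x) \<partial>\<mu>)"
proof -
  let ?K = "\<phi> ` space \<mu>" and ?A = "\<lambda>y. \<phi> -` {y} \<inter> space \<mu>"
  have fin: "finite ?K" using \<phi> by (auto simp: simple_function_def)
  have disj: "disjoint_family_on ?A ?K" by (auto simp: disjoint_family_on_def)
  have A: "?A y \<in> sets \<mu>" if "y \<in> ?K" for y using \<phi> that by (auto simp: simple_function_def)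
  have eq: "(\<Sum>y\<in>?K. y * indicator (?A y) x) = \<phi> x" if "x \<in> space \<mu>" for x
    using step_function_disjoint_eq[OF fin disj, of "\<phi> x" x "\<lambda>y. y"] that by auto
  have "(\<integral>\<^sup>+\<omega>. exp_neg (\<Sum>i. \<phi> (P i \<omega>)) \<partial>N)
      = (\<integral>\<^sup>+\<omega>. exp_neg (\<Sum>i. \<Sum>y\<in>?K. y * indicator (?A y) (P i \<omega>)) \<partial>N)"
    by (intro nn_integral_cong arg_cong[of _ _ exp_neg] arg_cong[of _ _ suminf] ext eq[symmetric]
        measurable_space[OF P_measurable])
  also have "\<dots> = exp_neg (\<integral>\<^sup>+x. 1 - exp_neg (\<Sum>y\<in>?K. y * indicator (?A y) x) \<partial>\<mu>)"
    by (rule laplace_step[OF fin disj A])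
  also have "(\<integral>\<^sup>+x. 1 - exp_neg (\<Sum>y\<in>?K. y * indicator (?A y) x) \<partial>\<mu>) = (\<integral>\<^sup>+x. 1 - exp_neg (\<phi> x) \<partial>\<mu>)"
    by (intro nn_integral_cong) (simp add: eq)
  finally show ?thesis .
qed

text \<open>Simple functions increase to \<open>\<phi>\<close>, so the left integrands decrease;
  being bounded by \<open>1\<close> they allow the exchange of infimum and integral. On the right
  the functions \<open>1 - exp_neg (f n x)\<close> increase, and monotone convergence holds even
  where \<mu> is infinite.\<close>

theorem laplace_functional:
  assumes \<phi>: "\<phi> \<in> borel_measurable \<mu>"
  shows "(\<integral>\<^sup>+\<omega>. exp_neg (\<Sum>i. \<phi> (P i \<omega>)) \<partial>N) = exp_neg (\<integral>\<^sup>+x. 1 - exp_neg (\<phi> x) \<partial>\<mu>)"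
proof -
  obtain f where f: "\<And>n. simple_function \<mu> (f n)" and inc: "incseq f" and sup: "\<And>x. (SUP n. f n x) = \<phi> x"
    using borel_measurable_implies_simple_function_sequence'[OF \<phi>] by metis
  have fm[measurable]: "f n \<in> borel_measurable \<mu>" for n by (rule borel_measurable_simple_function[OF f])
  have mono: "f m x \<le> f n x" if "m \<le> n" for m n x using inc that by (auto simp: incseq_def le_fun_def)
  have sup1: "(SUP n. 1 - exp_neg (f n x)) = 1 - exp_neg (\<phi> x)" for x
    unfolding sup[symmetric] exp_neg_SUP[OF UNIV_not_empty] by (rule ennreal_INF_const_minus) simp
  have "(\<Sum>i. \<phi> (P i \<omega>)) = (SUP n. \<Sum>i. f n (P i \<omega>))" for \<omega>
    unfolding sup[symmetric] by (rule ennreal_suminf_SUP_eq) (auto simp: incseq_def mono)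
  then have "(\<integral>\<^sup>+\<omega>. exp_neg (\<Sum>i. \<phi> (P i \<omega>)) \<partial>N) = (\<integral>\<^sup>+\<omega>. (INF n. exp_neg (\<Sum>i. f n (P i \<omega>))) \<partial>N)"
    by (simp add: exp_neg_SUP)
  also have "\<dots> = (INF n. \<integral>\<^sup>+\<omega>. exp_neg (\<Sum>i. f n (P i \<omega>)) \<partial>N)"
  proof (rule nn_integral_monotone_convergence_INF_decseq[where i=0])
    show "decseq (\<lambda>n \<omega>. exp_neg (\<Sum>i. f n (P i \<omega>)))"
      by (intro decseq_SucI le_funI exp_neg_antimono suminf_le summableI mono) simp
    have "(\<integral>\<^sup>+\<omega>. exp_neg (\<Sum>i. f 0 (P i \<omega>)) \<partial>N) \<le> (\<integral>\<^sup>+\<omega>. 1 \<partial>N)"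
      by (intro nn_integral_mono exp_neg_le_1)
    then show "(\<integral>\<^sup>+\<omega>. exp_neg (\<Sum>i. f 0 (P i \<omega>)) \<partial>N) < \<infinity>"
      by (simp add: emeasure_space_1) (metis ennreal_one_less_top order.strict_trans1)
  qed measurable
  also have "\<dots> = (INF n. exp_neg (\<integral>\<^sup>+x. 1 - exp_neg (f n x) \<partial>\<mu>))"
    by (simp add: laplace_simple[OF f])
  also have "\<dots> = exp_neg (SUP n. \<integral>\<^sup>+x. 1 - exp_neg (f n x) \<partial>\<mu>)"
    by (simp add: exp_neg_SUP)
  also have "(SUP n. \<integral>\<^sup>+x. 1 - exp_neg (f n x) \<partial>\<mu>) = (\<integral>\<^sup>+x. (SUP n. 1 - exp_neg (f n x)) \<partial>\<mu>)"
    by (intro nn_integral_monotone_convergence_SUP[symmetric])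
      (auto simp: incseq_def le_fun_def mono intro!: ennreal_minus_mono exp_neg_antimono)
  finally show ?thesis unfolding sup1 .
qed

end

section \<open>Recognising a Poisson process by its Laplace functional\<close>

lemma poisson_weight_finite: "poisson_weight m k < \<top>"
  by (simp add: poisson_weight_def)

text \<open>As \<open>c\<close> runs through the positive reals, \<open>exp_neg c\<close> runs
  through the open unit interval, and both sides of \<open>eq\<close> are power series in it; their
  coefficients must agree. \<open>B\<close> stands for the contribution of the factors collected in
  \<open>Z\<close>.\<close>

lemma count_coefficients:
  assumes "prob_space N" and Z[measurable]: "Z \<in> borel_measurable N" and C[measurable]: "C \<in> borel_measurable N"
    and Z1: "\<And>\<omega>. Z \<omega> \<le> 1" and range: "\<And>\<omega>. C \<omega> \<in> insert \<infinity> (range of_nat)" and B: "B < \<top>"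
    and eq: "\<And>c. 0 < c \<Longrightarrow> (\<integral>\<^sup>+\<omega>. Z \<omega> * exp_neg (c * C \<omega>) \<partial>N) = B * exp_neg ((1 - exp_neg c) * m)"
  shows "(\<integral>\<^sup>+\<omega>. Z \<omega> * indicator {of_nat k} (C \<omega>) \<partial>N) = B * poisson_weight m k"
proof -
  interpret prob_space N by fact
  define a where "a k = (\<integral>\<^sup>+\<omega>. Z \<omega> * indicator {of_nat k} (C \<omega>) \<partial>N)" for k
  have le1: "(\<integral>\<^sup>+\<omega>. Z \<omega> * g \<omega> \<partial>N) \<le> 1" if "\<And>\<omega>. g \<omega> \<le> 1" for g
  proof -
    have "(\<integral>\<^sup>+\<omega>. Z \<omega> * g \<omega> \<partial>N) \<le> (\<integral>\<^sup>+\<omega>. 1 \<partial>N)"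
      using mult_mono[OF Z1 that] by (intro nn_integral_mono) simp
    then show ?thesis by (simp add: emeasure_space_1)
  qed
  have a_top: "a k < \<top>" for k
    using le1[of "\<lambda>\<omega>. indicator {of_nat k} (C \<omega>)"] order.strict_trans1[OF _ ennreal_one_less_top]
    by (auto simp: a_def indicator_def)
  have b_top: "B * poisson_weight m k < \<top>" for k using B poisson_weight_finite by (simp add: ennreal_mult_less_top)
  have "enn2real (a k) - enn2real (B * poisson_weight m k) = 0"
  proof (rule powser_eq_0_imp_coeffs_0)
    fix x :: real assume x: "0 < x" "x < 1"
    define c where "c = ennreal (- ln x)"
    have c: "0 < c" "exp_neg c = ennreal x" using x by (auto simp: c_def exp_neg_ennreal)
    have sum_a: "(\<Sum>k. a k * exp_neg c ^ k) = (\<integral>\<^sup>+\<omega>. Z \<omega> * exp_neg (c * C \<omega>) \<partial>N)"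
      unfolding a_def using nn_integral_exp_neg_count[OF Z C range, of c] c by simp
    also have "\<dots> = B * (\<Sum>k. poisson_weight m k * exp_neg c ^ k)"
      unfolding eq[OF c(1)] using c by (subst poisson_weight_pgf) auto
    also have "\<dots> = (\<Sum>k. B * poisson_weight m k * exp_neg c ^ k)"
      by (simp add: ennreal_suminf_cmult mult.assoc)
    finally have sums_eq: "(\<Sum>k. a k * exp_neg c ^ k) = (\<Sum>k. B * poisson_weight m k * exp_neg c ^ k)" .
    have fin: "(\<Sum>k. a k * exp_neg c ^ k) \<noteq> \<top>"
      unfolding sum_a using le1[of "\<lambda>\<omega>. exp_neg (c * C \<omega>)"] exp_neg_le_1 by (auto simp: top_unique)
    have real: "ennreal (enn2real y * x ^ k) = y * exp_neg c ^ k" if "y < \<top>" for y k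
      using x that by (simp add: ennreal_mult c ennreal_power)
    have sa: "summable (\<lambda>k. enn2real (a k) * x ^ k)"
      using fin x by (intro summable_suminf_not_top) (auto simp: real[OF a_top])
    have sb: "summable (\<lambda>k. enn2real (B * poisson_weight m k) * x ^ k)"
      using fin x unfolding sums_eq by (intro summable_suminf_not_top) (simp_all only: real[OF b_top], auto)
    have "ennreal (\<Sum>k. enn2real (a k) * x ^ k) = ennreal (\<Sum>k. enn2real (B * poisson_weight m k) * x ^ k)"
      using sums_eq x
      by (subst (1 2) suminf_ennreal2[symmetric]) (simp_all only: real[OF a_top] real[OF b_top] sa sb, auto)
    then have "(\<Sum>k. enn2real (a k) * x ^ k) = (\<Sum>k. enn2real (B * poisson_weight m k) * x ^ k)"
      using x sa sb by (subst (asm) ennreal_inj) (auto intro!: suminf_nonneg)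
    then show "(\<lambda>k. (enn2real (a k) - enn2real (B * poisson_weight m k)) * x ^ k) sums 0"
      using sums_diff[OF summable_sums[OF sa] summable_sums[OF sb]] by (simp add: left_diff_distrib)
  qed
  then have "ennreal (enn2real (a k)) = ennreal (enn2real (B * poisson_weight m k))" by simp
  then show ?thesis using a_top[of k] b_top[of k] by (simp add: a_def)
qed

lemma indicator_le_1_ennreal: "indicator A x \<le> (1::ennreal)"
  by (simp add: indicator_def)

text \<open>At step functions the Laplace functional is the joint generating function of the counts
  on disjoint sets. Reading off coefficients one set at a time shows that the joint law of the
  counts is a product of Poisson weights, which contains both the marginal laws and the
  independence.\<close>

theorem poisson_point_processI_laplace:
  assumes "prob_space N" and P[measurable]: "\<And>i. P i \<in> N \<rightarrow>\<^sub>M \<mu>"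
    and laplace: "\<And>\<phi>. \<phi> \<in> borel_measurable \<mu> \<Longrightarrow>
      (\<integral>\<^sup>+\<omega>. exp_neg (\<Sum>i. \<phi> (P i \<omega>)) \<partial>N) = exp_neg (\<integral>\<^sup>+x. 1 - exp_neg (\<phi> x) \<partial>\<mu>)"
  shows "poisson_point_process N \<mu> P"
proof -
  interpret prob_space N by fact
  \<comment> \<open>\<open>L\<close> collects the sets whose generating function has already been
    converted into the event of an exact count; the sets in \<open>K - L\<close> keep their free
    parameters \<open>c j\<close>, and each induction step varies one of them.\<close>
  have step: "(\<integral>\<^sup>+\<omega>. (\<Prod>l\<in>L. indicator {of_nat (n l)} (point_count P (A l) \<omega>))
        * (\<Prod>j\<in>K - L. exp_neg (c j * point_count P (A j) \<omega>)) \<partial>N)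
      = (\<Prod>l\<in>L. poisson_weight (emeasure \<mu> (A l)) (n l))
        * (\<Prod>j\<in>K - L. exp_neg ((1 - exp_neg (c j)) * emeasure \<mu> (A j)))"
    if K: "finite K" "disjoint_family_on A K" and A: "\<And>k. k \<in> K \<Longrightarrow> A k \<in> sets \<mu>" and L: "L \<subseteq> K"
    for K L :: "nat set" and A c and n :: "nat \<Rightarrow> nat"
  proof -
    from L K(1) have "finite L" by (rule finite_subset)
    then show ?thesis using L
    proof (induction L arbitrary: c rule: finite_induct)
      case empty
      have "(\<integral>\<^sup>+\<omega>. (\<Prod>j\<in>K. exp_neg (c j * point_count P (A j) \<omega>)) \<partial>N)
         = (\<integral>\<^sup>+\<omega>. exp_neg (\<Sum>i. \<Sum>k\<in>K. c k * indicator (A k) (P i \<omega>)) \<partial>N)"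
        unfolding suminf_step_function[OF K(1)] exp_neg_sum ..
      also have "\<dots> = exp_neg (\<integral>\<^sup>+x. 1 - exp_neg (\<Sum>k\<in>K. c k * indicator (A k) x) \<partial>\<mu>)"
        using A by (intro laplace borel_measurable_sum borel_measurable_times_ennreal borel_measurable_indicator) auto
      also have "(\<integral>\<^sup>+x. 1 - exp_neg (\<Sum>k\<in>K. c k * indicator (A k) x) \<partial>\<mu>)
          = (\<Sum>k\<in>K. (1 - exp_neg (c k)) * emeasure \<mu> (A k))"
        by (rule nn_integral_exp_neg_step[OF K A])
      finally show ?case by (simp add: exp_neg_sum)
    next
      case (insert l L)
      let ?R = "K - insert l L"
      have K_L: "K - L = insert l ?R" "l \<notin> ?R" "finite ?R" using insert K(1) by auto
      have l: "l \<in> K" using insert by auto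
      define Z where "Z \<omega> = (\<Prod>l\<in>L. indicator {of_nat (n l)} (point_count P (A l) \<omega>))
        * (\<Prod>j\<in>?R. exp_neg (c j * point_count P (A j) \<omega>))" for \<omega>
      define B where "B = (\<Prod>l\<in>L. poisson_weight (emeasure \<mu> (A l)) (n l))
        * (\<Prod>j\<in>?R. exp_neg ((1 - exp_neg (c j)) * emeasure \<mu> (A j)))"
      have [measurable]: "point_count P (A j) \<in> borel_measurable N" if "j \<in> K" for j
        using A[OF that] by measurable
      have Z[measurable]: "Z \<in> borel_measurable N"
        unfolding Z_def using insert.prems
        by (intro borel_measurable_times_ennreal borel_measurable_prod_ennreal) (auto, measurable)
      have "Z \<omega> \<le> 1 * 1" for \<omega>
        unfolding Z_def by (intro mult_mono prod_le_1) (auto simp: indicator_le_1_ennreal exp_neg_le_1)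
      then have Z1: "Z \<omega> \<le> 1" for \<omega> by simp
      have prod_fin: "(\<Prod>i\<in>I. f i) < \<top>" if "\<And>i. f i < \<top>" for f :: "nat \<Rightarrow> ennreal" and I
        by (induction I rule: infinite_finite_induct) (auto simp: ennreal_mult_less_top that)
      have B: "B < \<top>"
        unfolding B_def by (simp only: ennreal_mult_less_top) (auto intro!: prod_fin poisson_weight_finite)
      have "(\<integral>\<^sup>+\<omega>. Z \<omega> * indicator {of_nat (n l)} (point_count P (A l) \<omega>) \<partial>N)
          = B * poisson_weight (emeasure \<mu> (A l)) (n l)"
      proof (rule count_coefficients[OF _ Z _ Z1 point_count_range B])
        fix c'
        let ?c = "c(l := c')"
        have R: "(\<Prod>j\<in>?R. f (?c j) j) = (\<Prod>j\<in>?R. f (c j) j)" for f :: "ennreal \<Rightarrow> nat \<Rightarrow> ennreal"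
          by (intro prod.cong) auto
        have "(\<integral>\<^sup>+\<omega>. Z \<omega> * exp_neg (c' * point_count P (A l) \<omega>) \<partial>N)
           = (\<integral>\<^sup>+\<omega>. (\<Prod>l\<in>L. indicator {of_nat (n l)} (point_count P (A l) \<omega>))
              * (\<Prod>j\<in>K - L. exp_neg (?c j * point_count P (A j) \<omega>)) \<partial>N)"
          unfolding K_L(1) prod.insert[OF K_L(3,2)] Z_def
          by (simp add: R[of "\<lambda>c j. exp_neg (c * point_count P (A j) _)"] ac_simps)
        also have "\<dots> = (\<Prod>l\<in>L. poisson_weight (emeasure \<mu> (A l)) (n l))
            * (\<Prod>j\<in>K - L. exp_neg ((1 - exp_neg (?c j)) * emeasure \<mu> (A j)))"
          using insert by (intro insert.IH) auto
        also have "\<dots> = B * exp_neg ((1 - exp_neg c') * emeasure \<mu> (A l))"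
          unfolding K_L(1) prod.insert[OF K_L(3,2)] B_def
          by (simp add: R[of "\<lambda>c j. exp_neg ((1 - exp_neg c) * emeasure \<mu> (A j))"] ac_simps)
        finally show "(\<integral>\<^sup>+\<omega>. Z \<omega> * exp_neg (c' * point_count P (A l) \<omega>) \<partial>N)
           = B * exp_neg ((1 - exp_neg c') * emeasure \<mu> (A l))" .
      qed (use l in \<open>auto intro: prob_space_axioms\<close>)
      then show ?case using insert.hyps by (simp add: Z_def B_def ac_simps)
    qed
  qed
  have joint: "emeasure N {\<omega> \<in> space N. \<forall>k\<in>K. point_count P (A k) \<omega> = of_nat (n k)}
      = (\<Prod>k\<in>K. poisson_weight (emeasure \<mu> (A k)) (n k))"
    if K: "finite K" "disjoint_family_on A K" and A: "\<And>k. k \<in> K \<Longrightarrow> A k \<in> sets \<mu>"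
    for K :: "nat set" and A n
  proof -
    have [measurable]: "point_count P (A j) \<in> borel_measurable N" if "j \<in> K" for j
      using A[OF that] by measurable
    have "emeasure N {\<omega> \<in> space N. \<forall>k\<in>K. point_count P (A k) \<omega> = of_nat (n k)}
      = (\<integral>\<^sup>+\<omega>. indicator {\<omega> \<in> space N. \<forall>k\<in>K. point_count P (A k) \<omega> = of_nat (n k)} \<omega> \<partial>N)"
      using K(1) by (intro nn_integral_indicator[symmetric]) measurable
    also have "\<dots> = (\<integral>\<^sup>+\<omega>. (\<Prod>l\<in>K. indicator {of_nat (n l)} (point_count P (A l) \<omega>)) \<partial>N)"
      using K(1) by (intro nn_integral_cong) (auto simp: indicator_def prod_zero_iff intro!: prod.neutral[symmetric])
    also have "\<dots> = (\<Prod>k\<in>K. poisson_weight (emeasure \<mu> (A k)) (n k))"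
      using step[OF K A order_refl, of n "\<lambda>_. 0"] by simp
    finally show ?thesis .
  qed
  have count: "emeasure N {\<omega> \<in> space N. point_count P A \<omega> = of_nat k} = poisson_weight (emeasure \<mu> A) k"
    if "A \<in> sets \<mu>" for A k
    using joint[of "{0}" "\<lambda>_. A" "\<lambda>_. k"] that by (simp add: disjoint_family_on_def)
  show ?thesis
    unfolding poisson_point_process_def
  proof (intro conjI ballI impI allI)
    fix A k assume A: "A \<in> sets \<mu>" "emeasure \<mu> A < \<infinity>"
    then have "emeasure N {\<omega> \<in> space N. point_count P A \<omega> = of_nat k}
        = ennreal (measure \<mu> A ^ k / fact k * exp (- measure \<mu> A))"
      by (simp add: count poisson_weight_def measure_def less_top)
    then show "measure N {\<omega> \<in> space N. point_count P A \<omega> = of_nat k}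
        = measure \<mu> A ^ k / fact k * exp (- measure \<mu> A)"
      by (intro measure_eq_emeasure_eq_ennreal) auto
  next
    fix A assume A[measurable]: "A \<in> sets \<mu>" and "emeasure \<mu> A = \<infinity>"
    then have "AE \<omega> in N. \<not> point_count P A \<omega> = of_nat k" for k
      using count[OF A, of k] by (intro AE_I[where N="{\<omega> \<in> space N. point_count P A \<omega> = of_nat k}"])
        (auto simp: poisson_weight_def)
    then have "AE \<omega> in N. \<forall>k. \<not> point_count P A \<omega> = of_nat k" by (simp add: AE_all_countable)
    then show "AE \<omega> in N. point_count P A \<omega> = \<infinity>"
    proof eventually_elim
      case (elim \<omega>)
      then show ?case using point_count_range[of P A \<omega>] by auto
    qed
  next
    fix n :: nat and A :: "nat \<Rightarrow> 'b set"
    assume "(\<forall>j<n. A j \<in> sets \<mu>) \<and> disjoint_family_on A {..<n}"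
    then have A: "\<And>j. j < n \<Longrightarrow> A j \<in> sets \<mu>" and disj: "disjoint_family_on A {..<n}" by auto
    have C[measurable]: "point_count P (A j) \<in> borel_measurable N" if "j < n" for j
      using A[OF that] by measurable
    \<comment> \<open>Different counts are disjoint events, so adding the empty set makes the
      generator stable under intersection.\<close>
    define G where "G j = insert {} (range (\<lambda>k::nat. {\<omega> \<in> space N. point_count P (A j) \<omega> = of_nat k}))" for j
    have G_events: "G j \<subseteq> events" if "j < n" for j using that by (auto simp: G_def)
    have "indep_sets G {..<n}"
    proof (rule indep_setsI)
      fix B J assume J: "J \<noteq> {}" "J \<subseteq> {..<n}" "finite J" and B: "\<forall>j\<in>J. B j \<in> G j"
      show "prob (\<Inter>j\<in>J. B j) = (\<Prod>j\<in>J. prob (B j))"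
      proof (cases "\<exists>j\<in>J. B j = {}")
        case True
        then have "(\<Inter>j\<in>J. B j) = {}" by auto
        moreover have "(\<Prod>j\<in>J. prob (B j)) = 0"
          using True J(3) by (auto intro!: prod_zero bexI)
        ultimately show ?thesis by simp
      next
        case False
        then have "\<forall>j\<in>J. \<exists>k. B j = {\<omega> \<in> space N. point_count P (A j) \<omega> = of_nat k}"
          using B unfolding G_def by blast
        from bchoice[OF this] obtain k
          where k: "\<forall>j\<in>J. B j = {\<omega> \<in> space N. point_count P (A j) \<omega> = of_nat (k j)}" by blast
        have Int: "(\<Inter>j\<in>J. B j) = {\<omega> \<in> space N. \<forall>j\<in>J. point_count P (A j) \<omega> = of_nat (k j)}"
          using J(1) by (auto simp: k)
        have "emeasure N (\<Inter>j\<in>J. B j) = (\<Prod>j\<in>J. poisson_weight (emeasure \<mu> (A j)) (k j))"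
          unfolding Int using J A by (intro joint disjoint_family_on_mono[OF J(2) disj]) auto
        also have "\<dots> = (\<Prod>j\<in>J. ennreal (prob (B j)))"
        proof (intro prod.cong refl)
          fix j assume j: "j \<in> J"
          then show "poisson_weight (emeasure \<mu> (A j)) (k j) = ennreal (prob (B j))"
            using J(2) k unfolding emeasure_eq_measure[symmetric] by (subst count[symmetric]) (auto intro: A)
        qed
        also have "\<dots> = ennreal (\<Prod>j\<in>J. prob (B j))" by (intro prod_ennreal) simp
        finally show ?thesis
          unfolding emeasure_eq_measure by (subst (asm) ennreal_inj) (simp_all add: prod_nonneg)
      qed
    qed (use G_events in auto)
    then have ind: "indep_sets (\<lambda>j. sigma_sets (space N) (G j)) {..<n}"
    proof (rule indep_sets_sigma)
      show "Int_stable (G j)" for j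
        by (auto simp: Int_stable_def G_def)
    qed
    show "indep_vars (\<lambda>_. borel) (\<lambda>j. point_count P (A j)) {..<n}"
      unfolding indep_vars_def2
    proof (intro conjI ballI indep_sets_mono_sets[OF ind] subsetI)
      fix j B assume "j \<in> {..<n}"
        and "B \<in> {point_count P (A j) -` S \<inter> space N | S. S \<in> sets borel}"
      then obtain S where S: "B = point_count P (A j) -` S \<inter> space N" by auto
      let ?E = "\<lambda>k::nat. {\<omega> \<in> space N. point_count P (A j) \<omega> = of_nat k}"
      have E: "?E k \<in> sigma_sets (space N) (G j)" for k by (intro sigma_sets.Basic) (auto simp: G_def)
      have fin: "(\<Union>k\<in>I. ?E k) \<in> sigma_sets (space N) (G j)" for I
      proof -
        have "(\<Union>k\<in>I. ?E k) = (\<Union>k. if k \<in> I then ?E k else {})" by auto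
        also have "\<dots> \<in> sigma_sets (space N) (G j)"
          by (intro sigma_sets.Union) (auto intro: E sigma_sets.Empty)
        finally show ?thesis .
      qed
      show "B \<in> sigma_sets (space N) (G j)"
      proof (cases "\<infinity> \<in> S")
        case True
        \<comment> \<open>\<open>G\<close> has no generator for infinite counts; that event is
          reached as the complement of the countably many events with a finite count.\<close>
        have "B = space N - (\<Union>k\<in>{k. of_nat k \<notin> S}. ?E k)"
        proof (rule set_eqI)
          show "\<omega> \<in> B \<longleftrightarrow> \<omega> \<in> space N - (\<Union>k\<in>{k. of_nat k \<notin> S}. ?E k)" for \<omega>
            using True point_count_range[of P "A j" \<omega>] by (auto simp: S)
        qed
        then show ?thesis using fin by (simp only:) (rule sigma_sets.Compl)
      next
        case False
        have "B = (\<Union>k\<in>{k. of_nat k \<in> S}. ?E k)"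
        proof (rule set_eqI)
          show "\<omega> \<in> B \<longleftrightarrow> \<omega> \<in> (\<Union>k\<in>{k. of_nat k \<in> S}. ?E k)" for \<omega>
            using False point_count_range[of P "A j" \<omega>] by (auto simp: S)
        qed
        then show ?thesis using fin by (simp only:)
      qed
    qed (use C in auto)
  qed (use P in auto)
qed

section \<open>Marked Poisson processes\<close>

lemma indep_vars_PiM_components:
  assumes L: "prob_space L"
  shows "prob_space.indep_vars (Pi\<^sub>M UNIV (\<lambda>_. L)) (\<lambda>_. L) (\<lambda>i x. x i) (UNIV :: 'i set)"
proof -
  interpret L: prob_space L by fact
  interpret X: product_prob_space "\<lambda>_::'i. L" UNIV by unfold_locales
  show ?thesis
    by (subst X.P.indep_vars_iff_distr_eq_PiM) (simp_all add: X.PiM_component restrict_def)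
qed

lemma nn_integral_PiM_prod:
  fixes f :: "'i \<Rightarrow> 'a \<Rightarrow> ennreal"
  assumes L: "prob_space L" and f[measurable]: "\<And>i. i \<in> J \<Longrightarrow> f i \<in> borel_measurable L" and J: "finite J"
  shows "(\<integral>\<^sup>+x. (\<Prod>i\<in>J. f i (x i)) \<partial>Pi\<^sub>M UNIV (\<lambda>_. L)) = (\<Prod>i\<in>J. \<integral>\<^sup>+x. f i x \<partial>L)"
proof -
  interpret L: prob_space L by fact
  interpret X: product_prob_space "\<lambda>_::'i. L" UNIV by unfold_locales
  have "X.P.indep_vars (\<lambda>_. L) (\<lambda>i x. x i) J"
    by (rule X.P.indep_vars_subset[OF indep_vars_PiM_components[OF L]]) simp
  then have "X.P.indep_vars (\<lambda>_. borel) (\<lambda>i x. f i (x i)) J"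
    by (rule X.P.indep_vars_compose2) simp
  then have "(\<integral>\<^sup>+x. (\<Prod>i\<in>J. f i (x i)) \<partial>Pi\<^sub>M UNIV (\<lambda>_. L)) = (\<Prod>i\<in>J. \<integral>\<^sup>+x. f i (x i) \<partial>Pi\<^sub>M UNIV (\<lambda>_. L))"
    by (intro X.P.indep_vars_nn_integral J) auto
  also have "\<dots> = (\<Prod>i\<in>J. \<integral>\<^sup>+x. f i x \<partial>L)"
  proof (intro prod.cong refl)
    fix i assume [measurable]: "i \<in> J"
    have "(\<integral>\<^sup>+x. f i x \<partial>L) = (\<integral>\<^sup>+x. f i x \<partial>distr (Pi\<^sub>M UNIV (\<lambda>_. L)) L (\<lambda>x. x i))"
      by (simp add: X.PiM_component)
    also have "\<dots> = (\<integral>\<^sup>+x. f i (x i) \<partial>Pi\<^sub>M UNIV (\<lambda>_. L))"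
      by (rule nn_integral_distr) measurable
    finally show "(\<integral>\<^sup>+x. f i (x i) \<partial>Pi\<^sub>M UNIV (\<lambda>_. L)) = (\<integral>\<^sup>+x. f i x \<partial>L)" ..
  qed
  finally show ?thesis .
qed

text \<open>An infinite product of expectations, written as \<open>exp_neg\<close> of a sum so that
  it has again the shape of an integrand in a Laplace functional. A vanishing factor becomes an
  infinite summand.\<close>

lemma nn_integral_PiM_exp_neg_suminf:
  assumes L: "prob_space L" and f[measurable]: "\<And>i::nat. f i \<in> borel_measurable L"
  shows "(\<integral>\<^sup>+x. exp_neg (\<Sum>i. f i (x i)) \<partial>Pi\<^sub>M UNIV (\<lambda>_. L))
    = exp_neg (\<Sum>i. neg_ln (\<integral>\<^sup>+x. exp_neg (f i x) \<partial>L))"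
proof -
  interpret L: prob_space L by fact
  interpret X: product_prob_space "\<lambda>_::nat. L" UNIV by unfold_locales
  have le1: "(\<integral>\<^sup>+x. exp_neg (g x) \<partial>K) \<le> 1" if "prob_space K" for g and K :: "'b measure"
  proof -
    have "(\<integral>\<^sup>+x. exp_neg (g x) \<partial>K) \<le> (\<integral>\<^sup>+x. 1 \<partial>K)" by (intro nn_integral_mono exp_neg_le_1)
    then show ?thesis using prob_space.emeasure_space_1[OF that] by simp
  qed
  have "(\<integral>\<^sup>+x. exp_neg (\<Sum>i. f i (x i)) \<partial>Pi\<^sub>M UNIV (\<lambda>_. L))
     = (\<integral>\<^sup>+x. (INF n. \<Prod>i<n. exp_neg (f i (x i))) \<partial>Pi\<^sub>M UNIV (\<lambda>_. L))"
    by (simp add: exp_neg_suminf)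
  also have "\<dots> = (INF n. \<integral>\<^sup>+x. (\<Prod>i<n. exp_neg (f i (x i))) \<partial>Pi\<^sub>M UNIV (\<lambda>_. L))"
  proof (rule nn_integral_monotone_convergence_INF_decseq[where i=0])
    show "decseq (\<lambda>n x. \<Prod>i<n. exp_neg (f i (x i)))"
    proof (intro decseq_SucI le_funI)
      fix n x
      show "(\<Prod>i<Suc n. exp_neg (f i (x i))) \<le> (\<Prod>i<n. exp_neg (f i (x i)))"
        using mult_left_mono[OF exp_neg_le_1[of "f n (x n)"], of "\<Prod>i<n. exp_neg (f i (x i))"] by simp
    qed
  qed (simp_all add: X.P.emeasure_space_1)
  also have "\<dots> = (INF n. \<Prod>i<n. \<integral>\<^sup>+x. exp_neg (f i x) \<partial>L)"
    by (subst nn_integral_PiM_prod[OF L]) auto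
  also have "\<dots> = (INF n. \<Prod>i<n. exp_neg (neg_ln (\<integral>\<^sup>+x. exp_neg (f i x) \<partial>L)))"
    by (simp add: exp_neg_neg_ln[OF le1[OF L]])
  finally show ?thesis by (simp add: exp_neg_suminf)
qed

context ppp
begin

text \<open>With the points held fixed, integrating out the marks replaces \<open>\<phi>\<close> by
  \<open>\<psi>\<close>, minus the logarithm of the mean of \<open>exp_neg (\<phi> (p, x))\<close>
  over the mark \<open>x\<close>. The unmarked formula applies to \<open>\<psi>\<close>, and there
  \<open>exp_neg\<close> undoes the logarithm.\<close>

theorem laplace_functional_marked:
  assumes L: "prob_space L" and \<phi>[measurable]: "\<phi> \<in> borel_measurable (\<mu> \<Otimes>\<^sub>M L)"
  shows "(\<integral>\<^sup>+\<omega>. \<integral>\<^sup>+x. exp_neg (\<Sum>i. \<phi> (P i \<omega>, x i)) \<partial>Pi\<^sub>M UNIV (\<lambda>_. L) \<partial>N)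
    = exp_neg (\<integral>\<^sup>+p. \<integral>\<^sup>+x. 1 - exp_neg (\<phi> (p, x)) \<partial>L \<partial>\<mu>)"
proof -
  interpret L: prob_space L by fact
  define \<psi> where "\<psi> p = neg_ln (\<integral>\<^sup>+x. exp_neg (\<phi> (p, x)) \<partial>L)" for p
  have \<psi>[measurable]: "\<psi> \<in> borel_measurable \<mu>" unfolding \<psi>_def by measurable
  have le1: "(\<integral>\<^sup>+x. exp_neg (\<phi> (p, x)) \<partial>L) \<le> 1" for p
  proof -
    have "(\<integral>\<^sup>+x. exp_neg (\<phi> (p, x)) \<partial>L) \<le> (\<integral>\<^sup>+x. 1 \<partial>L)" by (intro nn_integral_mono exp_neg_le_1)
    then show ?thesis by (simp add: L.emeasure_space_1)
  qed
  have "(\<integral>\<^sup>+\<omega>. \<integral>\<^sup>+x. exp_neg (\<Sum>i. \<phi> (P i \<omega>, x i)) \<partial>Pi\<^sub>M UNIV (\<lambda>_. L) \<partial>N)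
     = (\<integral>\<^sup>+\<omega>. exp_neg (\<Sum>i. \<psi> (P i \<omega>)) \<partial>N)"
  proof (intro nn_integral_cong)
    fix \<omega> assume \<omega>: "\<omega> \<in> space N"
    have "(\<lambda>x. \<phi> (P i \<omega>, x)) \<in> borel_measurable L" for i
      using measurable_space[OF P_measurable \<omega>] by measurable
    then show "(\<integral>\<^sup>+x. exp_neg (\<Sum>i. \<phi> (P i \<omega>, x i)) \<partial>Pi\<^sub>M UNIV (\<lambda>_. L)) = exp_neg (\<Sum>i. \<psi> (P i \<omega>))"
      unfolding \<psi>_def by (rule nn_integral_PiM_exp_neg_suminf[OF L])
  qed
  also have "\<dots> = exp_neg (\<integral>\<^sup>+p. 1 - exp_neg (\<psi> p) \<partial>\<mu>)" by (rule laplace_functional[OF \<psi>])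
  also have "(\<integral>\<^sup>+p. 1 - exp_neg (\<psi> p) \<partial>\<mu>) = (\<integral>\<^sup>+p. \<integral>\<^sup>+x. 1 - exp_neg (\<phi> (p, x)) \<partial>L \<partial>\<mu>)"
  proof (intro nn_integral_cong)
    fix p assume p: "p \<in> space \<mu>"
    have "(\<integral>\<^sup>+x. 1 - exp_neg (\<phi> (p, x)) \<partial>L) = (\<integral>\<^sup>+x. 1 \<partial>L) - (\<integral>\<^sup>+x. exp_neg (\<phi> (p, x)) \<partial>L)"
      using p le1[of p] by (intro nn_integral_diff) (auto simp: exp_neg_le_1 top_unique)
    then show "1 - exp_neg (\<psi> p) = (\<integral>\<^sup>+x. 1 - exp_neg (\<phi> (p, x)) \<partial>L)"
      by (simp add: \<psi>_def exp_neg_neg_ln[OF le1] L.emeasure_space_1)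
  qed
  finally show ?thesis .
qed

end

section \<open>Marks living on the same sample space as the points\<close>

lemma distr_Pair_independent_rvs:
  assumes "prob_space M" and ind: "independent_rvs M A X B Y"
  shows "distr M (A \<Otimes>\<^sub>M B) (\<lambda>\<omega>. (X \<omega>, Y \<omega>)) = distr M A X \<Otimes>\<^sub>M distr M B Y"
proof -
  interpret prob_space M by fact
  have X[measurable]: "X \<in> M \<rightarrow>\<^sub>M A" and Y[measurable]: "Y \<in> M \<rightarrow>\<^sub>M B"
    using ind by (auto simp: independent_rvs_def)
  interpret X: prob_space "distr M A X" by (rule prob_space_distr) measurable
  interpret Y: prob_space "distr M B Y" by (rule prob_space_distr) measurable
  show ?thesis
  proof (rule pair_measure_eqI[symmetric])
    fix S T assume S: "S \<in> sets (distr M A X)" and T: "T \<in> sets (distr M B Y)"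
    then have S': "S \<in> sets A" and T': "T \<in> sets B" by simp_all
    have "\<forall>a\<in>{X -` S \<inter> space M | S. S \<in> sets A}. \<forall>b\<in>{Y -` S \<inter> space M | S. S \<in> sets B}.
        prob (a \<inter> b) = prob a * prob b"
      using ind unfolding independent_rvs_def indep_sets2_eq by (elim conjE)
    then have "\<forall>b\<in>{Y -` S \<inter> space M | S. S \<in> sets B}.
        prob (X -` S \<inter> space M \<inter> b) = prob (X -` S \<inter> space M) * prob b"
      by (rule bspec) (use S' in blast)
    then have "prob (X -` S \<inter> space M \<inter> (Y -` T \<inter> space M)) = prob (X -` S \<inter> space M) * prob (Y -` T \<inter> space M)"
      by (rule bspec) (use T' in blast)
    moreover have "X -` S \<inter> space M \<inter> (Y -` T \<inter> space M) = (\<lambda>\<omega>. (X \<omega>, Y \<omega>)) -` (S \<times> T) \<inter> space M" by auto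
    ultimately show "emeasure (distr M A X) S * emeasure (distr M B Y) T
        = emeasure (distr M (A \<Otimes>\<^sub>M B) (\<lambda>\<omega>. (X \<omega>, Y \<omega>))) (S \<times> T)"
      using S T by (simp add: emeasure_distr emeasure_eq_measure ennreal_mult)
  qed (simp_all add: X.sigma_finite_measure_axioms Y.sigma_finite_measure_axioms)
qed

lemma distr_indep_sequence:
  assumes "prob_space M" and ind: "prob_space.indep_vars M (\<lambda>_. A) X UNIV" and law: "\<And>i. distr M A (X i) = L"
  shows "distr M (Pi\<^sub>M UNIV (\<lambda>_. A)) (\<lambda>\<omega> i. X i \<omega>) = Pi\<^sub>M UNIV (\<lambda>_. L)"
proof -
  interpret prob_space M by fact
  have X: "random_variable A (X i)" for i using ind by (simp add: indep_vars_def2)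
  show ?thesis
    using ind by (subst (asm) indep_vars_iff_distr_eq_PiM) (auto simp: X law restrict_def)
qed

context ppp
begin

text \<open>By independence the joint law of points and marks is a product, so the marks can be
  integrated out for fixed points. \<open>S\<close> names the \<sigma>-algebra for which
  independence is stated; \<open>\<mu>\<close> has the same measurable sets.\<close>

corollary laplace_functional_independent_marks:
  assumes ind: "indep_vars (\<lambda>_. A) X UNIV" and law: "\<And>i. distr N A (X i) = L" and S: "sets S = sets \<mu>"
    and joint: "independent_rvs N (Pi\<^sub>M UNIV (\<lambda>_. S)) (\<lambda>\<omega> i. P i \<omega>) (Pi\<^sub>M UNIV (\<lambda>_. A)) (\<lambda>\<omega> i. X i \<omega>)"
    and \<phi>: "\<phi> \<in> borel_measurable (\<mu> \<Otimes>\<^sub>M L)"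
  shows "(\<integral>\<^sup>+\<omega>. exp_neg (\<Sum>i. \<phi> (P i \<omega>, X i \<omega>)) \<partial>N)
    = exp_neg (\<integral>\<^sup>+p. \<integral>\<^sup>+x. 1 - exp_neg (\<phi> (p, x)) \<partial>L \<partial>\<mu>)"
proof -
  have X[measurable]: "X i \<in> N \<rightarrow>\<^sub>M A" for i using ind by (simp add: indep_vars_def2)
  have L: "prob_space L" using law[of 0] prob_space_distr[OF X] by metis
  have sL[measurable_cong]: "sets L = sets A" using law[of 0] by (metis sets_distr)
  interpret L: prob_space L by fact
  interpret LL: product_prob_space "\<lambda>_::nat. L" UNIV by unfold_locales
  note S[measurable_cong]
  have PS: "P i \<in> N \<rightarrow>\<^sub>M S" for i
    using P_measurable by (simp cong: measurable_cong_sets add: S)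
  then have Pm[measurable]: "(\<lambda>\<omega> i. P i \<omega>) \<in> N \<rightarrow>\<^sub>M Pi\<^sub>M UNIV (\<lambda>_. S)"
    by (intro measurable_PiM_single') (auto intro: measurable_space[OF PS] PS)
  have [measurable]: "(\<lambda>\<omega> i. X i \<omega>) \<in> N \<rightarrow>\<^sub>M Pi\<^sub>M UNIV (\<lambda>_. A)"
    by (intro measurable_PiM_single') (auto intro: measurable_space[OF X] X)
  have \<phi>'[measurable]: "(\<lambda>(p, x). exp_neg (\<Sum>i. \<phi> (p i, x i)))
      \<in> borel_measurable (Pi\<^sub>M UNIV (\<lambda>_. S) \<Otimes>\<^sub>M Pi\<^sub>M UNIV (\<lambda>_. A))"
    using \<phi> by measurable
  have "(\<integral>\<^sup>+\<omega>. exp_neg (\<Sum>i. \<phi> (P i \<omega>, X i \<omega>)) \<partial>N)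
     = (\<integral>\<^sup>+z. (\<lambda>(p, x). exp_neg (\<Sum>i. \<phi> (p i, x i))) z
          \<partial>distr N (Pi\<^sub>M UNIV (\<lambda>_. S) \<Otimes>\<^sub>M Pi\<^sub>M UNIV (\<lambda>_. A)) (\<lambda>\<omega>. ((\<lambda>i. P i \<omega>), (\<lambda>i. X i \<omega>))))"
    by (subst nn_integral_distr) auto
  also have "\<dots> = (\<integral>\<^sup>+z. (\<lambda>(p, x). exp_neg (\<Sum>i. \<phi> (p i, x i))) z
      \<partial>(distr N (Pi\<^sub>M UNIV (\<lambda>_. S)) (\<lambda>\<omega> i. P i \<omega>) \<Otimes>\<^sub>M Pi\<^sub>M UNIV (\<lambda>_. L)))"
    unfolding distr_Pair_independent_rvs[OF prob_space_axioms joint]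
      distr_indep_sequence[OF prob_space_axioms ind law] ..
  also have "\<dots> = (\<integral>\<^sup>+p. \<integral>\<^sup>+x. exp_neg (\<Sum>i. \<phi> (p i, x i)) \<partial>Pi\<^sub>M UNIV (\<lambda>_. L)
      \<partial>distr N (Pi\<^sub>M UNIV (\<lambda>_. S)) (\<lambda>\<omega> i. P i \<omega>))"
    by (subst LL.P.nn_integral_fst[symmetric]) auto
  also have "\<dots> = (\<integral>\<^sup>+\<omega>. \<integral>\<^sup>+x. exp_neg (\<Sum>i. \<phi> (P i \<omega>, x i)) \<partial>Pi\<^sub>M UNIV (\<lambda>_. L) \<partial>N)"
    by (subst nn_integral_distr) auto
  finally show ?thesis by (simp add: laplace_functional_marked[OF L \<phi>])
qed

end

text \<open>The weight \<open>exp (- u)\<close> is an eigenfunction of translations. This is the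
  source both of the logarithmic correction in the product process and of the homogeneity of
  \<open>exponent\<close>.\<close>

lemma nn_integral_exp_translate:
  fixes g :: "real \<Rightarrow> ennreal"
  assumes [measurable]: "g \<in> borel_measurable borel"
  shows "(\<integral>\<^sup>+u. ennreal (exp (- u)) * g (u + c) \<partial>lborel) = ennreal (exp c) * (\<integral>\<^sup>+u. ennreal (exp (- u)) * g u \<partial>lborel)"
proof -
  have e: "ennreal (exp (- u - c)) = ennreal (exp (- c)) * ennreal (exp (- u))" for u
    by (simp add: exp_add[symmetric] flip: ennreal_mult)
  have "(\<integral>\<^sup>+u. ennreal (exp (- u)) * g u \<partial>lborel) = (\<integral>\<^sup>+u. ennreal (exp (- (c + 1 * u))) * g (c + 1 * u) \<partial>lborel)"
    by (subst nn_integral_real_affine[where c=1 and t=c]) auto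
  also have "\<dots> = (\<integral>\<^sup>+u. ennreal (exp (- c)) * (ennreal (exp (- u)) * g (u + c)) \<partial>lborel)"
    by (simp add: e mult.assoc add.commute)
  also have "\<dots> = ennreal (exp (- c)) * (\<integral>\<^sup>+u. ennreal (exp (- u)) * g (u + c) \<partial>lborel)"
    by (rule nn_integral_cmult) measurable
  finally show ?thesis
    by (simp add: exp_minus flip: mult.assoc ennreal_mult)
qed

section \<open>Construction of a Poisson process on the product space\<close>

lemma prob_space_positive_density:
  obtains p :: "'a::euclidean_space \<Rightarrow> real"
  where "p \<in> borel_measurable borel" "\<And>x. 0 < p x" "prob_space (density lborel (\<lambda>x. ennreal (p x)))"
proof -
  \<comment> \<open>Sigma-finiteness provides a strictly positive integrable function. Positivity
    everywhere matters, because the logarithm of the normalised function is used as a shift.\<close>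
  obtain h :: "'a \<Rightarrow> ennreal" where h[measurable]: "h \<in> borel_measurable lborel"
    and int: "integral\<^sup>N lborel h \<noteq> \<infinity>" and pos: "\<And>x. 0 < h x \<and> h x < \<infinity>"
    using sigma_finite_measure.Ex_finite_integrable_function[OF sigma_finite_lborel] by auto
  define c where "c = enn2real (integral\<^sup>N lborel h)"
  have "integral\<^sup>N lborel h \<noteq> 0"
  proof
    assume "integral\<^sup>N lborel h = 0"
    then have "AE x in (lborel :: 'a measure). h x = 0" by (simp add: nn_integral_0_iff_AE)
    then have "AE x in (lborel :: 'a measure). False"
      by (rule eventually_mono) (use pos in \<open>auto simp: less_le\<close>)
    then show False by (simp add: AE_iff_measurable[OF _ refl])
  qed
  then have c: "0 < c" "integral\<^sup>N lborel h = ennreal c"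
    using int by (auto simp: c_def enn2real_positive_iff less_top zero_less_iff_neq_zero)
  define p where "p x = enn2real (h x) / c" for x
  have [measurable]: "p \<in> borel_measurable borel" unfolding p_def using h by simp
  have hp: "ennreal (p x) = ennreal (1 / c) * h x" for x
    using c pos[of x] by (simp add: p_def divide_inverse ennreal_mult mult.commute)
  have "(\<integral>\<^sup>+x. ennreal (p x) \<partial>lborel) = 1"
    unfolding hp using c by (simp add: nn_integral_cmult flip: ennreal_mult)
  then have "prob_space (density lborel (\<lambda>x. ennreal (p x)))"
    by (intro prob_spaceI) (simp add: emeasure_density)
  moreover have "0 < p x" for x using pos[of x] c by (simp add: p_def enn2real_positive_iff)
  ultimately show ?thesis by (intro that[of p]) auto
qed

text \<open>
  For a probability density \<open>p > 0\<close> and independent marks \<open>t\<^sub>i\<close> with this density, the points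
  \<open>(t\<^sub>i, U\<^sub>i - ln (p t\<^sub>i))\<close> have intensity \<open>exp (- y) dt dy\<close>.
\<close>

theorem exists_poisson_point_process_product:
  assumes "prob_space N" and U: "poisson_point_process N (density lborel (\<lambda>y. ennreal (exp (- y)))) U"
  obtains K :: "(nat \<Rightarrow> 'a::euclidean_space \<times> real) measure"
  where "prob_space K" "sets K = sets (Pi\<^sub>M UNIV (\<lambda>_. borel \<Otimes>\<^sub>M borel))"
    "poisson_point_process K (density (lborel \<Otimes>\<^sub>M lborel) (\<lambda>(t, y). ennreal (exp (- y)))) (\<lambda>i p. p i)"
proof -
  let ?\<mu> = "density (lborel \<Otimes>\<^sub>M lborel) (\<lambda>(t :: 'a, y). ennreal (exp (- y)))"
  let ?\<nu> = "density lborel (\<lambda>y. ennreal (exp (- y)))"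
  interpret U: ppp N ?\<nu> U using assms by (simp add: ppp_def ppp_axioms_def)
  obtain p :: "'a \<Rightarrow> real" where p[measurable]: "p \<in> borel_measurable borel" and pos: "\<And>x. 0 < p x"
    and L: "prob_space (density lborel (\<lambda>x. ennreal (p x)))"
    by (rule prob_space_positive_density) blast
  let ?L = "density lborel (\<lambda>x. ennreal (p x))"
  interpret L: prob_space ?L by (rule L)
  interpret LL: product_prob_space "\<lambda>_::nat. ?L" UNIV by unfold_locales
  interpret NL: pair_prob_space N "Pi\<^sub>M UNIV (\<lambda>_::nat. ?L)" by unfold_locales
  have Um[measurable]: "U i \<in> borel_measurable N" for i using U.P_measurable by simp
  define Q where "Q = (\<lambda>(\<omega>, x) i. (x i, U i \<omega> - ln (p (x i))))"
  let ?S = "Pi\<^sub>M (UNIV :: nat set) (\<lambda>_. borel \<Otimes>\<^sub>M borel) :: (nat \<Rightarrow> 'a \<times> real) measure"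
  have Q[measurable]: "Q \<in> N \<Otimes>\<^sub>M Pi\<^sub>M UNIV (\<lambda>_::nat. ?L) \<rightarrow>\<^sub>M ?S"
  proof (rule measurable_PiM_single')
    fix i
    show "(\<lambda>z. Q z i) \<in> N \<Otimes>\<^sub>M Pi\<^sub>M UNIV (\<lambda>_::nat. ?L) \<rightarrow>\<^sub>M borel \<Otimes>\<^sub>M borel"
    proof -
      have "(\<lambda>z. snd z i) \<in> N \<Otimes>\<^sub>M Pi\<^sub>M UNIV (\<lambda>_::nat. ?L) \<rightarrow>\<^sub>M ?L" by measurable
      then have [measurable]: "(\<lambda>z. snd z i) \<in> N \<Otimes>\<^sub>M Pi\<^sub>M UNIV (\<lambda>_::nat. ?L) \<rightarrow>\<^sub>M borel" by simp
      show ?thesis unfolding Q_def split_beta' by simp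
    qed
  qed (auto simp: space_pair_measure)
  let ?K = "distr (N \<Otimes>\<^sub>M Pi\<^sub>M UNIV (\<lambda>_::nat. ?L)) ?S Q"
  have prob: "prob_space ?K" by (rule NL.prob_space_distr) measurable
  have "poisson_point_process ?K ?\<mu> (\<lambda>i p. p i)"
  proof (rule poisson_point_processI_laplace[OF prob])
    show "(\<lambda>p. p i) \<in> ?K \<rightarrow>\<^sub>M ?\<mu>" for i by measurable
    fix \<phi> :: "'a \<times> real \<Rightarrow> ennreal" assume "\<phi> \<in> borel_measurable ?\<mu>"
    then have \<phi>[measurable]: "\<phi> \<in> borel_measurable (borel \<Otimes>\<^sub>M borel)" by simp
    define \<psi> where "\<psi> z = \<phi> (snd z, fst z - ln (p (snd z)))" for z
    have \<psi>[measurable]: "\<psi> \<in> borel_measurable (?\<nu> \<Otimes>\<^sub>M ?L)" unfolding \<psi>_def by measurable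
    have g[measurable]: "(\<lambda>(x, y). 1 - exp_neg (\<phi> (x, y))) \<in> borel_measurable (borel \<Otimes>\<^sub>M borel)" by measurable
    have "(\<integral>\<^sup>+q. exp_neg (\<Sum>i. \<phi> (q i)) \<partial>?K)
        = (\<integral>\<^sup>+z. exp_neg (\<Sum>i. \<phi> (Q z i)) \<partial>(N \<Otimes>\<^sub>M Pi\<^sub>M UNIV (\<lambda>_::nat. ?L)))"
      by (rule nn_integral_distr) measurable
    also have "\<dots> = (\<integral>\<^sup>+\<omega>. \<integral>\<^sup>+x. exp_neg (\<Sum>i. \<psi> (U i \<omega>, x i)) \<partial>Pi\<^sub>M UNIV (\<lambda>_::nat. ?L) \<partial>N)"
      by (subst LL.P.nn_integral_fst[symmetric]) (measurable, simp add: Q_def \<psi>_def)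
    also have "\<dots> = exp_neg (\<integral>\<^sup>+u. \<integral>\<^sup>+x. 1 - exp_neg (\<psi> (u, x)) \<partial>?L \<partial>?\<nu>)"
      by (rule U.laplace_functional_marked[OF L \<psi>])
    also have "(\<integral>\<^sup>+u. \<integral>\<^sup>+x. 1 - exp_neg (\<psi> (u, x)) \<partial>?L \<partial>?\<nu>)
        = (\<integral>\<^sup>+u. \<integral>\<^sup>+x. ennreal (exp (- u)) * (ennreal (p x) * (1 - exp_neg (\<phi> (x, u - ln (p x))))) \<partial>lborel \<partial>lborel)"
      unfolding \<psi>_def by (simp add: nn_integral_density nn_integral_cmult)
    \<comment> \<open>With \<open>u\<close> as the inner variable the shift by
      \<open>ln (p x)\<close> is constant under the integral. It produces the factor
      \<open>1 / p x\<close>, which cancels the density of the marks.\<close>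
    also have "\<dots> = (\<integral>\<^sup>+x. \<integral>\<^sup>+u. ennreal (exp (- u)) * (ennreal (p x) * (1 - exp_neg (\<phi> (x, u - ln (p x))))) \<partial>lborel \<partial>lborel)"
      by (rule lborel_pair.Fubini') measurable
    also have "\<dots> = (\<integral>\<^sup>+x. \<integral>\<^sup>+u. ennreal (exp (- u)) * (1 - exp_neg (\<phi> (x, u))) \<partial>lborel \<partial>lborel)"
    proof (rule nn_integral_cong)
      fix x
      have "(\<integral>\<^sup>+u. ennreal (exp (- u)) * (ennreal (p x) * (1 - exp_neg (\<phi> (x, u - ln (p x))))) \<partial>lborel)
          = (\<integral>\<^sup>+u. ennreal (exp (- u)) * (\<lambda>v. ennreal (p x) * (1 - exp_neg (\<phi> (x, v)))) (u + - ln (p x)) \<partial>lborel)"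
        by simp
      also have "\<dots> = ennreal (exp (- ln (p x))) * (\<integral>\<^sup>+u. ennreal (exp (- u)) * (ennreal (p x) * (1 - exp_neg (\<phi> (x, u)))) \<partial>lborel)"
        by (rule nn_integral_exp_translate) measurable
      also have "\<dots> = ennreal (exp (- ln (p x))) * (\<integral>\<^sup>+u. ennreal (p x) * (ennreal (exp (- u)) * (1 - exp_neg (\<phi> (x, u)))) \<partial>lborel)"
        by (simp add: ac_simps)
      also have "\<dots> = ennreal (exp (- ln (p x))) * (ennreal (p x) * (\<integral>\<^sup>+u. ennreal (exp (- u)) * (1 - exp_neg (\<phi> (x, u))) \<partial>lborel))"
        by (subst nn_integral_cmult) auto
      also have "\<dots> = (\<integral>\<^sup>+u. ennreal (exp (- u)) * (1 - exp_neg (\<phi> (x, u))) \<partial>lborel)"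
        using pos[of x] by (simp add: exp_minus flip: mult.assoc ennreal_mult)
      finally show "(\<integral>\<^sup>+u. ennreal (exp (- u)) * (ennreal (p x) * (1 - exp_neg (\<phi> (x, u - ln (p x))))) \<partial>lborel)
          = (\<integral>\<^sup>+u. ennreal (exp (- u)) * (1 - exp_neg (\<phi> (x, u))) \<partial>lborel)" .
    qed
    also have "\<dots> = (\<integral>\<^sup>+z. 1 - exp_neg (\<phi> z) \<partial>?\<mu>)"
      by (simp add: nn_integral_density split_beta' flip: lborel.nn_integral_fst)
    finally show "(\<integral>\<^sup>+q. exp_neg (\<Sum>i. \<phi> (q i)) \<partial>?K) = exp_neg (\<integral>\<^sup>+z. 1 - exp_neg (\<phi> z) \<partial>?\<mu>)" .
  qed
  with prob show ?thesis by (intro that[of ?K]) simp_all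
qed

section \<open>Tilting a Gaussian process with stationary increments\<close>

lemma normal_density_exp_tilt:
  assumes "0 < s"
  shows "normal_density 0 s x * exp x = exp (s\<^sup>2 / 2) * normal_density (s\<^sup>2) s x"
proof -
  have "- (x\<^sup>2) / (2 * s\<^sup>2) + x = s\<^sup>2 / 2 + - (x - s\<^sup>2)\<^sup>2 / (2 * s\<^sup>2)"
    using assms by (simp add: field_simps power2_eq_square)
  then have "exp (- (x\<^sup>2) / (2 * s\<^sup>2)) * exp x = exp (s\<^sup>2 / 2) * exp (- (x - s\<^sup>2)\<^sup>2 / (2 * s\<^sup>2))"
    by (simp only: exp_add[symmetric])
  then show ?thesis by (simp add: normal_density_def)
qed

text \<open>The factor adds \<open>1\<close> to the inverse variance. It yields a bounded function
  of a centered Gaussian variable whose mean still determines the variance.\<close>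

lemma normal_density_square_tilt:
  assumes "0 < s"
  shows "normal_density 0 s x * exp (- (x\<^sup>2) / 2) = (1 / sqrt (1 + s\<^sup>2)) * normal_density 0 (s / sqrt (1 + s\<^sup>2)) x"
proof -
  have pos: "0 < 1 + s\<^sup>2" by (simp add: add_pos_nonneg)
  have r: "(s / sqrt (1 + s\<^sup>2))\<^sup>2 = s\<^sup>2 / (1 + s\<^sup>2)" using pos by (simp add: power_divide)
  have "- (x\<^sup>2) / (2 * s\<^sup>2) + - (x\<^sup>2) / 2 = - (x\<^sup>2) / (2 * (s\<^sup>2 / (1 + s\<^sup>2)))"
    using assms pos by (simp add: field_simps)
  then have "exp (- (x\<^sup>2) / (2 * s\<^sup>2)) * exp (- (x\<^sup>2) / 2) = exp (- (x\<^sup>2) / (2 * (s\<^sup>2 / (1 + s\<^sup>2))))"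
    by (simp only: exp_add[symmetric])
  moreover have "1 / sqrt (2 * pi * s\<^sup>2) = (1 / sqrt (1 + s\<^sup>2)) * (1 / sqrt (2 * pi * (s\<^sup>2 / (1 + s\<^sup>2))))"
    using assms pos by (simp add: real_sqrt_divide real_sqrt_mult)
  ultimately show ?thesis by (simp add: normal_density_def r)
qed

text \<open>Stated through the second moment, so that point masses are covered by the same formulas.
  The third one serves the continuity of the variance, where a bounded integrand is wanted.\<close>

lemma gaussian_variable_centered:
  assumes "prob_space M" and X: "gaussian_variable M X" and mean: "prob_space.expectation M X = 0"
  shows "integrable M (\<lambda>\<omega>. (X \<omega>)\<^sup>2)"
    and "(\<integral>\<^sup>+\<omega>. ennreal (exp (X \<omega>)) \<partial>M) = ennreal (exp ((\<integral>\<omega>. (X \<omega>)\<^sup>2 \<partial>M) / 2))"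
    and "(\<integral>\<^sup>+\<omega>. ennreal (exp (- ((X \<omega>)\<^sup>2) / 2)) \<partial>M) = ennreal (1 / sqrt (1 + (\<integral>\<omega>. (X \<omega>)\<^sup>2 \<partial>M)))"
proof -
  interpret prob_space M by fact
  have Xm[measurable]: "X \<in> borel_measurable M" using X by (simp add: gaussian_variable_def)
  obtain m where m: "distr M borel X = return borel m \<or> (\<exists>s>0. distributed M lborel X (\<lambda>x. ennreal (normal_density m s x)))"
    using X unfolding gaussian_variable_def by auto
  have "integrable M (\<lambda>\<omega>. (X \<omega>)\<^sup>2) \<and>
    (\<integral>\<^sup>+\<omega>. ennreal (exp (X \<omega>)) \<partial>M) = ennreal (exp ((\<integral>\<omega>. (X \<omega>)\<^sup>2 \<partial>M) / 2)) \<and>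
    (\<integral>\<^sup>+\<omega>. ennreal (exp (- ((X \<omega>)\<^sup>2) / 2)) \<partial>M) = ennreal (1 / sqrt (1 + (\<integral>\<omega>. (X \<omega>)\<^sup>2 \<partial>M)))"
    using m
  proof
    assume d: "distr M borel X = return borel m"
    have "AE x in distr M borel X. x = m" unfolding d by (simp add: AE_return)
    then have Xm_AE: "AE \<omega> in M. X \<omega> = m" by (subst (asm) AE_distr_iff) auto
    have "expectation X = expectation (\<lambda>_. m)" by (rule integral_cong_AE) (use Xm_AE in auto)
    then have "m = 0" using mean by (simp add: prob_space)
    with Xm_AE have X0: "AE \<omega> in M. X \<omega> = 0" by simp
    have "integrable M (\<lambda>\<omega>. (X \<omega>)\<^sup>2)"
      by (subst integrable_cong_AE[where g="\<lambda>_. 0"]) (use X0 in auto)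
    moreover have "(\<integral>\<omega>. (X \<omega>)\<^sup>2 \<partial>M) = (\<integral>\<omega>. 0 \<partial>M)" by (rule integral_cong_AE) (use X0 in auto)
    moreover have "(\<integral>\<^sup>+\<omega>. ennreal (exp (X \<omega>)) \<partial>M) = (\<integral>\<^sup>+\<omega>. 1 \<partial>M)"
      by (rule nn_integral_cong_AE) (use X0 in auto)
    moreover have "(\<integral>\<^sup>+\<omega>. ennreal (exp (- ((X \<omega>)\<^sup>2) / 2)) \<partial>M) = (\<integral>\<^sup>+\<omega>. 1 \<partial>M)"
      by (rule nn_integral_cong_AE) (use X0 in auto)
    ultimately show ?thesis by (simp add: emeasure_space_1)
  next
    assume "\<exists>s>0. distributed M lborel X (\<lambda>x. ennreal (normal_density m s x))"
    then obtain s where s: "0 < s" and D: "distributed M lborel X (\<lambda>x. ennreal (normal_density m s x))" by auto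
    have "m = 0" using normal_distributed_expectation[OF s D] mean by simp
    with D have D: "distributed M lborel X (\<lambda>x. ennreal (normal_density 0 s x))" by simp
    have I: "integrable M (\<lambda>\<omega>. (X \<omega>)\<^sup>2)"
      using distributed_integrable[OF D, of "\<lambda>x. x\<^sup>2"] integrable_normal_moment[of s 0 2] s by simp
    have V: "(\<integral>\<omega>. (X \<omega>)\<^sup>2 \<partial>M) = s\<^sup>2"
      using normal_distributed_variance[OF s D] mean by simp
    have "(\<integral>\<^sup>+\<omega>. ennreal (exp (X \<omega>)) \<partial>M) = (\<integral>\<^sup>+x. ennreal (normal_density 0 s x) * ennreal (exp x) \<partial>lborel)"
      by (rule distributed_nn_integral[OF D, symmetric]) simp
    also have "\<dots> = (\<integral>\<^sup>+x. ennreal (exp (s\<^sup>2 / 2)) * ennreal (normal_density (s\<^sup>2) s x) \<partial>lborel)"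
      by (intro nn_integral_cong) (simp add: normal_density_exp_tilt[OF s] flip: ennreal_mult)
    also have "\<dots> = ennreal (exp (s\<^sup>2 / 2)) * (\<integral>\<^sup>+x. ennreal (normal_density (s\<^sup>2) s x) \<partial>lborel)"
      by (rule nn_integral_cmult) simp
    also have "(\<integral>\<^sup>+x. ennreal (normal_density (s\<^sup>2) s x) \<partial>lborel) = 1"
      using s by (subst nn_integral_eq_integral) (auto simp: integral_normal_density)
    finally have E: "(\<integral>\<^sup>+\<omega>. ennreal (exp (X \<omega>)) \<partial>M) = ennreal (exp (s\<^sup>2 / 2))" by simp
    have s': "0 < s / sqrt (1 + s\<^sup>2)" using s by (simp add: add_pos_nonneg)
    have "(\<integral>\<^sup>+\<omega>. ennreal (exp (- ((X \<omega>)\<^sup>2) / 2)) \<partial>M)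
        = (\<integral>\<^sup>+x. ennreal (normal_density 0 s x) * ennreal (exp (- (x\<^sup>2) / 2)) \<partial>lborel)"
      by (rule distributed_nn_integral[OF D, symmetric]) simp
    also have "\<dots> = (\<integral>\<^sup>+x. ennreal (1 / sqrt (1 + s\<^sup>2)) * ennreal (normal_density 0 (s / sqrt (1 + s\<^sup>2)) x) \<partial>lborel)"
      by (intro nn_integral_cong)
        (simp only: normal_density_square_tilt[OF s] ennreal_mult[symmetric] normal_density_nonneg exp_ge_zero
          divide_nonneg_nonneg zero_le_one real_sqrt_ge_zero add_nonneg_nonneg zero_le_power2)
    also have "\<dots> = ennreal (1 / sqrt (1 + s\<^sup>2)) * (\<integral>\<^sup>+x. ennreal (normal_density 0 (s / sqrt (1 + s\<^sup>2)) x) \<partial>lborel)"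
      by (rule nn_integral_cmult) simp
    also have "(\<integral>\<^sup>+x. ennreal (normal_density 0 (s / sqrt (1 + s\<^sup>2)) x) \<partial>lborel) = 1"
      using s' by (subst nn_integral_eq_integral) (auto simp: integral_normal_density)
    finally show ?thesis using I V E by simp
  qed
  then show "integrable M (\<lambda>\<omega>. (X \<omega>)\<^sup>2)"
    and "(\<integral>\<^sup>+\<omega>. ennreal (exp (X \<omega>)) \<partial>M) = ennreal (exp ((\<integral>\<omega>. (X \<omega>)\<^sup>2 \<partial>M) / 2))"
    and "(\<integral>\<^sup>+\<omega>. ennreal (exp (- ((X \<omega>)\<^sup>2) / 2)) \<partial>M) = ennreal (1 / sqrt (1 + (\<integral>\<omega>. (X \<omega>)\<^sup>2 \<partial>M)))"
    by auto
qed

section \<open>The linear span of a centered Gaussian process\<close>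

locale centered_gaussian_process = prob_space M for M :: "'w measure" +
  fixes W :: "'t \<Rightarrow> 'w \<Rightarrow> real"
  assumes gaussian: "gaussian_process M W" and zero_mean: "zero_mean M W"
begin

text \<open>The Gaussian space of the process. It is closed under sums and its members are centered
  Gaussian, so an exponential moment involving several coordinates reduces to the second moment of a
  single member.\<close>

definition lincomb :: "('w \<Rightarrow> real) \<Rightarrow> bool" where
  "lincomb X \<longleftrightarrow> (\<exists>T a. finite T \<and> X = (\<lambda>\<omega>. \<Sum>t\<in>T. a t * W t \<omega>))"

lemma lincomb_0: "lincomb (\<lambda>_. 0)"
  unfolding lincomb_def by (rule exI[of _ "{}"]) simp

lemma lincomb_W: "lincomb (W t)"
  unfolding lincomb_def by (intro exI[of _ "{t}"] exI[of _ "\<lambda>_. 1"]) simp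

lemma lincomb_cmult: "lincomb X \<Longrightarrow> lincomb (\<lambda>\<omega>. c * X \<omega>)"
proof -
  assume "lincomb X"
  then obtain T a where "finite T" "X = (\<lambda>\<omega>. \<Sum>t\<in>T. a t * W t \<omega>)" by (auto simp: lincomb_def)
  then show ?thesis
    unfolding lincomb_def by (intro exI[of _ T] exI[of _ "\<lambda>t. c * a t"]) (simp add: sum_distrib_left mult.assoc)
qed

lemma lincomb_add: assumes "lincomb X" "lincomb Y" shows "lincomb (\<lambda>\<omega>. X \<omega> + Y \<omega>)"
proof -
  obtain S a T b where S: "finite S" "X = (\<lambda>\<omega>. \<Sum>t\<in>S. a t * W t \<omega>)"
    and T: "finite T" "Y = (\<lambda>\<omega>. \<Sum>t\<in>T. b t * W t \<omega>)" using assms by (auto simp: lincomb_def)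
  let ?c = "\<lambda>t. (if t \<in> S then a t else 0) + (if t \<in> T then b t else 0)"
  have "(\<Sum>t\<in>S \<union> T. ?c t * W t \<omega>) = X \<omega> + Y \<omega>" for \<omega>
  proof -
    have "(\<Sum>t\<in>S \<union> T. ?c t * W t \<omega>)
        = (\<Sum>t\<in>S \<union> T. if t \<in> S then a t * W t \<omega> else 0) + (\<Sum>t\<in>S \<union> T. if t \<in> T then b t * W t \<omega> else 0)"
      by (subst sum.distrib[symmetric]) (auto simp: algebra_simps intro!: sum.cong)
    also have "(\<Sum>t\<in>S \<union> T. if t \<in> S then a t * W t \<omega> else 0) = X \<omega>"
      using S T(1) by (auto intro!: sum.mono_neutral_cong_right)
    also have "(\<Sum>t\<in>S \<union> T. if t \<in> T then b t * W t \<omega> else 0) = Y \<omega>"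
      using T S(1) by (auto intro!: sum.mono_neutral_cong_right)
    finally show ?thesis .
  qed
  then show ?thesis using S(1) T(1) unfolding lincomb_def by (intro exI[of _ "S \<union> T"] exI[of _ ?c]) auto
qed

lemma lincomb_diff: "lincomb X \<Longrightarrow> lincomb Y \<Longrightarrow> lincomb (\<lambda>\<omega>. X \<omega> - Y \<omega>)"
  using lincomb_add[of X "\<lambda>\<omega>. (-1) * Y \<omega>"] lincomb_cmult[of Y "-1"] by simp

lemma lincomb_sum: "(\<And>i. i \<in> I \<Longrightarrow> lincomb (X i)) \<Longrightarrow> lincomb (\<lambda>\<omega>. \<Sum>i\<in>I. X i \<omega>)"
  by (induction I rule: infinite_finite_induct) (auto intro: lincomb_0 lincomb_add)

lemma lincomb_gaussian: "lincomb X \<Longrightarrow> gaussian_variable M X"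
  using gaussian unfolding lincomb_def gaussian_process_def by auto

lemma lincomb_measurable: "lincomb X \<Longrightarrow> X \<in> borel_measurable M"
  using lincomb_gaussian by (auto simp: gaussian_variable_def)

lemma W_measurable [measurable]: "W t \<in> borel_measurable M"
  by (rule lincomb_measurable[OF lincomb_W])

lemma W_square_integrable: "integrable M (\<lambda>\<omega>. (W t \<omega>)\<^sup>2)"
  using gaussian_variable_centered(1)[OF prob_space_axioms lincomb_gaussian[OF lincomb_W]] zero_mean
  by (simp add: zero_mean_def)

lemma lincomb_mean: "lincomb X \<Longrightarrow> expectation X = 0"
proof -
  assume "lincomb X"
  then obtain T a where X: "finite T" "X = (\<lambda>\<omega>. \<Sum>t\<in>T. a t * W t \<omega>)" by (auto simp: lincomb_def)
  have "integrable M (W t)" for t by (rule square_integrable_imp_integrable[OF W_measurable W_square_integrable])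
  then show ?thesis using zero_mean by (simp add: X zero_mean_def)
qed

lemmas lincomb_centered = gaussian_variable_centered[OF prob_space_axioms lincomb_gaussian lincomb_mean]

lemma lincomb_mult_integrable:
  assumes X: "lincomb X" and Y: "lincomb Y"
  shows "integrable M (\<lambda>\<omega>. X \<omega> * Y \<omega>)"
proof -
  \<comment> \<open>Polarisation reduces products to squares, which are integrable for every member
    of the span.\<close>
  have "(\<lambda>\<omega>. X \<omega> * Y \<omega>) = (\<lambda>\<omega>. ((X \<omega> + Y \<omega>)\<^sup>2 - (X \<omega>)\<^sup>2 - (Y \<omega>)\<^sup>2) / 2)"
    by (simp add: power2_eq_square algebra_simps)
  then show ?thesis
    using lincomb_centered(1)[OF X X] lincomb_centered(1)[OF Y Y] lincomb_centered(1)[OF lincomb_add[OF X Y] lincomb_add[OF X Y]]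
    by simp
qed

lemma expectation_square_add:
  assumes X: "lincomb X" and Y: "lincomb Y"
  shows "(\<integral>\<omega>. (X \<omega> + Y \<omega>)\<^sup>2 \<partial>M) = (\<integral>\<omega>. (X \<omega>)\<^sup>2 \<partial>M) + 2 * (\<integral>\<omega>. X \<omega> * Y \<omega> \<partial>M) + (\<integral>\<omega>. (Y \<omega>)\<^sup>2 \<partial>M)"
proof -
  have "(\<integral>\<omega>. (X \<omega> + Y \<omega>)\<^sup>2 \<partial>M) = (\<integral>\<omega>. (X \<omega>)\<^sup>2 + 2 * (X \<omega> * Y \<omega>) + (Y \<omega>)\<^sup>2 \<partial>M)"
    by (simp add: power2_eq_square algebra_simps)
  then show ?thesis
    using lincomb_centered(1)[OF X X] lincomb_centered(1)[OF Y Y] lincomb_mult_integrable[OF X Y] by simp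
qed

end

text \<open>This is all that is retained of the Gaussian hypotheses: the normalisation of
  \<open>exp (v 0)\<close> and the independence of the base point after tilting. The path properties
  are demanded at every sample point, so that all paths lie in one fixed set of functions.\<close>

locale spectral_process = prob_space M for M :: "'w measure" +
  fixes v :: "'a::euclidean_space \<Rightarrow> 'w \<Rightarrow> real"
  assumes v_measurable [measurable]: "\<And>t. v t \<in> borel_measurable M"
    and v_continuous: "\<And>\<omega>. \<omega> \<in> space M \<Longrightarrow> continuous_on UNIV (\<lambda>t. v t \<omega>)"
    and v_limit: "\<And>\<omega>. \<omega> \<in> space M \<Longrightarrow> filterlim (\<lambda>t. v t \<omega>) at_bot at_infinity"
    and v_normalized: "(\<integral>\<^sup>+\<omega>. ennreal (exp (v 0 \<omega>)) \<partial>M) = 1"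
    and v_tilted: "\<And>s. distr (density M (\<lambda>\<omega>. ennreal (exp (v s \<omega>)))) path_space (\<lambda>\<omega> t. v (t + s) \<omega> - v s \<omega>)
        = distr (density M (\<lambda>\<omega>. ennreal (exp (v 0 \<omega>)))) path_space (\<lambda>\<omega> t. v t \<omega> - v 0 \<omega>)"

section \<open>Exponential moments under the change of measure\<close>

locale stationary_gaussian_increments = centered_gaussian_process M W
  for M :: "'w measure" and W :: "'a::euclidean_space \<Rightarrow> 'w \<Rightarrow> real" +
  assumes stationary: "stationary_increments M W" and sample_continuous: "sample_continuous M W"
begin

definition var :: "'a \<Rightarrow> real" where "var t = (\<integral>\<omega>. (W t \<omega>)\<^sup>2 \<partial>M)"

text \<open>Stationarity compares the base points \<open>s\<close> and \<open>0\<close>; the term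
  \<open>W 0\<close> stays because it need not vanish.\<close>

lemma increment_second_moment_stationary:
  assumes "finite T"
  shows "(\<integral>\<omega>. (\<Sum>t\<in>T. a t * (W (t + s) \<omega> - W s \<omega>))\<^sup>2 \<partial>M) = (\<integral>\<omega>. (\<Sum>t\<in>T. a t * (W t \<omega> - W 0 \<omega>))\<^sup>2 \<partial>M)"
proof -
  have *: "(\<integral>\<omega>. (\<Sum>t\<in>T. a t * (W (t + s) \<omega> - W s \<omega>))\<^sup>2 \<partial>M)
      = (\<integral>f. (\<Sum>t\<in>T. a t * f t)\<^sup>2 \<partial>process_law M (\<lambda>t \<omega>. W (t + s) \<omega> - W s \<omega>))" for s
    unfolding process_law_def by (subst integral_distr) (auto intro!: measurable_PiM_single')
  have "process_law M (\<lambda>t \<omega>. W (t + s) \<omega> - W s \<omega>) = process_law M (\<lambda>t \<omega>. W (t + 0) \<omega> - W 0 \<omega>)"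
    using stationary unfolding stationary_increments_def by blast
  then show ?thesis using *[of s] *[of 0] by simp
qed

text \<open>The exponent is a centered Gaussian variable minus a constant, so the integral is the
  exponential of half its variance minus that constant. By polarisation, twice the covariance of
  \<open>W s\<close> with an increment equals \<open>var (t + s) - var s\<close> minus the second
  moment of the increment; the terms in \<open>var\<close> cancel against the drift. What remains
  are second moments of increments, and these do not depend on \<open>s\<close>.\<close>

lemma tilted_exp_integral:
  assumes T: "finite T"
  shows "(\<integral>\<^sup>+\<omega>. ennreal (exp (W s \<omega> - var s / 2 + (\<Sum>t\<in>T. a t * ((W (t + s) \<omega> - var (t + s) / 2) - (W s \<omega> - var s / 2))))) \<partial>M)
    = ennreal (exp (((\<integral>\<omega>. (\<Sum>t\<in>T. a t * (W t \<omega> - W 0 \<omega>))\<^sup>2 \<partial>M)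
        - (\<Sum>t\<in>T. a t * (\<integral>\<omega>. (W t \<omega> - W 0 \<omega>)\<^sup>2 \<partial>M))) / 2))"
proof -
  define D where "D t \<omega> = W (t + s) \<omega> - W s \<omega>" for t \<omega>
  define A where "A \<omega> = (\<Sum>t\<in>T. a t * D t \<omega>)" for \<omega>
  define K where "K = var s / 2 + (\<Sum>t\<in>T. a t * (var (t + s) / 2 - var s / 2))"
  have D: "lincomb (D t)" for t unfolding D_def by (intro lincomb_diff lincomb_W)
  have A: "lincomb A" unfolding A_def by (intro lincomb_sum lincomb_cmult D)
  have XA: "lincomb (\<lambda>\<omega>. W s \<omega> + A \<omega>)" by (intro lincomb_add lincomb_W A)
  have DD: "(\<integral>\<omega>. (D t \<omega>)\<^sup>2 \<partial>M) = (\<integral>\<omega>. (W t \<omega> - W 0 \<omega>)\<^sup>2 \<partial>M)" for t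
    using increment_second_moment_stationary[of "{t}" "\<lambda>_. 1" s] by (simp add: D_def)
  have AA: "(\<integral>\<omega>. (A \<omega>)\<^sup>2 \<partial>M) = (\<integral>\<omega>. (\<Sum>t\<in>T. a t * (W t \<omega> - W 0 \<omega>))\<^sup>2 \<partial>M)"
    unfolding A_def D_def by (rule increment_second_moment_stationary[OF T])
  have XD: "2 * (\<integral>\<omega>. W s \<omega> * D t \<omega> \<partial>M) = var (t + s) - var s - (\<integral>\<omega>. (D t \<omega>)\<^sup>2 \<partial>M)" for t
    using expectation_square_add[OF lincomb_W[of s] D[of t]] by (simp add: var_def D_def)
  have "(\<integral>\<omega>. W s \<omega> * A \<omega> \<partial>M) = (\<integral>\<omega>. (\<Sum>t\<in>T. a t * (W s \<omega> * D t \<omega>)) \<partial>M)"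
    by (simp add: A_def sum_distrib_left ac_simps)
  also have "\<dots> = (\<Sum>t\<in>T. a t * (\<integral>\<omega>. W s \<omega> * D t \<omega> \<partial>M))"
    by (simp add: lincomb_mult_integrable[OF lincomb_W D])
  finally have "2 * (\<integral>\<omega>. W s \<omega> * A \<omega> \<partial>M) = (\<Sum>t\<in>T. a t * (2 * (\<integral>\<omega>. W s \<omega> * D t \<omega> \<partial>M)))"
    by (simp add: sum_distrib_left ac_simps)
  also have "\<dots> = (\<Sum>t\<in>T. a t * (var (t + s) - var s)) - (\<Sum>t\<in>T. a t * (\<integral>\<omega>. (D t \<omega>)\<^sup>2 \<partial>M))"
    unfolding XD by (simp add: right_diff_distrib sum_subtractf)
  finally have XA2: "(\<integral>\<omega>. (W s \<omega> + A \<omega>)\<^sup>2 \<partial>M) = var s + (\<Sum>t\<in>T. a t * (var (t + s) - var s))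
      - (\<Sum>t\<in>T. a t * (\<integral>\<omega>. (D t \<omega>)\<^sup>2 \<partial>M)) + (\<integral>\<omega>. (A \<omega>)\<^sup>2 \<partial>M)"
    by (subst expectation_square_add[OF lincomb_W A]) (simp add: var_def)
  have eq: "W s \<omega> - var s / 2 + (\<Sum>t\<in>T. a t * ((W (t + s) \<omega> - var (t + s) / 2) - (W s \<omega> - var s / 2)))
      = (W s \<omega> + A \<omega>) - K" for \<omega>
  proof -
    have "(\<Sum>t\<in>T. a t * ((W (t + s) \<omega> - var (t + s) / 2) - (W s \<omega> - var s / 2)))
        = A \<omega> - (\<Sum>t\<in>T. a t * (var (t + s) / 2 - var s / 2))"
      unfolding A_def D_def sum_subtractf[symmetric] by (intro sum.cong) (simp_all add: algebra_simps)
    then show ?thesis by (simp add: K_def)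
  qed
  have e: "ennreal (exp (x - K)) = ennreal (exp (- K)) * ennreal (exp x)" for x
    by (simp add: exp_add[symmetric] flip: ennreal_mult)
  have "(\<integral>\<^sup>+\<omega>. ennreal (exp (W s \<omega> - var s / 2 + (\<Sum>t\<in>T. a t * ((W (t + s) \<omega> - var (t + s) / 2) - (W s \<omega> - var s / 2))))) \<partial>M)
      = (\<integral>\<^sup>+\<omega>. ennreal (exp (- K)) * ennreal (exp (W s \<omega> + A \<omega>)) \<partial>M)"
    unfolding eq e ..
  also have "\<dots> = ennreal (exp (- K)) * (\<integral>\<^sup>+\<omega>. ennreal (exp (W s \<omega> + A \<omega>)) \<partial>M)"
    using lincomb_measurable[OF XA] by (intro nn_integral_cmult) simp
  also have "\<dots> = ennreal (exp (- K + (\<integral>\<omega>. (W s \<omega> + A \<omega>)\<^sup>2 \<partial>M) / 2))"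
    unfolding lincomb_centered(2)[OF XA XA] by (simp add: exp_add[symmetric] flip: ennreal_mult)
  also have "- K + (\<integral>\<omega>. (W s \<omega> + A \<omega>)\<^sup>2 \<partial>M) / 2
      = ((\<integral>\<omega>. (A \<omega>)\<^sup>2 \<partial>M) - (\<Sum>t\<in>T. a t * (\<integral>\<omega>. (D t \<omega>)\<^sup>2 \<partial>M))) / 2"
  proof -
    have "(\<Sum>t\<in>T. a t * (var (t + s) / 2 - var s / 2)) = (\<Sum>t\<in>T. a t * (var (t + s) - var s)) / 2"
      unfolding sum_divide_distrib by (intro sum.cong) (simp_all add: field_simps)
    then show ?thesis unfolding XA2 K_def by (simp add: field_simps)
  qed
  finally show ?thesis unfolding DD AA .
qed

text \<open>Almost sure continuity of the paths does not by itself give convergence of second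
  moments. The bounded function \<open>exp (- ((W t \<omega>)\<^sup>2) / 2)\<close> does converge in
  mean by domination, and its mean \<open>1 / sqrt (1 + var t)\<close> can be solved for
  \<open>var t\<close>. The drift is thus continuous, as \<open>v\<close> requires.\<close>

lemma continuous_var: "continuous_on UNIV var"
proof -
  define h where "h t = (\<integral>\<omega>. exp (- ((W t \<omega>)\<^sup>2) / 2) \<partial>M)" for t
  have h: "h t = 1 / sqrt (1 + var t)" for t
    unfolding h_def using lincomb_centered(3)[OF lincomb_W lincomb_W, of t]
    by (subst integral_eq_nn_integral) (auto simp: var_def)
  have pos: "0 < 1 + var t" for t unfolding var_def by (intro add_pos_nonneg integral_nonneg) auto
  have "(h \<longlongrightarrow> h t) (at t)" for t
  proof (subst tendsto_at_iff_sequentially, intro allI impI)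
    fix X assume "\<forall>i. X i \<in> UNIV - {t}" and X: "X \<longlonglongrightarrow> t"
    have "(\<lambda>n. \<integral>\<omega>. exp (- ((W (X n) \<omega>)\<^sup>2) / 2) \<partial>M) \<longlonglongrightarrow> (\<integral>\<omega>. exp (- ((W t \<omega>)\<^sup>2) / 2) \<partial>M)"
    proof (rule integral_dominated_convergence[where w="\<lambda>_. 1"])
      show "AE \<omega> in M. (\<lambda>n. exp (- ((W (X n) \<omega>)\<^sup>2) / 2)) \<longlonglongrightarrow> exp (- ((W t \<omega>)\<^sup>2) / 2)"
        using sample_continuous unfolding sample_continuous_def
      proof eventually_elim
        case (elim \<omega>)
        then have "isCont (\<lambda>t. W t \<omega>) t" by (simp add: continuous_on_eq_continuous_at)
        then have "(\<lambda>n. W (X n) \<omega>) \<longlonglongrightarrow> W t \<omega>" using X by (rule isCont_tendsto_compose)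
        then show ?case by (intro tendsto_intros) simp_all
      qed
    qed auto
    then show "((h \<circ> X) \<longlongrightarrow> h t) sequentially" by (simp add: h_def comp_def)
  qed
  then have "continuous_on UNIV h" by (simp add: continuous_on_def)
  moreover have "var t = 1 / (h t)\<^sup>2 - 1" for t
    using pos[of t] by (simp add: h power_divide)
  moreover have "h t \<noteq> 0" for t using pos[of t] by (simp add: h)
  ultimately show ?thesis by (auto intro!: continuous_intros)
qed

lemma spectral_modification:
  assumes lim: "AE \<omega> in M. filterlim (\<lambda>t. W t \<omega> - var t / 2) at_bot at_infinity"
  obtains v where "spectral_process M v" "\<And>t. AE \<omega> in M. v t \<omega> = W t \<omega> - var t / 2"
proof -
  have "AE \<omega> in M. continuous_on UNIV (\<lambda>t. W t \<omega>) \<and> filterlim (\<lambda>t. W t \<omega> - var t / 2) at_bot at_infinity"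
    using lim sample_continuous unfolding sample_continuous_def by eventually_elim simp
  then obtain N0 where N0: "N0 \<in> null_sets M"
    and good: "\<And>\<omega>. \<omega> \<in> space M - N0 \<Longrightarrow>
      continuous_on UNIV (\<lambda>t. W t \<omega>) \<and> filterlim (\<lambda>t. W t \<omega> - var t / 2) at_bot at_infinity"
    by (rule AE_E3) blast
  have [measurable]: "N0 \<in> sets M" using N0 by auto
  \<comment> \<open>On the exceptional null set any continuous path tending to minus infinity
    serves; \<open>- norm t\<close> is one.\<close>
  define v where "v t \<omega> = (if \<omega> \<in> N0 then - norm t else W t \<omega> - var t / 2)" for t \<omega>
  have AE_v: "AE \<omega> in M. v t \<omega> = W t \<omega> - var t / 2" for t
    using AE_not_in[OF N0] by eventually_elim (simp add: v_def)
  have vm[measurable]: "v t \<in> borel_measurable M" for t unfolding v_def by measurable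
  \<comment> \<open>The right side is free of \<open>s\<close>, which gives the invariance under the
    base point; with \<open>T\<close> empty it gives the normalisation.\<close>
  have exp_v: "(\<integral>\<^sup>+\<omega>. ennreal (exp (\<Sum>t\<in>T. a t * (v (t + s) \<omega> - v s \<omega>))) \<partial>density M (\<lambda>\<omega>. ennreal (exp (v s \<omega>))))
    = ennreal (exp (((\<integral>\<omega>. (\<Sum>t\<in>T. a t * (W t \<omega> - W 0 \<omega>))\<^sup>2 \<partial>M)
        - (\<Sum>t\<in>T. a t * (\<integral>\<omega>. (W t \<omega> - W 0 \<omega>)\<^sup>2 \<partial>M))) / 2))" if T: "finite T" for T a s
  proof -
    have "(\<integral>\<^sup>+\<omega>. ennreal (exp (\<Sum>t\<in>T. a t * (v (t + s) \<omega> - v s \<omega>))) \<partial>density M (\<lambda>\<omega>. ennreal (exp (v s \<omega>))))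
      = (\<integral>\<^sup>+\<omega>. ennreal (exp (v s \<omega> + (\<Sum>t\<in>T. a t * (v (t + s) \<omega> - v s \<omega>)))) \<partial>M)"
      by (subst nn_integral_density) (auto simp: exp_add ennreal_mult)
    also have "\<dots> = (\<integral>\<^sup>+\<omega>. ennreal (exp (W s \<omega> - var s / 2
        + (\<Sum>t\<in>T. a t * ((W (t + s) \<omega> - var (t + s) / 2) - (W s \<omega> - var s / 2))))) \<partial>M)"
    proof (rule nn_integral_cong_AE)
      show "AE \<omega> in M. ennreal (exp (v s \<omega> + (\<Sum>t\<in>T. a t * (v (t + s) \<omega> - v s \<omega>)))) = ennreal (exp (W s \<omega> - var s / 2
          + (\<Sum>t\<in>T. a t * ((W (t + s) \<omega> - var (t + s) / 2) - (W s \<omega> - var s / 2)))))"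
        using AE_not_in[OF N0] by eventually_elim (simp add: v_def)
    qed
    finally show ?thesis by (simp only: tilted_exp_integral[OF T])
  qed
  have "spectral_process M v"
  proof (unfold_locales)
    show "v t \<in> borel_measurable M" for t by measurable
    show "continuous_on UNIV (\<lambda>t. v t \<omega>)" if "\<omega> \<in> space M" for \<omega>
    proof (cases "\<omega> \<in> N0")
      case False
      then have "continuous_on UNIV (\<lambda>t. W t \<omega>)" using good that by auto
      with False show ?thesis by (auto simp: v_def intro!: continuous_intros continuous_var)
    qed (auto simp: v_def intro!: continuous_intros)
    show "filterlim (\<lambda>t. v t \<omega>) at_bot at_infinity" if "\<omega> \<in> space M" for \<omega>
    proof (cases "\<omega> \<in> N0")
      case False
      then show ?thesis using good that by (simp add: v_def)
    next
      case True
      have "filterlim (\<lambda>t::'a. - norm t) at_bot at_infinity"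
        unfolding filterlim_uminus_at_bot by (simp add: filterlim_norm_at_top)
      with True show ?thesis by (simp add: v_def)
    qed
    show "(\<integral>\<^sup>+\<omega>. ennreal (exp (v 0 \<omega>)) \<partial>M) = 1"
      using exp_v[OF finite.emptyI, of 0] by (simp add: emeasure_density cong: nn_integral_cong)
    show "distr (density M (\<lambda>\<omega>. ennreal (exp (v s \<omega>)))) path_space (\<lambda>\<omega> t. v (t + s) \<omega> - v s \<omega>)
        = distr (density M (\<lambda>\<omega>. ennreal (exp (v 0 \<omega>)))) path_space (\<lambda>\<omega> t. v t \<omega> - v 0 \<omega>)" for s
    proof (rule distr_path_space_eqI_exp)
      fix T :: "'a set" and a assume T: "finite T"
      show "(\<integral>\<^sup>+\<omega>. ennreal (exp (\<Sum>t\<in>T. a t * (v (t + s) \<omega> - v s \<omega>))) \<partial>density M (\<lambda>\<omega>. ennreal (exp (v s \<omega>))))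
        = (\<integral>\<^sup>+\<omega>. ennreal (exp (\<Sum>t\<in>T. a t * (v t \<omega> - v 0 \<omega>))) \<partial>density M (\<lambda>\<omega>. ennreal (exp (v 0 \<omega>))))"
        using exp_v[OF T, of s a] exp_v[OF T, of 0 a] by simp
      show "(\<integral>\<^sup>+\<omega>. ennreal (exp (\<Sum>t\<in>T. a t * (v (t + s) \<omega> - v s \<omega>))) \<partial>density M (\<lambda>\<omega>. ennreal (exp (v s \<omega>)))) < \<infinity>"
        by (simp add: exp_v[OF T])
    qed auto
  qed
  then show ?thesis using AE_v by (rule that)
qed

end

section \<open>Moving representation of the spectral process\<close>

lemma nn_integral_lborel_translate:
  fixes f :: "'a::euclidean_space \<Rightarrow> ennreal"
  assumes [measurable]: "f \<in> borel_measurable borel"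
  shows "(\<integral>\<^sup>+x. f (x + c) \<partial>lborel) = (\<integral>\<^sup>+x. f x \<partial>lborel)"
proof -
  have "(\<integral>\<^sup>+x. f x \<partial>lborel) = (\<integral>\<^sup>+x. f x \<partial>distr lborel borel ((+) c))"
    by (simp only: lborel_distr_plus)
  also have "\<dots> = (\<integral>\<^sup>+x. f (x + c) \<partial>lborel)" by (subst nn_integral_distr) (auto simp: add.commute)
  finally show ?thesis ..
qed

lemma nn_integral_lborel_uminus:
  fixes f :: "'a::euclidean_space \<Rightarrow> ennreal"
  assumes [measurable]: "f \<in> borel_measurable borel"
  shows "(\<integral>\<^sup>+x. f (- x) \<partial>lborel) = (\<integral>\<^sup>+x. f x \<partial>lborel)"
proof -
  have "(\<integral>\<^sup>+x. f x \<partial>lborel) = (\<integral>\<^sup>+x. f x \<partial>density (distr lborel borel (\<lambda>x::'a. 0 + (- 1) *\<^sub>R x)) (\<lambda>_. ennreal (\<bar>- 1\<bar> ^ DIM('a))))"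
    by (subst lborel_affine[of "- 1" 0]) simp_all
  also have "\<dots> = (\<integral>\<^sup>+x. f (- x) \<partial>lborel)"
    by (subst nn_integral_density) (simp_all add: nn_integral_distr)
  finally show ?thesis ..
qed

text \<open>
  The paths of the spectral process, with the trace of the product \<open>\<sigma>\<close>-algebra: unlike on the whole
  path space, evaluation is jointly measurable here.
\<close>

definition decaying_paths :: "('a::euclidean_space \<Rightarrow> real) set" where
  "decaying_paths = {f. continuous_on UNIV f \<and> filterlim f at_bot at_infinity}"

definition decaying_path_space :: "('a::euclidean_space \<Rightarrow> real) measure" where
  "decaying_path_space = restrict_space path_space decaying_paths"

lemma space_decaying_path_space [simp]: "space decaying_path_space = decaying_paths"
  by (simp add: decaying_path_space_def space_restrict_space space_PiM)

lemma eval_measurable_decaying [measurable]: "(\<lambda>f. f t) \<in> borel_measurable decaying_path_space"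
  unfolding decaying_path_space_def by (intro measurable_restrict_space1) measurable

lemma measurable_path_space_decaying: "g \<in> path_space \<rightarrow>\<^sub>M N \<Longrightarrow> g \<in> decaying_path_space \<rightarrow>\<^sub>M N"
  unfolding decaying_path_space_def by (rule measurable_restrict_space1)

text \<open>The time is approximated by simple functions \<open>r i\<close>, so that each
  approximation involves finitely many evaluations; continuity of the path recovers
  \<open>f t\<close> in the limit.\<close>

lemma joint_eval_measurable_decaying:
  "(\<lambda>(t, f). f t) \<in> borel_measurable (borel \<Otimes>\<^sub>M (decaying_path_space :: ('a::euclidean_space \<Rightarrow> real) measure))"
proof -
  obtain r :: "nat \<Rightarrow> 'a \<Rightarrow> 'a" where r: "\<And>i. simple_function borel (r i)" and lim: "\<And>t. (\<lambda>i. r i t) \<longlonglongrightarrow> t"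
    using borel_measurable_implies_sequence_metric[of "\<lambda>t::'a. t" borel] by (auto simp: space_borel) metis
  show ?thesis
  proof (rule borel_measurable_LIMSEQ_real)
    fix z :: "'a \<times> ('a \<Rightarrow> real)" assume "z \<in> space (borel \<Otimes>\<^sub>M decaying_path_space)"
    then have "continuous_on UNIV (snd z)" by (auto simp: space_pair_measure decaying_paths_def)
    then have "isCont (snd z) (fst z)" by (simp add: continuous_on_eq_continuous_at)
    then show "(\<lambda>i. snd z (r i (fst z))) \<longlonglongrightarrow> (case z of (t, f) \<Rightarrow> f t)"
      using isCont_tendsto_compose[OF _ lim] by (simp add: split_beta')
  next
    fix i
    have [measurable]: "r i \<in> borel \<rightarrow>\<^sub>M count_space (range (r i))"
      using r[of i] unfolding simple_function_def
      by (subst measurable_count_space_eq2) auto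
    show "(\<lambda>z. snd z (r i (fst z))) \<in> borel_measurable (borel \<Otimes>\<^sub>M decaying_path_space)"
    proof (rule measurable_compose_countable'[where I="range (r i)" and f="\<lambda>s z. snd z s" and g="\<lambda>z. r i (fst z)"])
      show "countable (range (r i))" using r[of i] by (intro countable_finite) (simp add: simple_function_def)
    qed measurable
  qed
qed

text \<open>Comparing with every \<open>q\<close> avoids mentioning the supremum, which would carry
  no information for an unbounded function. The tolerance \<open>1\<close> leaves room for an open
  set around each maximiser.\<close>

definition plateau :: "('a::euclidean_space \<Rightarrow> real) \<Rightarrow> 'a set" where
  "plateau f = {u. \<forall>q. f q \<le> f u + 1}"

definition plateau_size :: "('a::euclidean_space \<Rightarrow> real) \<Rightarrow> ennreal" where
  "plateau_size f = (\<integral>\<^sup>+u. indicator (plateau f) u \<partial>lborel)"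

text \<open>For a continuous path the set where it exceeds \<open>f u + 1\<close> is open, so it is
  empty as soon as it misses a countable dense set. This leaves countably many conditions on
  finitely many evaluations each.\<close>

lemma plateau_measurable [measurable]:
  "(\<lambda>(u, f). indicator (plateau f) u :: ennreal)
    \<in> borel_measurable (borel \<Otimes>\<^sub>M (decaying_path_space :: ('a::euclidean_space \<Rightarrow> real) measure))"
proof -
  obtain D :: "'a set" where D: "countable D" "\<And>X. open X \<Longrightarrow> X \<noteq> {} \<Longrightarrow> \<exists>d\<in>D. d \<in> X"
    using countable_dense_exists by blast
  have eq: "u \<in> plateau f \<longleftrightarrow> (\<forall>q\<in>D. f q \<le> f u + 1)" if f: "f \<in> decaying_paths" for u f
  proof
    assume le: "\<forall>q\<in>D. f q \<le> f u + 1"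
    have "open {q. f u + 1 < f q}"
      using f by (intro open_Collect_less) (auto simp: decaying_paths_def)
    then have "{q. f u + 1 < f q} = {}" using D(2)[of "{q. f u + 1 < f q}"] le by force
    then show "u \<in> plateau f" by (simp add: plateau_def not_less)
  qed (simp add: plateau_def)
  have "{z \<in> space (borel \<Otimes>\<^sub>M decaying_path_space). \<forall>q\<in>D. snd z q \<le> snd z (fst z) + 1}
      \<in> sets (borel \<Otimes>\<^sub>M (decaying_path_space :: ('a \<Rightarrow> real) measure))"
  proof -
    have joint: "(\<lambda>z. snd z (fst z)) \<in> borel_measurable (borel \<Otimes>\<^sub>M (decaying_path_space :: ('a \<Rightarrow> real) measure))"
      using joint_eval_measurable_decaying unfolding case_prod_beta' .
    show ?thesis
      by (intro sets.sets_Collect_countable_All' D(1) borel_measurable_le borel_measurable_add joint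
          measurable_compose[OF measurable_snd eval_measurable_decaying] borel_measurable_const)
  qed
  then have "(\<lambda>z. indicator {z \<in> space (borel \<Otimes>\<^sub>M decaying_path_space). \<forall>q\<in>D. snd z q \<le> snd z (fst z) + 1} z :: ennreal)
      \<in> borel_measurable (borel \<Otimes>\<^sub>M (decaying_path_space :: ('a \<Rightarrow> real) measure))"
    by (rule borel_measurable_indicator)
  then show ?thesis
    by (rule measurable_cong[THEN iffD1, rotated]) (auto simp: indicator_def eq space_pair_measure)
qed

lemma plateau_size_measurable [measurable]: "plateau_size \<in> borel_measurable decaying_path_space"
  unfolding plateau_size_def[abs_def]
  by (rule lborel.borel_measurable_nn_integral) 
    (use measurable_compose[OF measurable_pair_swap' plateau_measurable] in \<open>simp add: split_beta'\<close>)

lemma plateau_at_measurable [measurable]: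
  "(\<lambda>f. indicator (plateau f) u :: ennreal) \<in> borel_measurable decaying_path_space"
  using measurable_compose[OF measurable_Pair1' plateau_measurable, of u] by simp

lemma plateau_borel: assumes "f \<in> decaying_paths" shows "plateau f \<in> sets borel"
proof -
  have "(\<lambda>u. indicator (plateau f) u :: ennreal) \<in> borel_measurable borel"
    using measurable_compose[OF measurable_Pair2' plateau_measurable, of f] assms by simp
  then show ?thesis by (simp add: borel_measurable_indicator_iff)
qed

lemma plateau_shift: "u \<in> plateau (\<lambda>t. f (t + s) - c) \<longleftrightarrow> u + s \<in> plateau f"
proof -
  have "(\<forall>q. f (q + s) \<le> f (u + s) + 1) \<longleftrightarrow> (\<forall>q. f q \<le> f (u + s) + 1)"
    by (metis diff_add_cancel)
  then show ?thesis by (simp add: plateau_def algebra_simps)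
qed

lemma plateau_size_shift:
  assumes "f \<in> decaying_paths"
  shows "plateau_size (\<lambda>t. f (t + s) - c) = plateau_size f"
proof -
  have "plateau_size (\<lambda>t. f (t + s) - c) = (\<integral>\<^sup>+u. indicator (plateau f) (u + s) \<partial>lborel)"
    unfolding plateau_size_def by (intro nn_integral_cong) (simp add: indicator_def plateau_shift)
  also have "\<dots> = plateau_size f"
    unfolding plateau_size_def using plateau_borel[OF assms] by (intro nn_integral_lborel_translate) simp
  finally show ?thesis .
qed

lemma decaying_paths_shift:
  assumes "f \<in> decaying_paths"
  shows "(\<lambda>t. f (t + s) - c) \<in> decaying_paths"
proof -
  have "continuous_on UNIV (\<lambda>t. f (t + s) - c)"
    using assms unfolding decaying_paths_def
    by (auto intro!: continuous_intros intro: continuous_on_compose2[of UNIV f])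
  moreover have "filterlim (\<lambda>t. f (t + s)) at_bot at_infinity"
  proof (rule filterlim_compose[of f at_bot at_infinity])
    show "filterlim f at_bot at_infinity" using assms by (simp add: decaying_paths_def)
    show "filterlim (\<lambda>t. t + s) at_infinity at_infinity"
      using tendsto_add_filterlim_at_infinity[OF tendsto_const[of s] filterlim_ident] by (simp add: add.commute)
  qed
  then have "filterlim (\<lambda>t. f (t + s) - c) at_bot at_infinity"
    unfolding filterlim_at_bot
  proof (intro allI)
    fix Z assume *: "\<forall>Z. \<forall>\<^sub>F t in at_infinity. f (t + s) \<le> Z"
    show "\<forall>\<^sub>F t in at_infinity. f (t + s) - c \<le> Z" using *[rule_format, of "Z + c"] by eventually_elim simp
  qed
  ultimately show ?thesis by (simp add: decaying_paths_def)
qed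

text \<open>Decay puts the plateau inside a ball, because far out the path lies below
  \<open>f 0 - 1\<close>. It also bounds the path above, and the plateau then contains the nonempty
  open set where \<open>f\<close> exceeds its supremum minus \<open>1\<close>. The bounds allow
  division by the size for every path.\<close>

lemma plateau_size_bounds:
  assumes f: "f \<in> decaying_paths"
  shows "0 < plateau_size f" "plateau_size f < \<infinity>"
proof -
  have cont: "continuous_on UNIV f" and lim: "filterlim f at_bot at_infinity"
    using f by (auto simp: decaying_paths_def)
  have "\<forall>\<^sub>F t in at_infinity. f t < f 0 - 1"
    using lim by (simp add: filterlim_at_bot_dense)
  then obtain R where R: "\<And>t. R \<le> norm t \<Longrightarrow> f t < f 0 - 1" by (auto simp: eventually_at_infinity)
  have size: "plateau_size f = emeasure lborel (plateau f)"
    unfolding plateau_size_def using plateau_borel[OF f] by simp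
  have "plateau f \<subseteq> cball 0 R"
  proof
    fix u assume "u \<in> plateau f"
    then have "f 0 \<le> f u + 1" by (simp add: plateau_def)
    then show "u \<in> cball 0 R" using R[of u] by (force simp: not_le)
  qed
  then have "plateau_size f \<le> emeasure lborel (cball (0::'a) R)"
    unfolding size by (intro emeasure_mono) auto
  also have "\<dots> < \<infinity>" by (rule emeasure_bounded_finite) simp
  finally show "plateau_size f < \<infinity>" .
  have "bdd_above (range f)"
  proof -
    have "compact (f ` cball 0 R)"
      by (intro compact_continuous_image continuous_on_subset[OF cont]) auto
    then obtain B where "\<And>t. t \<in> cball 0 R \<Longrightarrow> f t \<le> B"
      using compact_imp_bounded bounded_imp_bdd_above by (metis bdd_above.unfold image_eqI)
    then have "f t \<le> max B (f 0)" for t using R[of t] by (cases "norm t \<le> R") force+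
    then show ?thesis by (intro bdd_aboveI[of _ "max B (f 0)"]) auto
  qed
  obtain u where u: "(SUP t. f t) - 1 < f u"
    using less_cSUP_iff[of UNIV f "(SUP t. f t) - 1"] \<open>bdd_above (range f)\<close> by auto
  let ?O = "{t. (SUP t. f t) - 1 < f t}"
  have "open ?O" using cont by (intro open_Collect_less) auto
  then obtain e where "0 < e" "ball u e \<subseteq> ?O" using u open_contains_ball by blast
  moreover have "?O \<subseteq> plateau f"
  proof
    fix t assume "t \<in> ?O"
    moreover have "f q \<le> (SUP t. f t)" for q by (rule cSUP_upper[OF _ \<open>bdd_above (range f)\<close>]) simp
    ultimately show "t \<in> plateau f" unfolding plateau_def
      by (smt (verit, best) mem_Collect_eq)
  qed
  ultimately have "emeasure lborel (ball u e) \<le> plateau_size f"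
    unfolding size using plateau_borel[OF f] by (intro emeasure_mono) auto
  moreover have "0 < emeasure lborel (ball u e)"
    using content_ball_pos[OF \<open>0 < e\<close>, of u] emeasure_bounded_finite[OF bounded_ball[of u e]]
    by (subst emeasure_eq_ennreal_measure) auto
  ultimately show "0 < plateau_size f" by simp
qed

section \<open>From the tilted path law to the mover\<close>

context spectral_process
begin

lemma v_decaying: "\<omega> \<in> space M \<Longrightarrow> (\<lambda>t. v t \<omega>) \<in> decaying_paths"
  using v_continuous v_limit by (simp add: decaying_paths_def)

lemma v_path_measurable [measurable]: "(\<lambda>\<omega> t. v (t + s) \<omega> - v s \<omega>) \<in> M \<rightarrow>\<^sub>M decaying_path_space"
  unfolding decaying_path_space_def
  by (intro measurable_restrict_space2 measurable_PiM_single') (auto intro: v_decaying decaying_paths_shift)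

lemma v_path_measurable': "(\<lambda>\<omega> t. v t \<omega>) \<in> M \<rightarrow>\<^sub>M decaying_path_space"
  unfolding decaying_path_space_def
  by (intro measurable_restrict_space2 measurable_PiM_single') (auto intro: v_decaying)

text \<open>Taken on decaying paths, where plateaus are measurable. By \<open>v_tilted\<close> it is
  also the law of the path seen from any other \<open>s\<close> under the density
  \<open>exp (v s)\<close>.\<close>

definition pivot_law :: "('a \<Rightarrow> real) measure" where
  "pivot_law = distr (density M (\<lambda>\<omega>. ennreal (exp (v 0 \<omega>)))) decaying_path_space (\<lambda>\<omega> t. v t \<omega> - v 0 \<omega>)"

lemma sets_pivot_law [simp, measurable_cong]: "sets pivot_law = sets decaying_path_space"
  by (simp add: pivot_law_def)

lemma space_pivot_law [simp]: "space pivot_law = decaying_paths"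
  by (simp add: pivot_law_def)

lemma prob_space_pivot_law: "prob_space pivot_law"
proof -
  have "prob_space (density M (\<lambda>\<omega>. ennreal (exp (v 0 \<omega>))))"
    using v_normalized by (intro prob_spaceI) (simp add: emeasure_density cong: nn_integral_cong)
  then show ?thesis
    unfolding pivot_law_def using v_path_measurable[of 0] by (intro prob_space.prob_space_distr) simp_all
qed

text \<open>\<open>v_tilted\<close> speaks about the product \<sigma>-algebra. It passes to the
  trace because every recentered path is decaying: a trace set and a product set inducing it have
  the same preimage.\<close>

lemma nn_integral_tilted:
  assumes g[measurable]: "g \<in> borel_measurable decaying_path_space"
  shows "(\<integral>\<^sup>+\<omega>. ennreal (exp (v s \<omega>)) * g (\<lambda>t. v (t + s) \<omega> - v s \<omega>) \<partial>M) = (\<integral>\<^sup>+f. g f \<partial>pivot_law)"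
proof -
  let ?D = "\<lambda>S s. distr (density M (\<lambda>\<omega>. ennreal (exp (v s \<omega>)))) S (\<lambda>\<omega> t. v (t + s) \<omega> - v s \<omega>)"
  have "?D decaying_path_space s = pivot_law"
  proof (rule measure_eqI)
    fix A assume "A \<in> sets (?D decaying_path_space s)"
    then have A[measurable]: "A \<in> sets decaying_path_space" by simp
    then obtain B where B[measurable]: "B \<in> sets path_space" and AB: "A = B \<inter> decaying_paths"
      unfolding decaying_path_space_def by (auto simp: sets_restrict_space)
    have *: "emeasure (?D decaying_path_space s) A
      = emeasure (?D path_space s) B" for s
    proof -
      have [measurable]: "(\<lambda>\<omega> t. v (t + s) \<omega> - v s \<omega>) \<in> M \<rightarrow>\<^sub>M path_space"
        by (rule measurable_PiM_single') auto
      have "(\<lambda>\<omega> t. v (t + s) \<omega> - v s \<omega>) -` A \<inter> space M = (\<lambda>\<omega> t. v (t + s) \<omega> - v s \<omega>) -` B \<inter> space M"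
        using decaying_paths_shift[OF v_decaying] by (auto simp: AB)
      then show ?thesis by (simp add: emeasure_distr)
    qed
    show "emeasure (?D decaying_path_space s) A
      = emeasure pivot_law A"
      using *[of s] *[of 0] v_tilted[of s] by (simp add: pivot_law_def)
  qed simp
  then have "(\<integral>\<^sup>+f. g f \<partial>pivot_law)
      = (\<integral>\<^sup>+f. g f \<partial>?D decaying_path_space s)"
    by simp
  also have "\<dots> = (\<integral>\<^sup>+\<omega>. ennreal (exp (v s \<omega>)) * g (\<lambda>t. v (t + s) \<omega> - v s \<omega>) \<partial>M)"
    by (rule nn_integral_distr_density) measurable
  finally show ?thesis ..
qed

text \<open>The plateau moves along with the path, and homogeneity extracts from \<open>G\<close>
  exactly the weight \<open>exp (v s)\<close> under which the recentered path has law
  \<open>pivot_law\<close>. Nothing but the recentered path is left for each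
  \<open>s\<close>.\<close>

lemma moving_representation:
  assumes G: "G \<in> borel_measurable path_space"
    and homogeneous: "\<And>f c. G (\<lambda>t. f t + c) = ennreal (exp c) * G f"
  shows "(\<integral>\<^sup>+\<omega>. G (\<lambda>t. v t \<omega>) \<partial>M)
    = (\<integral>\<^sup>+s. \<integral>\<^sup>+f. indicator (plateau f) 0 / plateau_size f * G (\<lambda>t. f (t - s)) \<partial>pivot_law \<partial>lborel)"
proof -
  define I where "I s \<omega> = (indicator (plateau (\<lambda>t. v t \<omega>)) s :: ennreal)" for s \<omega>
  define S where "S \<omega> = plateau_size (\<lambda>t. v t \<omega>)" for \<omega>
  have Gv[measurable]: "(\<lambda>\<omega>. G (\<lambda>t. v t \<omega>)) \<in> borel_measurable M"
    by (rule measurable_compose[OF _ G], rule measurable_PiM_single') auto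
  have S[measurable]: "S \<in> borel_measurable M"
    unfolding S_def[abs_def] by (rule measurable_compose[OF v_path_measurable' plateau_size_measurable])
  have I[measurable]: "(\<lambda>(s, \<omega>). I s \<omega>) \<in> borel_measurable (lborel \<Otimes>\<^sub>M M)"
  proof -
    have "(\<lambda>z. (fst z, \<lambda>t. v t (snd z))) \<in> lborel \<Otimes>\<^sub>M M \<rightarrow>\<^sub>M borel \<Otimes>\<^sub>M decaying_path_space"
      by (intro measurable_Pair measurable_compose[OF measurable_snd v_path_measurable']) simp
    from measurable_compose[OF this plateau_measurable] show ?thesis by (simp add: I_def case_prod_beta')
  qed
  interpret lborel_M: pair_sigma_finite lborel M by unfold_locales
  \<comment> \<open>Inserts the uniform density \<open>I s \<omega> / S \<omega>\<close> on the
    plateau, whose integral over \<open>s\<close> is \<open>1\<close>.\<close>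
  have "(\<integral>\<^sup>+\<omega>. G (\<lambda>t. v t \<omega>) \<partial>M) = (\<integral>\<^sup>+\<omega>. \<integral>\<^sup>+s. I s \<omega> / S \<omega> * G (\<lambda>t. v t \<omega>) \<partial>lborel \<partial>M)"
  proof (rule nn_integral_cong)
    fix \<omega> assume \<omega>: "\<omega> \<in> space M"
    have Im: "(\<lambda>s. I s \<omega>) \<in> borel_measurable lborel"
      unfolding I_def using plateau_borel[OF v_decaying[OF \<omega>]] by (intro borel_measurable_indicator) simp
    have "(\<integral>\<^sup>+s. I s \<omega> / S \<omega> * G (\<lambda>t. v t \<omega>) \<partial>lborel) = (\<integral>\<^sup>+s. I s \<omega> * (G (\<lambda>t. v t \<omega>) / S \<omega>) \<partial>lborel)"
      by (simp add: divide_ennreal_def ac_simps)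
    also have "\<dots> = S \<omega> * (G (\<lambda>t. v t \<omega>) / S \<omega>)"
      by (subst nn_integral_multc[OF Im]) (simp add: S_def I_def plateau_size_def)
    also have "\<dots> = G (\<lambda>t. v t \<omega>)"
      using plateau_size_bounds[OF v_decaying[OF \<omega>]]
      by (simp add: S_def ennreal_times_divide mult.commute[of "plateau_size _"] ennreal_mult_divide_eq)
    finally show "G (\<lambda>t. v t \<omega>) = (\<integral>\<^sup>+s. I s \<omega> / S \<omega> * G (\<lambda>t. v t \<omega>) \<partial>lborel)" ..
  qed
  also have "\<dots> = (\<integral>\<^sup>+s. \<integral>\<^sup>+\<omega>. I s \<omega> / S \<omega> * G (\<lambda>t. v t \<omega>) \<partial>M \<partial>lborel)"
    by (rule lborel_M.Fubini') measurable
  also have "\<dots> = (\<integral>\<^sup>+s. \<integral>\<^sup>+f. indicator (plateau f) 0 / plateau_size f * G (\<lambda>t. f (t - s)) \<partial>pivot_law \<partial>lborel)"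
  proof (rule nn_integral_cong)
    fix s :: 'a
    have [measurable]: "(\<lambda>f. G (\<lambda>t. f (t - s))) \<in> borel_measurable decaying_path_space"
      by (intro measurable_path_space_decaying measurable_compose[OF _ G] measurable_PiM_single') auto
    \<comment> \<open>The path is its recentered version plus \<open>v s \<omega>\<close>, which
      releases the factor \<open>exp (v s \<omega>)\<close>; and \<open>s\<close> lies in the
      plateau of the path iff \<open>0\<close> lies in that of the recentered one.\<close>
    have "(\<integral>\<^sup>+\<omega>. I s \<omega> / S \<omega> * G (\<lambda>t. v t \<omega>) \<partial>M) = (\<integral>\<^sup>+\<omega>. ennreal (exp (v s \<omega>)) *
        (\<lambda>f. indicator (plateau f) 0 / plateau_size f * G (\<lambda>t. f (t - s))) (\<lambda>t. v (t + s) \<omega> - v s \<omega>) \<partial>M)"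
    proof (rule nn_integral_cong)
      fix \<omega> assume \<omega>: "\<omega> \<in> space M"
      have "G (\<lambda>t. v t \<omega>) = ennreal (exp (v s \<omega>)) * G (\<lambda>t. v t \<omega> - v s \<omega>)"
        using homogeneous[of "\<lambda>t. v t \<omega> - v s \<omega>" "v s \<omega>"] by simp
      moreover have "plateau_size (\<lambda>t. v (t + s) \<omega> - v s \<omega>) = S \<omega>"
        unfolding S_def by (rule plateau_size_shift[OF v_decaying[OF \<omega>]])
      moreover have "indicator (plateau (\<lambda>t. v (t + s) \<omega> - v s \<omega>)) 0 = I s \<omega>"
        using plateau_shift[of 0 "\<lambda>t. v t \<omega>" s "v s \<omega>"] by (simp add: I_def indicator_def)
      ultimately show "I s \<omega> / S \<omega> * G (\<lambda>t. v t \<omega>) = ennreal (exp (v s \<omega>)) *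
        (\<lambda>f. indicator (plateau f) 0 / plateau_size f * G (\<lambda>t. f (t - s))) (\<lambda>t. v (t + s) \<omega> - v s \<omega>)"
        by (simp add: ac_simps)
    qed
    also have "\<dots> = (\<integral>\<^sup>+f. indicator (plateau f) 0 / plateau_size f * G (\<lambda>t. f (t - s)) \<partial>pivot_law)"
      by (rule nn_integral_tilted) measurable
    finally show "(\<integral>\<^sup>+\<omega>. I s \<omega> / S \<omega> * G (\<lambda>t. v t \<omega>) \<partial>M)
        = (\<integral>\<^sup>+f. indicator (plateau f) 0 / plateau_size f * G (\<lambda>t. f (t - s)) \<partial>pivot_law)" .
  qed
  finally show ?thesis .
qed

lemma exp_eval_integral: "(\<integral>\<^sup>+s. \<integral>\<^sup>+f. indicator (plateau f) 0 / plateau_size f * ennreal (exp (f (- s))) \<partial>pivot_law \<partial>lborel) = 1"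
proof -
  have "(\<integral>\<^sup>+\<omega>. (\<lambda>f. ennreal (exp (f 0))) (\<lambda>t. v t \<omega>) \<partial>M)
    = (\<integral>\<^sup>+s. \<integral>\<^sup>+f. indicator (plateau f) 0 / plateau_size f * (\<lambda>f. ennreal (exp (f 0))) (\<lambda>t. f (t - s)) \<partial>pivot_law \<partial>lborel)"
    by (rule moving_representation) (auto simp: exp_add ennreal_mult mult.commute)
  then show ?thesis using v_normalized by simp
qed

definition pivot_prob :: real where
  "pivot_prob = enn2real (\<integral>\<^sup>+f. indicator (plateau f) 0 \<partial>pivot_law)"

text \<open>If the origin almost never lay in the plateau, the representation of the functional
  \<open>exp (f 0)\<close> would give \<open>0\<close> instead of \<open>1\<close>. So conditioning
  on this event is legitimate.\<close>

lemma pivot_prob: "0 < pivot_prob" "ennreal pivot_prob = (\<integral>\<^sup>+f. indicator (plateau f) 0 \<partial>pivot_law)"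
proof -
  interpret K: prob_space pivot_law by (rule prob_space_pivot_law)
  have "(\<integral>\<^sup>+f. indicator (plateau f) 0 \<partial>pivot_law) \<le> (\<integral>\<^sup>+f. 1 \<partial>pivot_law)"
    by (intro nn_integral_mono) (auto simp: indicator_def)
  also have "\<dots> = 1" using K.emeasure_space_1 by simp
  finally have fin: "(\<integral>\<^sup>+f. indicator (plateau f) 0 \<partial>pivot_law) < \<top>"
    by (rule order.strict_trans1[OF _ ennreal_one_less_top])
  have "(\<integral>\<^sup>+f. indicator (plateau f) (0::'a) \<partial>pivot_law) \<noteq> 0"
  proof
    assume "(\<integral>\<^sup>+f. indicator (plateau f) (0::'a) \<partial>pivot_law) = 0"
    then have AE0: "AE f in pivot_law. indicator (plateau f) (0::'a) = (0::ennreal)"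
      by (subst (asm) nn_integral_0_iff_AE) auto
    have "(\<integral>\<^sup>+f. indicator (plateau f) 0 / plateau_size f * ennreal (exp (f (- s))) \<partial>pivot_law) = (\<integral>\<^sup>+f. 0 \<partial>pivot_law)" for s
      by (rule nn_integral_cong_AE) (use AE0 in eventually_elim, simp add: divide_ennreal_def)
    then show False using exp_eval_integral by simp
  qed
  then show "0 < pivot_prob" using fin by (simp add: pivot_prob_def enn2real_positive_iff zero_less_iff_neq_zero)
  show "ennreal pivot_prob = (\<integral>\<^sup>+f. indicator (plateau f) 0 \<partial>pivot_law)"
    using fin by (simp add: pivot_prob_def)
qed

definition mover_law :: "('a \<Rightarrow> real) measure" where
  "mover_law = density pivot_law (\<lambda>f. indicator (plateau f) 0 / ennreal pivot_prob)"

text \<open>The exponential of the added constant is \<open>pivot_prob / plateau_size f\<close>.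
  Multiplied by the conditioning density \<open>indicator (plateau f) 0 / pivot_prob\<close> it
  gives the weight in \<open>moving_representation\<close>, so homogeneity turns that weight into a
  vertical shift of the path.\<close>

definition mover :: "'a \<Rightarrow> ('a \<Rightarrow> real) \<Rightarrow> real" where
  "mover t f = f t + (ln pivot_prob - ln (enn2real (plateau_size f)))"

lemma sets_mover_law [simp, measurable_cong]: "sets mover_law = sets decaying_path_space"
  by (simp add: mover_law_def)

lemma space_mover_law [simp]: "space mover_law = decaying_paths"
  by (simp add: mover_law_def)

lemma prob_space_mover_law: "prob_space mover_law"
proof (rule prob_spaceI)
  have "emeasure mover_law (space mover_law) = (\<integral>\<^sup>+f. indicator (plateau f) 0 * inverse (ennreal pivot_prob) \<partial>pivot_law)"
    unfolding mover_law_def using sets.top[of decaying_path_space]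
    by (subst emeasure_density) (auto simp: divide_ennreal_def intro!: nn_integral_cong)
  also have "\<dots> = ennreal pivot_prob * inverse (ennreal pivot_prob)"
    by (subst nn_integral_multc) (auto simp: pivot_prob(2))
  also have "\<dots> = 1" using pivot_prob(1) by (simp add: inverse_ennreal flip: ennreal_mult)
  finally show "emeasure mover_law (space mover_law) = 1" .
qed

lemma measurable_process_mover: "measurable_process mover_law mover"
proof -
  have "(\<lambda>z. snd z (fst z)) \<in> borel_measurable (borel \<Otimes>\<^sub>M mover_law)"
    using joint_eval_measurable_decaying
    unfolding case_prod_beta' measurable_cong_sets[OF sets_pair_measure_cong[OF refl sets_mover_law] refl] .
  moreover have "plateau_size \<in> borel_measurable mover_law" by simp
  then have "(\<lambda>z. plateau_size (snd z)) \<in> borel_measurable (borel \<Otimes>\<^sub>M mover_law)"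
    by (rule measurable_compose[OF measurable_snd])
  ultimately show ?thesis unfolding measurable_process_def mover_def case_prod_beta' by measurable
qed

lemma mover_moving_representation:
  assumes G: "G \<in> borel_measurable path_space"
    and homogeneous: "\<And>f c. G (\<lambda>t. f t + c) = ennreal (exp c) * G f"
  shows "(\<integral>\<^sup>+\<omega>. G (\<lambda>t. v t \<omega>) \<partial>M) = (\<integral>\<^sup>+s. \<integral>\<^sup>+f. G (\<lambda>t. mover (t - s) f) \<partial>mover_law \<partial>lborel)"
  unfolding moving_representation[OF assms]
proof (rule nn_integral_cong)
  fix s :: 'a
  have [measurable]: "(\<lambda>f. G (\<lambda>t. f (t - s))) \<in> borel_measurable decaying_path_space"
    by (intro measurable_path_space_decaying measurable_compose[OF _ G] measurable_PiM_single') auto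
  have mover: "G (\<lambda>t. mover (t - s) f) = ennreal pivot_prob / plateau_size f * G (\<lambda>t. f (t - s))"
    if f: "f \<in> decaying_paths" for f
  proof -
    obtain r where r: "plateau_size f = ennreal r" "0 < r"
      using plateau_size_bounds[OF f] by (cases "plateau_size f") auto
    have "exp (ln pivot_prob - ln r) = pivot_prob / r"
      using r(2) pivot_prob(1) by (simp add: exp_diff)
    then show ?thesis
      unfolding mover_def homogeneous using r pivot_prob(1) by (simp add: divide_ennreal)
  qed
  have "(\<integral>\<^sup>+f. G (\<lambda>t. mover (t - s) f) \<partial>mover_law)
    = (\<integral>\<^sup>+f. ennreal pivot_prob / plateau_size f * G (\<lambda>t. f (t - s)) \<partial>mover_law)"
    by (intro nn_integral_cong) (simp add: mover)
  also have "\<dots> = (\<integral>\<^sup>+f. indicator (plateau f) 0 / ennreal pivot_prob * (ennreal pivot_prob / plateau_size f * G (\<lambda>t. f (t - s))) \<partial>pivot_law)"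
    unfolding mover_law_def by (subst nn_integral_density) auto
  also have "\<dots> = (\<integral>\<^sup>+f. indicator (plateau f) 0 / plateau_size f * G (\<lambda>t. f (t - s)) \<partial>pivot_law)"
  proof (intro nn_integral_cong)
    fix f
    have "inverse (ennreal pivot_prob) * ennreal pivot_prob = 1"
      using pivot_prob(1) by (simp add: inverse_ennreal flip: ennreal_mult)
    then show "indicator (plateau f) 0 / ennreal pivot_prob * (ennreal pivot_prob / plateau_size f * G (\<lambda>t. f (t - s)))
      = indicator (plateau f) 0 / plateau_size f * G (\<lambda>t. f (t - s))"
      by (simp add: indicator_def divide_ennreal_def flip: mult.assoc)
  qed
  finally show "(\<integral>\<^sup>+f. indicator (plateau f) 0 / plateau_size f * G (\<lambda>t. f (t - s)) \<partial>pivot_law)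
    = (\<integral>\<^sup>+f. G (\<lambda>t. mover (t - s) f) \<partial>mover_law)" ..
qed

text \<open>After reflecting \<open>t\<close>, the integrand is the functional
  \<open>exp (f 0)\<close> at a translate of the mover, so the moving representation gives the mean
  of \<open>exp (v 0)\<close>. In particular the integrability condition on a mixed moving maxima
  process holds.\<close>

lemma mover_exp_integral: "(\<integral>\<^sup>+f. \<integral>\<^sup>+t. ennreal (exp (mover t f)) \<partial>lborel \<partial>mover_law) = 1"
proof -
  interpret P: prob_space mover_law by (rule prob_space_mover_law)
  interpret lborel_P: pair_sigma_finite lborel mover_law by unfold_locales
  have joint[measurable]: "(\<lambda>(t, f). mover t f) \<in> borel_measurable (lborel \<Otimes>\<^sub>M mover_law)"
    using measurable_process_mover by (simp add: measurable_process_def)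
  have [measurable]: "(\<lambda>t. mover t f) \<in> borel_measurable borel" if "f \<in> decaying_paths" for f
    using measurable_compose[OF measurable_Pair2' joint, of f] that by simp
  have "(\<integral>\<^sup>+f. \<integral>\<^sup>+t. ennreal (exp (mover t f)) \<partial>lborel \<partial>mover_law)
    = (\<integral>\<^sup>+t. \<integral>\<^sup>+f. ennreal (exp (mover t f)) \<partial>mover_law \<partial>lborel)"
    by (rule lborel_P.Fubini') measurable
  also have "\<dots> = (\<integral>\<^sup>+t. \<integral>\<^sup>+f. ennreal (exp (mover (- t) f)) \<partial>mover_law \<partial>lborel)"
    by (rule nn_integral_lborel_uminus[symmetric]) measurable
  also have "\<dots> = (\<integral>\<^sup>+\<omega>. (\<lambda>f. ennreal (exp (f 0))) (\<lambda>t. v t \<omega>) \<partial>M)"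
    by (subst mover_moving_representation) (auto simp: exp_add ennreal_mult mult.commute)
  finally show ?thesis using v_normalized by simp
qed

end

section \<open>Laws of the maxima\<close>

definition box_event ::
    "'t set \<Rightarrow> ('t \<Rightarrow> ereal set) \<Rightarrow> 't set \<Rightarrow> ('t \<Rightarrow> ereal) \<Rightarrow> ('t \<Rightarrow> 'a \<Rightarrow> ereal) \<Rightarrow> 'a set \<Rightarrow> 'a set" where
  "box_event K B J y Z S = {\<omega> \<in> S. (\<forall>k\<in>K. Z k \<omega> \<in> B k) \<and> (\<forall>t\<in>J. Z t \<omega> \<le> y t)}"

text \<open>For suprema the natural events are those below thresholds. One coordinate at a time is
  released from a threshold to an arbitrary Borel set: with the other constraints frozen in a
  density, values on closed lower rays determine a finite measure on the extended line.\<close>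

lemma distr_path_space_eqI_atMost:
  fixes X :: "'t \<Rightarrow> 'a \<Rightarrow> ereal" and Y :: "'t \<Rightarrow> 'b \<Rightarrow> ereal"
  assumes M: "prob_space M" and N: "prob_space N"
    and X[measurable]: "\<And>t. X t \<in> borel_measurable M" and Y[measurable]: "\<And>t. Y t \<in> borel_measurable N"
    and eq: "\<And>J y. finite J \<Longrightarrow> emeasure M {\<omega> \<in> space M. \<forall>t\<in>J. X t \<omega> \<le> y t}
               = emeasure N {\<omega> \<in> space N. \<forall>t\<in>J. Y t \<omega> \<le> y t}"
  shows "distr M path_space (\<lambda>\<omega> t. X t \<omega>) = distr N path_space (\<lambda>\<omega> t. Y t \<omega>)"
proof -
  interpret M: prob_space M by fact
  interpret N: prob_space N by fact
  have *: "emeasure M {\<omega> \<in> space M. (\<forall>k\<in>K. X k \<omega> \<in> B k) \<and> (\<forall>t\<in>J. X t \<omega> \<le> y t)}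
      = emeasure N {\<omega> \<in> space N. (\<forall>k\<in>K. Y k \<omega> \<in> B k) \<and> (\<forall>t\<in>J. Y t \<omega> \<le> y t)}"
    if "finite K" "finite J" "\<And>k. k \<in> K \<Longrightarrow> B k \<in> sets borel" for K B J and y :: "'t \<Rightarrow> ereal"
    using that
  proof (induction K arbitrary: J y rule: finite_induct)
    case empty
    then show ?case using eq by simp
  next
    case (insert k K)
    have Bk[measurable]: "B k \<in> sets borel" and BK: "\<And>j. j \<in> K \<Longrightarrow> B j \<in> sets borel"
      using insert.prems by auto
    let ?C = "box_event K B J y"
    have C: "?C Z (space L) \<in> sets L" if Z[measurable]: "\<And>t. Z t \<in> borel_measurable L" for L and Z :: "'t \<Rightarrow> 'c \<Rightarrow> ereal"
    proof -
      have 1: "{\<omega> \<in> space L. \<forall>k\<in>K. Z k \<omega> \<in> B k} \<in> sets L"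
        using insert.hyps BK by (intro sets.sets_Collect_finite_All measurable_sets_Collect[OF Z]) auto
      have 2: "{\<omega> \<in> space L. \<forall>t\<in>J. Z t \<omega> \<le> y t} \<in> sets L"
        using insert.prems by (intro sets.sets_Collect_finite_All) auto
      show ?thesis unfolding box_event_def using sets.sets_Collect_conj[OF 2 1] .
    qed
    note CM[measurable] = C[of X M, OF X] and CN[measurable] = C[of Y N, OF Y]
    have restr: "emeasure (distr (density L (indicator (?C Z (space L)))) borel (Z k)) A
        = emeasure L {\<omega> \<in> ?C Z (space L). Z k \<omega> \<in> A}"
      if Z[measurable]: "\<And>t. Z t \<in> borel_measurable L" and A[measurable]: "A \<in> sets borel"
      for L and Z :: "'t \<Rightarrow> 'c \<Rightarrow> ereal" and A
    proof -
      note C[of Z L, OF Z, measurable]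
      have "emeasure (distr (density L (indicator (?C Z (space L)))) borel (Z k)) A
        = (\<integral>\<^sup>+\<omega>. indicator (?C Z (space L)) \<omega> * indicator (Z k -` A \<inter> space L) \<omega> \<partial>L)"
        by (simp add: emeasure_distr emeasure_density)
      also have "\<dots> = (\<integral>\<^sup>+\<omega>. indicator {\<omega> \<in> ?C Z (space L). Z k \<omega> \<in> A} \<omega> \<partial>L)"
        by (intro nn_integral_cong) (auto simp: indicator_def box_event_def)
      also have "\<dots> = emeasure L {\<omega> \<in> ?C Z (space L). Z k \<omega> \<in> A}"
      proof (rule nn_integral_indicator)
        have "{\<omega> \<in> ?C Z (space L). Z k \<omega> \<in> A} = ?C Z (space L) \<inter> (Z k -` A \<inter> space L)" by (auto simp: box_event_def)
        then show "{\<omega> \<in> ?C Z (space L). Z k \<omega> \<in> A} \<in> sets L" by simp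
      qed
      finally show ?thesis .
    qed
    have borel: "sets (borel :: ereal measure) = sigma_sets UNIV (range atMost)"
    proof -
      have c: "{a<..} = UNIV - {..a}" "{..a} = UNIV - {a<..}" for a :: ereal by auto
      have "sets (borel :: ereal measure) = sigma_sets UNIV (range greaterThan)"
        by (subst borel_Ioi) (simp add: sets_measure_of)
      also have "\<dots> = sigma_sets UNIV (range atMost)"
      proof (rule sigma_sets_eqI)
        fix S :: "ereal set" assume "S \<in> range greaterThan"
        then obtain a where "S = UNIV - {..a}" using c(1) by auto
        then show "S \<in> sigma_sets UNIV (range atMost)" by (simp only:) (intro sigma_sets.Compl sigma_sets.Basic, simp)
      next
        fix S :: "ereal set" assume "S \<in> range atMost"
        then obtain a where "S = UNIV - {a<..}" using c(2) by auto
        then show "S \<in> sigma_sets UNIV (range greaterThan)" by (simp only:) (intro sigma_sets.Compl sigma_sets.Basic, simp)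
      qed
      finally show ?thesis .
    qed
    have "distr (density M (indicator (?C X (space M)))) borel (X k)
        = distr (density N (indicator (?C Y (space N)))) borel (Y k)"
    \<comment> \<open>The generator \<open>{..\<infinity>}\<close> is already the whole extended
      line, so a constant sequence exhausts the space.\<close>
    proof (rule measure_eqI_generator_eq[where E="range atMost" and \<Omega>=UNIV and A="\<lambda>_. {..\<infinity>}"])
      show "Int_stable (range (atMost :: ereal \<Rightarrow> ereal set))"
        by (auto simp: Int_stable_def intro: image_eqI[where x="min _ _"])
      fix S :: "ereal set" assume "S \<in> range atMost"
      then obtain a where S: "S = {..a}" by auto
      have Sm: "S \<in> sets borel" by (simp add: S)
      \<comment> \<open>If \<open>k\<close> already carries a threshold, both constraints are merged
        by the minimum.\<close>
      define y' where "y' t = (if t = k then (if k \<in> J then min a (y k) else a) else y t)" for t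
      have set_eq: "{\<omega> \<in> ?C Z (space L). Z k \<omega> \<in> S}
          = {\<omega> \<in> space L. (\<forall>k\<in>K. Z k \<omega> \<in> B k) \<and> (\<forall>t\<in>insert k J. Z t \<omega> \<le> y' t)}"
        for L and Z :: "'t \<Rightarrow> 'c \<Rightarrow> ereal"
        by (auto simp: box_event_def y'_def S)
      show "emeasure (distr (density M (indicator (?C X (space M)))) borel (X k)) S
          = emeasure (distr (density N (indicator (?C Y (space N)))) borel (Y k)) S"
        unfolding restr[of X M, OF X Sm] restr[of Y N, OF Y Sm] set_eq
        using insert.prems(1) by (intro insert.IH BK) auto
    next
      have "emeasure M {\<omega> \<in> ?C X (space M). X k \<omega> \<in> UNIV} \<noteq> \<infinity>" by simp
      then show "emeasure (distr (density M (indicator (?C X (space M)))) borel (X k)) {..\<infinity>} \<noteq> \<infinity>"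
        by (subst restr) auto
      have "{..\<infinity>} = (UNIV :: ereal set)" by auto
      then show "(\<Union>i::nat. {..\<infinity>}) = (UNIV :: ereal set)" by simp
    qed (simp_all add: borel)
    from arg_cong[OF this, of "\<lambda>\<mu>. emeasure \<mu> (B k)"]
    have eqC: "emeasure M {\<omega> \<in> ?C X (space M). X k \<omega> \<in> B k} = emeasure N {\<omega> \<in> ?C Y (space N). Y k \<omega> \<in> B k}"
      by (simp add: restr[of X M, OF X Bk] restr[of Y N, OF Y Bk])
    have box_insert: "{\<omega> \<in> ?C Z S. Z k \<omega> \<in> B k}
        = {\<omega> \<in> S. (\<forall>k\<in>insert k K. Z k \<omega> \<in> B k) \<and> (\<forall>t\<in>J. Z t \<omega> \<le> y t)}" for Z :: "'t \<Rightarrow> 'c \<Rightarrow> ereal" and S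
      by (auto simp: box_event_def)
    show ?case using eqC unfolding box_insert .
  qed
  have mX: "(\<lambda>\<omega> t. X t \<omega>) \<in> M \<rightarrow>\<^sub>M path_space" and mY: "(\<lambda>\<omega> t. Y t \<omega>) \<in> N \<rightarrow>\<^sub>M path_space"
    by (intro measurable_PiM_single'; simp)+
  show ?thesis
  proof (rule measure_eqI_PiM_infinite)
    show "finite_measure (distr M path_space (\<lambda>\<omega> t. X t \<omega>))"
      using M.prob_space_distr[OF mX] by (rule prob_space.finite_measure)
    fix A :: "'t \<Rightarrow> ereal set" and J assume J: "finite J" "\<And>i. i \<in> J \<Longrightarrow> A i \<in> sets borel"
    have box: "emeasure (distr L path_space (\<lambda>\<omega> t. Z t \<omega>)) (prod_emb UNIV (\<lambda>_. borel) J (Pi\<^sub>E J A))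
       = emeasure L {\<omega> \<in> space L. (\<forall>k\<in>J. Z k \<omega> \<in> A k) \<and> (\<forall>t\<in>{}. Z t \<omega> \<le> (\<lambda>_. 0) t)}"
      if Z: "(\<lambda>\<omega> t. Z t \<omega>) \<in> L \<rightarrow>\<^sub>M path_space" for L and Z :: "'t \<Rightarrow> 'c \<Rightarrow> ereal"
    proof -
      have "prod_emb UNIV (\<lambda>_. borel) J (Pi\<^sub>E J A) \<in> sets (path_space :: ('t \<Rightarrow> ereal) measure)"
        using J by (intro sets_PiM_I) auto
      then show ?thesis
        by (subst emeasure_distr[OF Z])
          (auto intro!: arg_cong[of _ _ "emeasure L"] simp: prod_emb_def PiE_iff)
    qed
    show "emeasure (distr M path_space (\<lambda>\<omega> t. X t \<omega>)) (prod_emb UNIV (\<lambda>_. borel) J (Pi\<^sub>E J A))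
      = emeasure (distr N path_space (\<lambda>\<omega> t. Y t \<omega>)) (prod_emb UNIV (\<lambda>_. borel) J (Pi\<^sub>E J A))"
      unfolding box[OF mX] box[OF mY] using J by (intro *) auto
  qed auto
qed

section \<open>Distribution functions of the maxima as void probabilities\<close>

definition exceedance :: "'t set \<Rightarrow> ('t \<Rightarrow> ereal) \<Rightarrow> ('t \<Rightarrow> real) \<Rightarrow> bool" where
  "exceedance J y f \<longleftrightarrow> (\<exists>t\<in>J. y t < ereal (f t))"

text \<open>For finite nonempty \<open>J\<close> and real thresholds this is the maximum over
  \<open>t\<close> in \<open>J\<close> of \<open>exp (f t - y t)\<close>, familiar from the
  distribution functions of max-stable processes. The integral form treats infinite thresholds
  without case distinctions.\<close>

definition exponent :: "'t set \<Rightarrow> ('t \<Rightarrow> ereal) \<Rightarrow> ('t \<Rightarrow> real) \<Rightarrow> ennreal" where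
  "exponent J y f = (\<integral>\<^sup>+u. ennreal (exp (- u)) * of_bool (exceedance J y (\<lambda>t. u + f t)) \<partial>lborel)"

lemma exceedance_measurable [measurable (raw)]:
  assumes J: "finite J" and f: "\<And>t. t \<in> J \<Longrightarrow> (\<lambda>\<omega>. f \<omega> t) \<in> borel_measurable L"
  shows "(\<lambda>\<omega>. of_bool (exceedance J y (f \<omega>)) :: ennreal) \<in> borel_measurable L"
proof -
  have "{\<omega> \<in> space L. \<exists>t\<in>J. y t < ereal (f \<omega> t)} \<in> sets L"
  proof (intro sets.sets_Collect_finite_Ex J)
    fix t assume "t \<in> J"
    note f[OF this, measurable]
    show "{\<omega> \<in> space L. y t < ereal (f \<omega> t)} \<in> sets L" by measurable
  qed
  then have "(\<lambda>\<omega>. indicator {\<omega> \<in> space L. \<exists>t\<in>J. y t < ereal (f \<omega> t)} \<omega> :: ennreal) \<in> borel_measurable L"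
    by (rule borel_measurable_indicator)
  then show ?thesis
    by (rule measurable_cong[THEN iffD1, rotated]) (simp add: exceedance_def indicator_def)
qed

lemma exponent_measurable:
  assumes "finite J"
  shows "exponent J y \<in> borel_measurable path_space"
  unfolding exponent_def[abs_def]
proof (intro lborel.borel_measurable_nn_integral)
  have "(\<lambda>z. of_bool (exceedance J y (\<lambda>t. snd z + fst z t)) :: ennreal)
      \<in> borel_measurable ((path_space :: ('a \<Rightarrow> real) measure) \<Otimes>\<^sub>M lborel)"
    by (rule exceedance_measurable[OF assms]) measurable
  then have "(\<lambda>z. ennreal (exp (- snd z)) * of_bool (exceedance J y (\<lambda>t. snd z + fst z t)))
      \<in> borel_measurable ((path_space :: ('a \<Rightarrow> real) measure) \<Otimes>\<^sub>M lborel)"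
    by (rule borel_measurable_times_ennreal[rotated]) measurable
  then show "(\<lambda>(f, u). ennreal (exp (- u)) * of_bool (exceedance J y (\<lambda>t. u + f t)))
      \<in> borel_measurable ((path_space :: ('a \<Rightarrow> real) measure) \<Otimes>\<^sub>M lborel)"
    by (simp add: case_prod_beta')
qed

lemma exponent_homogeneous:
  assumes "finite J"
  shows "exponent J y (\<lambda>t. f t + c) = ennreal (exp c) * exponent J y f"
proof -
  have [measurable]: "(\<lambda>u. of_bool (exceedance J y (\<lambda>t. u + f t)) :: ennreal) \<in> borel_measurable borel"
    by (rule exceedance_measurable[OF assms]) measurable
  have "exponent J y (\<lambda>t. f t + c)
    = (\<integral>\<^sup>+u. ennreal (exp (- u)) * (\<lambda>u. of_bool (exceedance J y (\<lambda>t. u + f t))) (u + c) \<partial>lborel)"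
    unfolding exponent_def by (simp add: ac_simps)
  also have "\<dots> = ennreal (exp c) * exponent J y f"
    unfolding exponent_def by (rule nn_integral_exp_translate) measurable
  finally show ?thesis .
qed

text \<open>With test values \<open>0\<close> and \<open>\<infinity>\<close> the exponential of the
  sum indicates that no index is hit. This is how Laplace functionals become probabilities that no
  point exceeds the thresholds.\<close>

lemma exp_neg_suminf_top:
  "exp_neg (\<Sum>i. \<top> * of_bool (A i)) = of_bool (\<not> (\<exists>i. A i))"
proof (cases "\<exists>i. A i")
  case True
  then obtain j where j: "A j" ..
  have "(\<Sum>i\<in>{j}. \<top> * of_bool (A i)) \<le> (\<Sum>i. \<top> * of_bool (A i) :: ennreal)"
    by (intro sum_le_suminf) auto
  then show ?thesis using j by (auto simp: top_unique)
qed simp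

lemma one_minus_exp_neg_top: "1 - exp_neg (\<top> * of_bool A) = of_bool A"
  by simp

lemma emeasure_Sup_le:
  fixes Z :: "nat \<Rightarrow> 't \<Rightarrow> 'w \<Rightarrow> real"
  assumes J: "finite J" and Z[measurable]: "\<And>i t. Z i t \<in> borel_measurable N"
  shows "emeasure N {\<omega> \<in> space N. \<forall>t\<in>J. (SUP i. ereal (Z i t \<omega>)) \<le> y t}
    = (\<integral>\<^sup>+\<omega>. exp_neg (\<Sum>i. \<top> * of_bool (exceedance J y (\<lambda>t. Z i t \<omega>))) \<partial>N)"
proof -
  have "emeasure N {\<omega> \<in> space N. \<forall>t\<in>J. (SUP i. ereal (Z i t \<omega>)) \<le> y t}
    = (\<integral>\<^sup>+\<omega>. indicator {\<omega> \<in> space N. \<forall>t\<in>J. (SUP i. ereal (Z i t \<omega>)) \<le> y t} \<omega> \<partial>N)"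
    using J by (intro nn_integral_indicator[symmetric] sets.sets_Collect_finite_All) measurable
  also have "\<dots> = (\<integral>\<^sup>+\<omega>. exp_neg (\<Sum>i. \<top> * of_bool (exceedance J y (\<lambda>t. Z i t \<omega>))) \<partial>N)"
    unfolding exp_neg_suminf_top
    by (intro nn_integral_cong) (auto simp: exceedance_def indicator_def SUP_le_iff not_less)
  finally show ?thesis .
qed

text \<open>The maximum stays below the thresholds iff no marked point \<open>(u, f)\<close> exceeds
  them after subtracting the drift \<open>b\<close>. The marked Laplace functional gives this void
  probability, and integrating over \<open>u\<close> before the path produces
  \<open>exponent\<close>.\<close>

lemma emeasure_gaussian_maxima_le:
  fixes W :: "'t \<Rightarrow> 'w \<Rightarrow> real" and Ws :: "nat \<Rightarrow> 't \<Rightarrow> 'v \<Rightarrow> real"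
  assumes M: "prob_space M" and N: "prob_space N"
    and W[measurable]: "\<And>t. W t \<in> borel_measurable M"
    and copies: "independent_copies N Ws M W"
    and U: "poisson_point_process N (density lborel (\<lambda>y. ennreal (exp (- y)))) U"
    and ind: "points_independent_of N borel U Ws"
    and J: "finite J"
  shows "emeasure N {\<omega> \<in> space N. \<forall>t\<in>J. (SUP i. ereal (U i \<omega> + Ws i t \<omega> - b t)) \<le> y t}
    = exp_neg (\<integral>\<^sup>+\<omega>. exponent J y (\<lambda>t. W t \<omega> - b t) \<partial>M)"
proof -
  interpret M: prob_space M by fact
  interpret N: prob_space N by fact
  let ?\<nu> = "density lborel (\<lambda>y. ennreal (exp (- y)))"
  interpret U: ppp N ?\<nu> U using N U by (simp add: ppp_def ppp_axioms_def)
  have Um[measurable]: "U i \<in> borel_measurable N" for i using U.P_measurable by simp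
  have vars: "N.indep_vars (\<lambda>_. path_space) (\<lambda>i \<omega> t. Ws i t \<omega>) UNIV"
    and law: "distr N path_space (\<lambda>\<omega> t. Ws i t \<omega>) = process_law M W" for i
    using copies by (auto simp: independent_copies_def process_law_def)
  have Wsm: "(\<lambda>\<omega> t. Ws i t \<omega>) \<in> N \<rightarrow>\<^sub>M path_space" for i
    using vars by (simp add: N.indep_vars_def2)
  have Ws[measurable]: "Ws i t \<in> borel_measurable N" for i t
    using measurable_compose[OF Wsm measurable_component_singleton[of t]] by simp
  have Wm: "(\<lambda>\<omega> t. W t \<omega>) \<in> M \<rightarrow>\<^sub>M path_space" by (rule measurable_PiM_single') auto
  have sets_law[measurable_cong]: "sets (process_law M W) = sets path_space" by (simp add: process_law_def)
  interpret L: prob_space "process_law M W"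
    unfolding process_law_def by (rule M.prob_space_distr[OF Wm])
  interpret LU: pair_sigma_finite lborel "process_law M W" by unfold_locales
  define \<phi> where "\<phi> = (\<lambda>(u, f). \<top> * of_bool (exceedance J y (\<lambda>t. u + f t - b t)) :: ennreal)"
  have E[measurable]: "(\<lambda>z. of_bool (exceedance J y (\<lambda>t. fst z + snd z t - b t)) :: ennreal)
      \<in> borel_measurable (lborel \<Otimes>\<^sub>M process_law M W)"
    by (rule exceedance_measurable[OF J]) measurable
  have "(\<lambda>z. \<top> * of_bool (exceedance J y (\<lambda>t. fst z + snd z t - b t)) :: ennreal)
      \<in> borel_measurable (lborel \<Otimes>\<^sub>M process_law M W)"
    using E by (rule borel_measurable_times_ennreal[OF borel_measurable_const])
  moreover have "sets (?\<nu> \<Otimes>\<^sub>M process_law M W) = sets (lborel \<Otimes>\<^sub>M process_law M W)"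
    by (intro sets_pair_measure_cong) simp_all
  ultimately have \<phi>: "\<phi> \<in> borel_measurable (?\<nu> \<Otimes>\<^sub>M process_law M W)"
    unfolding \<phi>_def case_prod_beta' by (simp cong: measurable_cong_sets)
  have "emeasure N {\<omega> \<in> space N. \<forall>t\<in>J. (SUP i. ereal (U i \<omega> + Ws i t \<omega> - b t)) \<le> y t}
    = (\<integral>\<^sup>+\<omega>. exp_neg (\<Sum>i. \<phi> (U i \<omega>, \<lambda>t. Ws i t \<omega>)) \<partial>N)"
    unfolding \<phi>_def prod.case by (rule emeasure_Sup_le[OF J]) measurable
  also have "\<dots> = exp_neg (\<integral>\<^sup>+u. \<integral>\<^sup>+f. 1 - exp_neg (\<phi> (u, f)) \<partial>process_law M W \<partial>?\<nu>)"
    using ind by (intro U.laplace_functional_independent_marks[OF vars law _ _ \<phi>, where S=borel])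
      (simp_all add: points_independent_of_def)
  also have "(\<integral>\<^sup>+u. \<integral>\<^sup>+f. 1 - exp_neg (\<phi> (u, f)) \<partial>process_law M W \<partial>?\<nu>)
    = (\<integral>\<^sup>+u. \<integral>\<^sup>+f. of_bool (exceedance J y (\<lambda>t. u + f t - b t)) \<partial>process_law M W \<partial>?\<nu>)"
    unfolding \<phi>_def prod.case one_minus_exp_neg_top ..
  also have "\<dots> = (\<integral>\<^sup>+u. ennreal (exp (- u)) * (\<integral>\<^sup>+f. of_bool (exceedance J y (\<lambda>t. u + f t - b t)) \<partial>process_law M W) \<partial>lborel)"
    using L.borel_measurable_nn_integral_fst[OF E] by (intro nn_integral_density) simp_all
  also have "\<dots> = (\<integral>\<^sup>+u. \<integral>\<^sup>+f. ennreal (exp (- u)) * of_bool (exceedance J y (\<lambda>t. u + f t - b t)) \<partial>process_law M W \<partial>lborel)"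
    using measurable_compose[OF measurable_Pair1' E] by (intro nn_integral_cong nn_integral_cmult[symmetric]) simp
  also have "\<dots> = (\<integral>\<^sup>+f. \<integral>\<^sup>+u. ennreal (exp (- u)) * of_bool (exceedance J y (\<lambda>t. u + f t - b t)) \<partial>lborel \<partial>process_law M W)"
  proof (rule LU.Fubini'[symmetric])
    show "(\<lambda>(u, f). ennreal (exp (- u)) * of_bool (exceedance J y (\<lambda>t. u + f t - b t)))
        \<in> borel_measurable (lborel \<Otimes>\<^sub>M process_law M W)"
      unfolding case_prod_beta' by (rule borel_measurable_times_ennreal[OF _ E]) measurable
  qed
  also have "\<dots> = (\<integral>\<^sup>+f. exponent J y (\<lambda>t. f t - b t) \<partial>process_law M W)"
    by (simp add: exponent_def add_diff_eq)
  also have "\<dots> = (\<integral>\<^sup>+\<omega>. exponent J y (\<lambda>t. W t \<omega> - b t) \<partial>M)"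
    unfolding process_law_def
    by (rule nn_integral_distr[OF Wm], rule measurable_compose[OF _ exponent_measurable[OF J]], rule measurable_PiM_single') auto
  finally show ?thesis .
qed

section \<open>Realising points and marks on a sample space of prescribed type\<close>

locale coded_marked_sequence = A: prob_space A + B: prob_space B
  for A :: "(nat \<Rightarrow> 'p) measure" and B :: "'x measure" +
  fixes S :: "'p measure" and code :: "(nat \<Rightarrow> 'p) \<times> (nat \<Rightarrow> 'x) \<Rightarrow> 'z"
    and decode :: "'z \<Rightarrow> (nat \<Rightarrow> 'p) \<times> (nat \<Rightarrow> 'x)"
  assumes sets_A [measurable_cong]: "sets A = sets (Pi\<^sub>M UNIV (\<lambda>_. S))"
    and decode_code: "\<And>z. decode (code z) = z"
begin

sublocale BB: product_prob_space "\<lambda>_::nat. B" UNIV by unfold_locales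
sublocale AB: pair_prob_space A "Pi\<^sub>M UNIV (\<lambda>_::nat. B)" by unfold_locales

abbreviation C :: "((nat \<Rightarrow> 'p) \<times> (nat \<Rightarrow> 'x)) measure" where
  "C \<equiv> A \<Otimes>\<^sub>M Pi\<^sub>M UNIV (\<lambda>_. B)"

text \<open>\<open>code\<close> carries the product space \<open>C\<close> into the prescribed type,
  with \<open>decode\<close> as left inverse. The \<sigma>-algebra is pulled back along
  \<open>decode\<close>, which makes \<open>decode\<close> measurable and identifies sample points
  that it does not distinguish.\<close>

definition Q :: "'z measure" where
  "Q = distr C (vimage_algebra (decode -` space C) decode C) code"

lemma code_measurable: "code \<in> C \<rightarrow>\<^sub>M vimage_algebra (decode -` space C) decode C"
  by (rule measurable_vimage_algebra2) (auto simp: decode_code)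

lemma decode_measurable: "decode \<in> Q \<rightarrow>\<^sub>M C"
  unfolding Q_def measurable_distr_eq1 by (rule measurable_vimage_algebra1) auto

lemma distr_decode: "distr Q C decode = C"
proof -
  have "distr Q C decode = distr C C (decode \<circ> code)"
    unfolding Q_def by (rule distr_distr[OF _ code_measurable]) (rule measurable_vimage_algebra1, auto)
  then show ?thesis by (simp add: comp_def decode_code)
qed

sublocale Q: prob_space Q
  unfolding Q_def by (rule AB.prob_space_distr[OF code_measurable])

abbreviation points :: "'z \<Rightarrow> nat \<Rightarrow> 'p" where "points \<omega> \<equiv> fst (decode \<omega>)"
abbreviation marks :: "'z \<Rightarrow> nat \<Rightarrow> 'x" where "marks \<omega> \<equiv> snd (decode \<omega>)"

lemma points_measurable: "points \<in> Q \<rightarrow>\<^sub>M Pi\<^sub>M UNIV (\<lambda>_. S)"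
  using measurable_compose[OF decode_measurable measurable_fst] by (simp cong: measurable_cong_sets add: sets_A)

lemma marks_measurable: "marks \<in> Q \<rightarrow>\<^sub>M Pi\<^sub>M UNIV (\<lambda>_. B)"
  by (rule measurable_compose[OF decode_measurable measurable_snd])

lemma nn_integral_Q:
  assumes g[measurable]: "g \<in> borel_measurable C"
  shows "(\<integral>\<^sup>+\<omega>. g (decode \<omega>) \<partial>Q) = (\<integral>\<^sup>+p. \<integral>\<^sup>+x. g (p, x) \<partial>Pi\<^sub>M UNIV (\<lambda>_. B) \<partial>A)"
proof -
  have "(\<integral>\<^sup>+\<omega>. g (decode \<omega>) \<partial>Q) = (\<integral>\<^sup>+z. g z \<partial>distr Q C decode)"
    by (rule nn_integral_distr[OF decode_measurable, symmetric]) measurable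
  also have "\<dots> = (\<integral>\<^sup>+z. g z \<partial>C)" by (simp only: distr_decode)
  finally show ?thesis by (simp add: BB.P.nn_integral_fst)
qed

lemma distr_points: "distr Q (Pi\<^sub>M UNIV (\<lambda>_. S)) points = A"
proof -
  have "distr Q (Pi\<^sub>M UNIV (\<lambda>_. S)) points = distr Q A (fst \<circ> decode)"
    by (rule distr_cong) (simp_all add: sets_A)
  also have "\<dots> = distr (distr Q C decode) A fst"
    by (rule distr_distr[OF measurable_fst decode_measurable, symmetric])
  finally show ?thesis by (simp add: distr_decode BB.P.distr_pair_fst)
qed

lemma emeasure_points_marks:
  assumes X: "X \<in> sets A" and Y: "Y \<in> sets (Pi\<^sub>M UNIV (\<lambda>_. B))"
  shows "emeasure Q {\<omega> \<in> space Q. points \<omega> \<in> X \<and> marks \<omega> \<in> Y} = emeasure A X * emeasure (Pi\<^sub>M UNIV (\<lambda>_. B)) Y"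
proof -
  have "{\<omega> \<in> space Q. points \<omega> \<in> X \<and> marks \<omega> \<in> Y} = decode -` (X \<times> Y) \<inter> space Q"
    by (auto simp: mem_Times_iff)
  then have "emeasure Q {\<omega> \<in> space Q. points \<omega> \<in> X \<and> marks \<omega> \<in> Y} = emeasure (distr Q C decode) (X \<times> Y)"
    using X Y by (subst emeasure_distr[OF decode_measurable]) simp_all
  then show ?thesis using X Y by (simp add: distr_decode BB.P.emeasure_pair_measure_Times)
qed

lemma distr_marks: "distr Q (Pi\<^sub>M UNIV (\<lambda>_. B)) marks = Pi\<^sub>M UNIV (\<lambda>_. B)"
proof (rule measure_eqI)
  fix Y assume "Y \<in> sets (distr Q (Pi\<^sub>M UNIV (\<lambda>_. B)) marks)"
  then have Y: "Y \<in> sets (Pi\<^sub>M UNIV (\<lambda>_. B))" by simp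
  have "marks -` Y \<inter> space Q = {\<omega> \<in> space Q. points \<omega> \<in> space A \<and> marks \<omega> \<in> Y}"
    using measurable_space[OF decode_measurable] by (auto simp: space_pair_measure mem_Times_iff)
  then show "emeasure (distr Q (Pi\<^sub>M UNIV (\<lambda>_. B)) marks) Y = emeasure (Pi\<^sub>M UNIV (\<lambda>_. B)) Y"
    by (simp add: emeasure_distr[OF marks_measurable Y] emeasure_points_marks[OF sets.top Y] A.emeasure_space_1)
qed simp

lemma independent_points_marks:
  assumes g: "g \<in> Pi\<^sub>M UNIV (\<lambda>_. B) \<rightarrow>\<^sub>M L"
  shows "independent_rvs Q (Pi\<^sub>M UNIV (\<lambda>_. S)) points L (\<lambda>\<omega>. g (marks \<omega>))"
proof -
  have gm: "(\<lambda>\<omega>. g (marks \<omega>)) \<in> Q \<rightarrow>\<^sub>M L" by (rule measurable_compose[OF marks_measurable g])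
  have "Q.indep_set {points -` X \<inter> space Q |X. X \<in> sets (Pi\<^sub>M UNIV (\<lambda>_. S))}
     {(\<lambda>\<omega>. g (marks \<omega>)) -` Y \<inter> space Q |Y. Y \<in> sets L}"
    unfolding Q.indep_sets2_eq
  proof (intro conjI ballI)
    fix a b
    assume "a \<in> {points -` X \<inter> space Q |X. X \<in> sets (Pi\<^sub>M UNIV (\<lambda>_. S))}"
      and "b \<in> {(\<lambda>\<omega>. g (marks \<omega>)) -` Y \<inter> space Q |Y. Y \<in> sets L}"
    then obtain X Y where X: "X \<in> sets (Pi\<^sub>M UNIV (\<lambda>_. S))" "a = points -` X \<inter> space Q"
      and Y: "Y \<in> sets L" "b = (\<lambda>\<omega>. g (marks \<omega>)) -` Y \<inter> space Q" by auto
    let ?Y = "g -` Y \<inter> space (Pi\<^sub>M UNIV (\<lambda>_. B))"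
    have Y': "?Y \<in> sets (Pi\<^sub>M UNIV (\<lambda>_. B))" by (rule measurable_sets[OF g Y(1)])
    have b: "b = marks -` ?Y \<inter> space Q" using measurable_space[OF marks_measurable] by (auto simp: Y)
    have "emeasure Q a = emeasure A X"
      using X emeasure_distr[OF points_measurable X(1)] by (simp add: distr_points)
    moreover have "emeasure Q b = emeasure (Pi\<^sub>M UNIV (\<lambda>_. B)) ?Y"
      using emeasure_distr[OF marks_measurable Y'] by (simp add: distr_marks b)
    moreover have "a \<inter> b = {\<omega> \<in> space Q. points \<omega> \<in> X \<and> marks \<omega> \<in> ?Y}" by (auto simp: X b)
    ultimately have "emeasure Q (a \<inter> b) = emeasure Q a * emeasure Q b"
      using emeasure_points_marks[OF _ Y', of X] X(1) by (simp add: sets_A)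
    then show "Q.prob (a \<inter> b) = Q.prob a * Q.prob b"
      by (simp add: Q.emeasure_eq_measure flip: ennreal_mult)
  qed (use measurable_sets[OF points_measurable] measurable_sets[OF gm] in auto)
  then show ?thesis using points_measurable gm by (simp add: independent_rvs_def)
qed

lemma mark_measurable: "(\<lambda>\<omega>. marks \<omega> i) \<in> Q \<rightarrow>\<^sub>M B"
  by (rule measurable_compose[OF marks_measurable measurable_component_singleton]) simp

lemma point_measurable: "(\<lambda>\<omega>. points \<omega> i) \<in> Q \<rightarrow>\<^sub>M S"
  by (rule measurable_compose[OF points_measurable measurable_component_singleton]) simp

lemma indep_marks: "Q.indep_vars (\<lambda>_. B) (\<lambda>i \<omega>. marks \<omega> i) UNIV"
  and distr_mark: "distr Q B (\<lambda>\<omega>. marks \<omega> i) = B"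
proof -
  have law: "distr Q B (\<lambda>\<omega>. marks \<omega> i) = B" for i
  proof -
    have "distr Q B (\<lambda>\<omega>. marks \<omega> i) = distr (distr Q (Pi\<^sub>M UNIV (\<lambda>_. B)) marks) B (\<lambda>x. x i)"
      by (subst distr_distr[OF _ marks_measurable]) (simp_all add: comp_def)
    then show ?thesis by (simp add: distr_marks BB.PiM_component)
  qed
  show "distr Q B (\<lambda>\<omega>. marks \<omega> i) = B" by (rule law)
  show "Q.indep_vars (\<lambda>_. B) (\<lambda>i \<omega>. marks \<omega> i) UNIV"
    by (subst Q.indep_vars_iff_distr_eq_PiM) (simp_all add: mark_measurable law restrict_def distr_marks)
qed

text \<open>The law of a sequence decides whether it is a Poisson process. The Laplace
  characterisation makes this a change of variables, as \<open>points\<close> has law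
  \<open>A\<close>.\<close>

lemma poisson_points:
  assumes ppp: "poisson_point_process A \<mu> (\<lambda>i p. p i)" and S: "sets S = sets \<mu>"
  shows "poisson_point_process Q \<mu> (\<lambda>i \<omega>. points \<omega> i)"
proof (rule poisson_point_processI_laplace[OF Q.prob_space_axioms])
  interpret P: ppp A \<mu> "\<lambda>i p. p i" using A.prob_space_axioms ppp by (simp add: ppp_def ppp_axioms_def)
  note S[measurable_cong]
  show "(\<lambda>\<omega>. points \<omega> i) \<in> Q \<rightarrow>\<^sub>M \<mu>" for i
    using point_measurable by (simp cong: measurable_cong_sets add: S)
  fix \<phi> :: "'p \<Rightarrow> ennreal" assume \<phi>[measurable]: "\<phi> \<in> borel_measurable \<mu>"
  have m: "(\<lambda>p. exp_neg (\<Sum>i. \<phi> (p i))) \<in> borel_measurable (Pi\<^sub>M UNIV (\<lambda>_. S))" by measurable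
  have "(\<integral>\<^sup>+\<omega>. exp_neg (\<Sum>i. \<phi> (points \<omega> i)) \<partial>Q) = (\<integral>\<^sup>+p. exp_neg (\<Sum>i. \<phi> (p i)) \<partial>A)"
    by (subst distr_points[symmetric], subst nn_integral_distr[OF points_measurable]) (simp_all add: m)
  also have "\<dots> = exp_neg (\<integral>\<^sup>+x. 1 - exp_neg (\<phi> x) \<partial>\<mu>)" by (rule P.laplace_functional[OF \<phi>])
  finally show "(\<integral>\<^sup>+\<omega>. exp_neg (\<Sum>i. \<phi> (points \<omega> i)) \<partial>Q) = exp_neg (\<integral>\<^sup>+x. 1 - exp_neg (\<phi> x) \<partial>\<mu>)" .
qed

end

section \<open>Distribution functions of the moving maxima\<close>

lemma (in spectral_process) mover_measurable [measurable]: "mover t \<in> borel_measurable mover_law"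
  using measurable_compose[OF measurable_Pair1' measurable_process_mover[unfolded measurable_process_def], of t] by simp

lemma (in spectral_process) mover_path_measurable: "(\<lambda>f t. mover t f) \<in> mover_law \<rightarrow>\<^sub>M path_space"
  by (rule measurable_PiM_single') auto

text \<open>The points are \<open>(s, u)\<close> and the marks are paths. For fixed \<open>s\<close>
  and path, integrating over \<open>u\<close> turns the exceedance indicator into
  \<open>exponent\<close> of the shifted mover. The remaining integral is the moving representation
  read backwards, which applies because \<open>exponent\<close> is homogeneous.\<close>

lemma (in spectral_process) emeasure_moving_maxima_le:
  fixes K :: "(nat \<Rightarrow> 'a \<times> real) measure" and Q :: "'q measure"
  assumes K: "prob_space K" "poisson_point_process K (density (lborel \<Otimes>\<^sub>M lborel) (\<lambda>(t, y). ennreal (exp (- y)))) (\<lambda>i p. p i)"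
    and J: "finite J"
  shows "(\<integral>\<^sup>+p. \<integral>\<^sup>+x. exp_neg (\<Sum>i. \<top> * of_bool (exceedance J y (\<lambda>t. mover (t - fst (p i)) (x i) + snd (p i))))
        \<partial>Pi\<^sub>M UNIV (\<lambda>_. mover_law) \<partial>K)
    = exp_neg (\<integral>\<^sup>+\<omega>. exponent J y (\<lambda>t. v t \<omega>) \<partial>M)"
proof -
  let ?\<mu> = "density (lborel \<Otimes>\<^sub>M lborel) (\<lambda>(t :: 'a, y). ennreal (exp (- y)))"
  interpret K: ppp K ?\<mu> "\<lambda>i p. p i" using K by (simp add: ppp_def ppp_axioms_def)
  interpret P: prob_space mover_law by (rule prob_space_mover_law)
  interpret LP: pair_sigma_finite lborel mover_law by unfold_locales
  let ?E = "\<lambda>s u f. of_bool (exceedance J y (\<lambda>t. mover (t - s) f + u)) :: ennreal"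
  have mover_joint: "(\<lambda>(t, f). mover t f) \<in> borel_measurable (borel \<Otimes>\<^sub>M mover_law)"
    using measurable_process_mover by (simp add: measurable_process_def)
  have mover_shift: "(\<lambda>z. mover (t - fst (fst z)) (snd z)) \<in> borel_measurable ((lborel \<Otimes>\<^sub>M (lborel :: real measure)) \<Otimes>\<^sub>M mover_law)" for t
  proof -
    have "(\<lambda>z. (t - fst (fst z), snd z)) \<in> ((lborel :: 'a measure) \<Otimes>\<^sub>M (lborel :: real measure)) \<Otimes>\<^sub>M mover_law \<rightarrow>\<^sub>M borel \<Otimes>\<^sub>M mover_law"
      by (intro measurable_Pair) measurable
    from measurable_compose[OF this mover_joint] show ?thesis by simp
  qed
  have E: "(\<lambda>z. ?E (fst (fst z)) (snd (fst z)) (snd z)) \<in> borel_measurable ((lborel \<Otimes>\<^sub>M lborel) \<Otimes>\<^sub>M mover_law)"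
    by (intro exceedance_measurable[OF J] borel_measurable_add mover_shift) measurable
  have E1: "(\<lambda>f. ?E s u f) \<in> borel_measurable mover_law" for s u
    by (intro exceedance_measurable[OF J] borel_measurable_add) measurable
  have E2: "(\<lambda>z. ?E s (fst z) (snd z)) \<in> borel_measurable (lborel \<Otimes>\<^sub>M mover_law)" for s
    by (intro exceedance_measurable[OF J] borel_measurable_add) measurable
  have EI: "(\<lambda>p. \<integral>\<^sup>+f. ?E (fst p) (snd p) f \<partial>mover_law) \<in> borel_measurable (lborel \<Otimes>\<^sub>M lborel)"
    using P.borel_measurable_nn_integral_fst[OF E] by simp
  define \<phi> where "\<phi> = (\<lambda>(p, f). \<top> * ?E (fst p) (snd p) f)"
  have "sets (?\<mu> \<Otimes>\<^sub>M mover_law) = sets ((lborel \<Otimes>\<^sub>M lborel) \<Otimes>\<^sub>M mover_law)"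
    by (intro sets_pair_measure_cong) simp_all
  then have \<phi>: "\<phi> \<in> borel_measurable (?\<mu> \<Otimes>\<^sub>M mover_law)"
    unfolding \<phi>_def case_prod_beta' using borel_measurable_times_ennreal[OF borel_measurable_const E]
    by (simp cong: measurable_cong_sets)
  have "(\<integral>\<^sup>+p. \<integral>\<^sup>+x. exp_neg (\<Sum>i. \<top> * ?E (fst (p i)) (snd (p i)) (x i)) \<partial>Pi\<^sub>M UNIV (\<lambda>_. mover_law) \<partial>K)
    = exp_neg (\<integral>\<^sup>+p. \<integral>\<^sup>+x. 1 - exp_neg (\<phi> (p, x)) \<partial>mover_law \<partial>?\<mu>)"
    using K.laplace_functional_marked[OF prob_space_mover_law \<phi>] unfolding \<phi>_def prod.case .
  also have "(\<integral>\<^sup>+p. \<integral>\<^sup>+x. 1 - exp_neg (\<phi> (p, x)) \<partial>mover_law \<partial>?\<mu>)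
    = (\<integral>\<^sup>+p. \<integral>\<^sup>+f. ?E (fst p) (snd p) f \<partial>mover_law \<partial>?\<mu>)"
    unfolding \<phi>_def prod.case one_minus_exp_neg_top ..
  also have "\<dots> = (\<integral>\<^sup>+p. ennreal (exp (- snd p)) * (\<integral>\<^sup>+f. ?E (fst p) (snd p) f \<partial>mover_law) \<partial>(lborel \<Otimes>\<^sub>M lborel))"
    unfolding case_prod_beta' by (intro nn_integral_density EI) measurable
  also have "\<dots> = (\<integral>\<^sup>+s. \<integral>\<^sup>+u. ennreal (exp (- u)) * (\<integral>\<^sup>+f. ?E s u f \<partial>mover_law) \<partial>lborel \<partial>lborel)"
    using borel_measurable_times_ennreal[OF _ EI, of "\<lambda>p. ennreal (exp (- snd p))"]
    by (subst lborel.nn_integral_fst[symmetric]) simp_all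
  also have "\<dots> = (\<integral>\<^sup>+s. \<integral>\<^sup>+u. \<integral>\<^sup>+f. ennreal (exp (- u)) * ?E s u f \<partial>mover_law \<partial>lborel \<partial>lborel)"
    by (intro nn_integral_cong nn_integral_cmult[symmetric] E1)
  also have "\<dots> = (\<integral>\<^sup>+s. \<integral>\<^sup>+f. \<integral>\<^sup>+u. ennreal (exp (- u)) * ?E s u f \<partial>lborel \<partial>mover_law \<partial>lborel)"
  proof (rule nn_integral_cong, rule LP.Fubini'[symmetric])
    show "(\<lambda>(u, f). ennreal (exp (- u)) * ?E s u f) \<in> borel_measurable (lborel \<Otimes>\<^sub>M mover_law)" for s
      unfolding case_prod_beta' by (rule borel_measurable_times_ennreal[OF _ E2]) measurable
  qed
  also have "\<dots> = (\<integral>\<^sup>+s. \<integral>\<^sup>+f. exponent J y (\<lambda>t. mover (t - s) f) \<partial>mover_law \<partial>lborel)"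
    by (simp add: exponent_def add.commute)
  also have "\<dots> = (\<integral>\<^sup>+\<omega>. exponent J y (\<lambda>t. v t \<omega>) \<partial>M)"
    by (rule mover_moving_representation[OF exponent_measurable[OF J] exponent_homogeneous[OF J], symmetric])
  finally show ?thesis .
qed

text \<open>
  In the type of the measure \<open>Q\<close> in the definition of a mixed moving maxima representation the symbol
  \<open>^\<close> binds weaker than \<open>\<times>\<close>, so the first component of its entries is a vector
  with an infinite index type, about which nothing but non-emptiness is known. Everything is therefore coded
  in the second components: a point \<open>(t, y)\<close> as the affine function \<open>s \<mapsto> s \<bullet> t + y\<close> at the even indices,
  the paths at the odd ones.
\<close>

definition path_code ::
    "(nat \<Rightarrow> 'a::euclidean_space \<times> real) \<times> (nat \<Rightarrow> 'a \<Rightarrow> real) \<Rightarrow> nat \<Rightarrow> 'u \<times> ('a \<Rightarrow> real)" where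
  "path_code z = (\<lambda>n. (undefined, if even n then \<lambda>s. s \<bullet> fst (fst z (n div 2)) + snd (fst z (n div 2)) else snd z (n div 2)))"

definition path_decode ::
    "(nat \<Rightarrow> 'u \<times> ('a::euclidean_space \<Rightarrow> real)) \<Rightarrow> (nat \<Rightarrow> 'a \<times> real) \<times> (nat \<Rightarrow> 'a \<Rightarrow> real)" where
  "path_decode \<omega> =
    (\<lambda>i. (\<Sum>b\<in>Basis. (snd (\<omega> (2 * i)) b - snd (\<omega> (2 * i)) 0) *\<^sub>R b, snd (\<omega> (2 * i)) 0),
     \<lambda>i. snd (\<omega> (2 * i + 1)))"

text \<open>The value of an affine function at \<open>0\<close> is its constant, and its increments
  along the basis vectors are the coordinates of its gradient; so a coded point is recovered from
  finitely many evaluations.\<close>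

lemma path_decode_code: "path_decode (path_code z) = z"
  by (cases z) (simp add: path_decode_def path_code_def inner_commute[of _ "fst _"] euclidean_representation)

theorem theorem14:
  fixes M :: "'w measure" and W :: "real^'d \<Rightarrow> 'w \<Rightarrow> real" and \<sigma>2 :: "real^'d \<Rightarrow> real"
    and N :: "'v measure" and U :: "nat \<Rightarrow> 'v \<Rightarrow> real" and Ws :: "nat \<Rightarrow> real^'d \<Rightarrow> 'v \<Rightarrow> real"
  assumes "prob_space M"
    and "gaussian_process M W"
    and "zero_mean M W"
    and "stationary_increments M W"
    and "sample_continuous M W"
    and "\<And>t. \<sigma>2 t = prob_space.variance M (W t)"
    and "AE \<omega> in M. filterlim (\<lambda>t. W t \<omega> - \<sigma>2 t / 2) at_bot at_infinity"
    and "prob_space N"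
    and "independent_copies N Ws M W"
    and "poisson_point_process N (density lborel (\<lambda>y. ennreal (exp (- y)))) U"
    and "points_independent_of N borel U Ws"
  shows "has_mixed_moving_maxima_representation N
           (\<lambda>t \<omega>. SUP i. ereal (U i \<omega> + Ws i t \<omega> - \<sigma>2 t / 2))"
proof -
  interpret W: stationary_gaussian_increments M W
    using assms(1-5)
    by (simp add: stationary_gaussian_increments_def stationary_gaussian_increments_axioms_def
        centered_gaussian_process_def centered_gaussian_process_axioms_def)
  \<comment> \<open>The mean is zero, so the variance is the second moment.\<close>
  have var: "W.var = \<sigma>2"
    using assms(3) by (simp add: fun_eq_iff W.var_def assms(6) zero_mean_def)
  obtain v where v: "spectral_process M v" and AE_v: "\<And>t. AE \<omega> in M. v t \<omega> = W t \<omega> - \<sigma>2 t / 2"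
    using W.spectral_modification[unfolded var, OF assms(7)] by blast
  interpret v: spectral_process M v by (rule v)
  let ?\<mu> = "density (lborel \<Otimes>\<^sub>M lborel) (\<lambda>(t :: real^'d, y). ennreal (exp (- y)))"
  \<comment> \<open>\<open>U\<close> is the only Poisson process at hand; giving its points random
    locations yields one on the product space.\<close>
  obtain K :: "(nat \<Rightarrow> (real^'d) \<times> real) measure"
    where K: "prob_space K" and sets_K: "sets K = sets (Pi\<^sub>M UNIV (\<lambda>_. borel \<Otimes>\<^sub>M borel))"
      and ppp_K: "poisson_point_process K ?\<mu> (\<lambda>i p. p i)"
    using exists_poisson_point_process_product[OF assms(8,10)] by blast
  \<comment> \<open>The annotation spells out the sample type of the representation, whose entries
    begin with a vector over \<open>'d \<times> real\<close>.\<close>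
  interpret mark: coded_marked_sequence K v.mover_law "borel \<Otimes>\<^sub>M borel" path_code
      "path_decode :: (nat \<Rightarrow> (real, 'd \<times> real) vec \<times> (real^'d \<Rightarrow> real)) \<Rightarrow> _"
    using K v.prob_space_mover_law sets_K
    by (simp add: coded_marked_sequence_def coded_marked_sequence_axioms_def path_decode_code)
  let ?Q = "mark.Q"
  define T where "T i \<omega> = fst (mark.points \<omega> i)" for i \<omega>
  define Y where "Y i \<omega> = snd (mark.points \<omega> i)" for i \<omega>
  define Fs where "Fs i t \<omega> = v.mover t (mark.marks \<omega> i)" for i t \<omega>
  define Z where "Z t \<omega> = (SUP i. ereal (Fs i (t - T i \<omega>) \<omega> + Y i \<omega>))" for t \<omega>
  have mover_joint: "(\<lambda>(t, f). v.mover t f) \<in> borel_measurable (borel \<Otimes>\<^sub>M v.mover_law)"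
    using v.measurable_process_mover by (simp add: measurable_process_def)
  have process: "measurable_process ?Q (Fs i)" for i
  proof -
    have "(\<lambda>z. (fst z, mark.marks (snd z) i)) \<in> borel \<Otimes>\<^sub>M ?Q \<rightarrow>\<^sub>M borel \<Otimes>\<^sub>M v.mover_law"
      by (intro measurable_Pair measurable_compose[OF measurable_snd mark.mark_measurable]) simp
    from measurable_compose[OF this mover_joint] show ?thesis
      by (simp add: measurable_process_def Fs_def case_prod_beta')
  qed
  have Tm: "T i \<in> ?Q \<rightarrow>\<^sub>M borel" and Ym[measurable]: "Y i \<in> ?Q \<rightarrow>\<^sub>M borel" for i
    unfolding T_def[abs_def] Y_def[abs_def] using mark.point_measurable by measurable
  have term_measurable: "(\<lambda>\<omega>. Fs i (t - T i \<omega>) \<omega> + Y i \<omega>) \<in> borel_measurable ?Q" for i t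
  proof (rule borel_measurable_add)
    have "(\<lambda>\<omega>. (t - T i \<omega>, \<omega>)) \<in> ?Q \<rightarrow>\<^sub>M borel \<Otimes>\<^sub>M ?Q"
      using Tm by measurable
    from measurable_compose[OF this process[unfolded measurable_process_def]]
    show "(\<lambda>\<omega>. Fs i (t - T i \<omega>) \<omega>) \<in> borel_measurable ?Q" by simp
  qed measurable
  have ppp_Q: "poisson_point_process ?Q ?\<mu> (\<lambda>i \<omega>. (T i \<omega>, Y i \<omega>))"
    unfolding T_def Y_def prod.collapse by (rule mark.poisson_points[OF ppp_K]) simp
  have copies: "independent_copies ?Q Fs v.mover_law v.mover"
    unfolding independent_copies_def process_law_def Fs_def
  proof (intro conjI allI)
    show "mark.Q.indep_vars (\<lambda>_. path_space) (\<lambda>i \<omega> t. v.mover t (mark.marks \<omega> i)) UNIV"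
      by (rule mark.Q.indep_vars_compose2[OF mark.indep_marks v.mover_path_measurable])
    fix i
    have "distr ?Q path_space (\<lambda>\<omega> t. v.mover t (mark.marks \<omega> i))
        = distr (distr ?Q v.mover_law (\<lambda>\<omega>. mark.marks \<omega> i)) path_space (\<lambda>f t. v.mover t f)"
      by (subst distr_distr[OF v.mover_path_measurable mark.mark_measurable]) (simp add: comp_def)
    then show "distr ?Q path_space (\<lambda>\<omega> t. v.mover t (mark.marks \<omega> i)) = distr v.mover_law path_space (\<lambda>f t. v.mover t f)"
      by (simp only: mark.distr_mark)
  qed
  have indep: "points_independent_of ?Q (borel \<Otimes>\<^sub>M borel) (\<lambda>i \<omega>. (T i \<omega>, Y i \<omega>)) Fs"
    unfolding points_independent_of_def T_def Y_def prod.collapse Fs_def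
  proof (rule mark.independent_points_marks)
    show "(\<lambda>x i t. v.mover t (x i)) \<in> Pi\<^sub>M UNIV (\<lambda>_. v.mover_law) \<rightarrow>\<^sub>M Pi\<^sub>M UNIV (\<lambda>_. path_space)"
      by (intro measurable_PiM_single' measurable_compose[OF _ v.mover_measurable]) (auto simp: space_PiM)
  qed
  have "mixed_moving_maxima v.mover_law v.mover ?Q Z"
    unfolding mixed_moving_maxima_def
  proof (intro conjI exI)
    show "(\<integral>\<^sup>+\<omega>. (\<integral>\<^sup>+t. ennreal (exp (v.mover t \<omega>)) \<partial>lborel) \<partial>v.mover_law) < \<infinity>"
      by (simp add: v.mover_exp_integral)
    show "\<forall>t. \<forall>\<omega>\<in>space ?Q. Z t \<omega> = (SUP i. ereal (Fs i (t - T i \<omega>) \<omega> + Y i \<omega>))"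
      by (simp add: Z_def)
  qed (use v.prob_space_mover_law v.measurable_process_mover mark.Q.prob_space_axioms ppp_Q process copies indep in auto)
  moreover have "process_law N (\<lambda>t \<omega>. SUP i. ereal (U i \<omega> + Ws i t \<omega> - \<sigma>2 t / 2)) = process_law ?Q Z"
    unfolding process_law_def
  proof (rule distr_path_space_eqI_atMost[OF assms(8) mark.Q.prob_space_axioms])
    interpret N: prob_space N by (rule assms(8))
    have Um: "U i \<in> borel_measurable N" for i using assms(10) by (simp add: poisson_point_process_def)
    have "(\<lambda>\<omega> t. Ws i t \<omega>) \<in> N \<rightarrow>\<^sub>M path_space" for i
      using assms(9) by (simp add: independent_copies_def N.indep_vars_def2)
    from measurable_compose[OF this measurable_component_singleton]
    have Wsm: "Ws i t \<in> borel_measurable N" for i t by simp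
    show "(\<lambda>\<omega>. SUP i. ereal (U i \<omega> + Ws i t \<omega> - \<sigma>2 t / 2)) \<in> borel_measurable N" for t
      using Um Wsm by measurable
    show "Z t \<in> borel_measurable ?Q" for t
      unfolding Z_def[abs_def] using term_measurable by measurable
    fix J :: "(real^'d) set" and y assume J: "finite J"
    have "emeasure N {\<omega> \<in> space N. \<forall>t\<in>J. (SUP i. ereal (U i \<omega> + Ws i t \<omega> - \<sigma>2 t / 2)) \<le> y t}
      = exp_neg (\<integral>\<^sup>+\<omega>. exponent J y (\<lambda>t. W t \<omega> - \<sigma>2 t / 2) \<partial>M)"
      by (rule emeasure_gaussian_maxima_le[OF assms(1,8) W.W_measurable assms(9,10,11) J])
    also have "(\<integral>\<^sup>+\<omega>. exponent J y (\<lambda>t. W t \<omega> - \<sigma>2 t / 2) \<partial>M) = (\<integral>\<^sup>+\<omega>. exponent J y (\<lambda>t. v t \<omega>) \<partial>M)"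
    proof (rule nn_integral_cong_AE)
      \<comment> \<open>For each \<open>t\<close> the modification agrees outside a null set of its
        own; finitely many coordinates are involved here, so these sets can be united.\<close>
      have "AE \<omega> in M. \<forall>t\<in>J. v t \<omega> = W t \<omega> - \<sigma>2 t / 2"
        using J AE_v by (intro AE_finite_allI) auto
      then show "AE \<omega> in M. exponent J y (\<lambda>t. W t \<omega> - \<sigma>2 t / 2) = exponent J y (\<lambda>t. v t \<omega>)"
        by eventually_elim (simp add: exponent_def exceedance_def)
    qed
    also have "exp_neg (\<integral>\<^sup>+\<omega>. exponent J y (\<lambda>t. v t \<omega>) \<partial>M)
      = (\<integral>\<^sup>+\<omega>. exp_neg (\<Sum>i. \<top> * of_bool (exceedance J y (\<lambda>t. Fs i (t - T i \<omega>) \<omega> + Y i \<omega>))) \<partial>?Q)"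
    proof -
      \<comment> \<open>The integrand as a function of the decoded pair, so that the integral over
        \<open>?Q\<close> becomes an iterated integral over points and marks.\<close>
      let ?g = "\<lambda>z. exp_neg (\<Sum>i. \<top> * of_bool (exceedance J y (\<lambda>t. v.mover (t - fst (fst z i)) (snd z i) + snd (fst z i))))"
      have "?g \<in> borel_measurable (K \<Otimes>\<^sub>M Pi\<^sub>M UNIV (\<lambda>_. v.mover_law))"
      proof (intro measurable_compose[OF _ borel_measurable_exp_neg] borel_measurable_suminf_order
            borel_measurable_times_ennreal borel_measurable_const exceedance_measurable[OF J] borel_measurable_add)
        fix i t
        have p: "(\<lambda>z. fst z i) \<in> K \<Otimes>\<^sub>M Pi\<^sub>M UNIV (\<lambda>_::nat. v.mover_law) \<rightarrow>\<^sub>M borel \<Otimes>\<^sub>M borel"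
          by (rule measurable_compose[OF measurable_fst]) (simp cong: measurable_cong_sets add: sets_K)
        show "(\<lambda>z. snd (fst z i)) \<in> borel_measurable (K \<Otimes>\<^sub>M Pi\<^sub>M UNIV (\<lambda>_::nat. v.mover_law))"
          by (rule measurable_compose[OF p measurable_snd])
        have "(\<lambda>z. (t - fst (fst z i), snd z i)) \<in> K \<Otimes>\<^sub>M Pi\<^sub>M UNIV (\<lambda>_::nat. v.mover_law) \<rightarrow>\<^sub>M borel \<Otimes>\<^sub>M v.mover_law"
          by (intro measurable_Pair borel_measurable_diff borel_measurable_const measurable_compose[OF p measurable_fst]
              measurable_compose[OF measurable_snd measurable_component_singleton]) simp
        from measurable_compose[OF this mover_joint]
        show "(\<lambda>z. v.mover (t - fst (fst z i)) (snd z i)) \<in> borel_measurable (K \<Otimes>\<^sub>M Pi\<^sub>M UNIV (\<lambda>_::nat. v.mover_law))"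
          by simp
      qed
      from mark.nn_integral_Q[OF this]
      have "(\<integral>\<^sup>+\<omega>. exp_neg (\<Sum>i. \<top> * of_bool (exceedance J y (\<lambda>t. Fs i (t - T i \<omega>) \<omega> + Y i \<omega>))) \<partial>?Q)
        = (\<integral>\<^sup>+p. \<integral>\<^sup>+x. exp_neg (\<Sum>i. \<top> * of_bool (exceedance J y (\<lambda>t. v.mover (t - fst (p i)) (x i) + snd (p i))))
            \<partial>Pi\<^sub>M UNIV (\<lambda>_. v.mover_law) \<partial>K)"
        by (simp only: Fs_def T_def Y_def fst_conv snd_conv)
      then show ?thesis by (simp only: v.emeasure_moving_maxima_le[OF K ppp_K J])
    qed
    also have "\<dots> = emeasure ?Q {\<omega> \<in> space ?Q. \<forall>t\<in>J. Z t \<omega> \<le> y t}"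
      unfolding Z_def by (rule emeasure_Sup_le[OF J term_measurable, symmetric])
    finally show "emeasure N {\<omega> \<in> space N. \<forall>t\<in>J. (SUP i. ereal (U i \<omega> + Ws i t \<omega> - \<sigma>2 t / 2)) \<le> y t}
      = emeasure ?Q {\<omega> \<in> space ?Q. \<forall>t\<in>J. Z t \<omega> \<le> y t}" .
  qed
  ultimately have "mixed_moving_maxima v.mover_law v.mover ?Q Z \<and>
      process_law N (\<lambda>t \<omega>. SUP i. ereal (U i \<omega> + Ws i t \<omega> - \<sigma>2 t / 2)) = process_law ?Q Z" ..
  then show ?thesis
    unfolding has_mixed_moving_maxima_representation_def by (intro exI)
qed

end
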